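(* Assume the setting given in the context, and suppose the following hold. (A1) (a) $\Pi$ is a proper prior on $\mathbb{R}^p$ with a bounded and continuous p.d.f. $\pi$ with $\pi(\boldsymbol\beta_0)>0$; (b) $\int \|\boldsymbol\beta\|^2\pi(\boldsymbol\beta)\,d\boldsymbol\beta<\infty$. (A2) There is $M>0$ with $\|\mathbf X_i\|\le M$ for all $i$. (A3) (a) The first coordinate of each $\mathbf X_i$ is identically $1$ and, after appropriate centering of the other coordinates (subtracting a suitable constant from each of them), there is $\epsilon_0>0$ such that $\liminf_{n\to\infty}\frac1n\sum_{i=1}^n I_{(\mathbf X_i\in D)}>0$ for every $D\subset\mathbb{R}^p$ of the form $\{1\}\times U_2\times\cdots\times U_p$ where, for some $j$, $U_j$ is either $(\epsilon_0,\infty)$ or $(-\infty,-\epsilon_0)$ and, for each $k\ne j$, $U_k$ is either $(0,\infty)$ or $(-\infty,0)$; (b) there is $C>0$ such that for all sufficiently small $\Delta>0$, $P(0<Z_i<\Delta)>C\Delta$ and $P(-\Delta<Z_i<0)>C\Delta$ for all $i$. (A4) $\limsup_{m\to\infty}\frac1m\sum_{i=1}^m E|Z_i|<\infty$ and $\sum_{i=1}^\infty \frac{E Z_i^2}{i^2}<\infty$. (A5) (a) $\{p_i(\mathbf X_i^T\boldsymbol\beta_0): i\ge1\}$ is uniformly bounded away from $\infty$; (b) for some $C,\eta>0$ and all $\boldsymbol\beta$ in some small enough neighborhood of $\boldsymbol\beta_0$, $|p_i(\mathbf X_i^T\boldsymbol\beta)-p_i(\mathbf X_i^T\boldsymbol\beta_0)|\le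 C|\mathbf X_i^T\boldsymbol\beta-\mathbf X_i^T\boldsymbol\beta_0|^\eta$ for all $i$. Then, with suprema over Borel sets $B\subset\mathbb{R}^p$: (a) $\displaystyle\sup_{B}\left|\Pi_n\left(\sqrt n(\boldsymbol\beta-\boldsymbol\beta_0)\in B\right)-\Phi\left(B,\ \sqrt n(\tilde{\boldsymbol\beta}_n-\boldsymbol\beta_0),\ V^{-1}\right)\right|\to 0$ in probability $[P]$; (b) $\displaystyle\sup_{B}\left|\Pi_n^{prop}\left(\sqrt n(\boldsymbol\beta-\boldsymbol\beta_0)\in B\right)-\Phi\left(B,\ \sqrt n(\tilde{\boldsymbol\beta}_n-\boldsymbol\beta_0),\ \Sigma\right)\right|\to 0$ in probability $[P]$.
   Context: Fix $\tau\in(0,1)$. $Y_1,Y_2,\dots$ are independent (not necessarily identically distributed) real random variables, $Y_i$ having p.d.f. $p_i$; $P=\prod_{i\ge1}p_i$ is the infinite product probability and $E$ the expectation under it. $\mathbf X_1,\mathbf X_2,\dots\in\mathbb{R}^p$ are non-random covariate vectors. The true $\tau$-th quantile of $Y_i$ is $\mathbf X_i^T\boldsymbol\beta_0$ for a fixed $\boldsymbol\beta_0\in\mathbb{R}^p$; with $Z_i:=Y_i-\mathbf X_i^T\boldsymbol\beta_0$, $P(Z_i\le0)=\tau$. $I_{(\cdot)}$ denotes an indicator. Let $\rho_\tau(u)=u(\tau-I_{(u\le0)})$. The (possibly misspecified) asymmetric Laplace likelihood is $f^{(n)}_{\boldsymbol\beta}=\prod_{i=1}^n f_{i\boldsymbol\beta}(Y_i)$,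 where $f_{i\boldsymbol\beta}(y)=\tau(1-\tau)\exp\{-\rho_\tau(y-\mathbf X_i^T\boldsymbol\beta)\}$, $y\in\mathbb{R}$. The posterior for a prior $\Pi$ with p.d.f. $\pi$ on $\mathbb{R}^p$ is $$\Pi_n(\boldsymbol\beta\in B)=\frac{\int_B f^{(n)}_{\boldsymbol\beta}\pi(\boldsymbol\beta)\,d\boldsymbol\beta}{\int_{\mathbb{R}^p} f^{(n)}_{\boldsymbol\beta}\pi(\boldsymbol\beta)\,d\boldsymbol\beta}.$$ Let $\tilde{\boldsymbol\beta}_n$ and $\frac1n V_n^{-1}$ denote the mean and covariance matrix of $\boldsymbol\beta$ under $\Pi_n$. Let $S_n=\frac1n\sum_{i=1}^n\mathbf X_i\mathbf X_i^T$, $S=\lim_{n\to\infty}S_n$, $V=\lim_{n\to\infty}\frac1n\sum_{i=1}^n p_i(\mathbf X_i^T\boldsymbol\beta_0)\mathbf X_i\mathbf X_i^T$ (both limits are assumed to exist, and $V$, $S$ to be invertible), and $$\Sigma=\tau(1-\tau)V^{-1}SV^{-1},\qquad \Sigma_n=\tau(1-\tau)V_n^{-1}S_nV_n^{-1}.$$ The sandwich likelihood is $$g^{(n)}_{\boldsymbol\beta}=\frac{1}{|\Sigma_n/n|^{1/2}}\exp\left\{-\frac n2(\tilde{\boldsymbol\beta}_n-\boldsymbol\beta)^T\Sigma_n^{-1}(\tilde{\boldsymbol\beta}_n-\boldsymbol\beta)\right\},$$ and the corresponding posterior is $$\Pi_n^{prop}(\boldsymbol\beta\in B)=\frac{\int_B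 g^{(n)}_{\boldsymbol\beta}\pi(\boldsymbol\beta)\,d\boldsymbol\beta}{\int_{\mathbb{R}^p} g^{(n)}_{\boldsymbol\beta}\pi(\boldsymbol\beta)\,d\boldsymbol\beta}.$$ $\Phi(B,\boldsymbol\mu,\boldsymbol\Sigma)$ is the probability of $B$ under the multivariate normal distribution with mean $\boldsymbol\mu$ and covariance matrix $\boldsymbol\Sigma$. *)

theory Defs
  imports "HOL-Probability.Probability"
begin

text \<open>
  Throughout, \<open>X :: nat \<Rightarrow> real^'d\<close> is the sequence of covariate vectors and
  \<open>y :: nat \<Rightarrow> real\<close> a realisation of the responses. Both are indexed from 1; the value at
  index 0 is never used.
\<close>

definition check_loss :: "real \<Rightarrow> real \<Rightarrow> real" where
  "check_loss \<tau> u = u * (\<tau> - indicator {..0} u)"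

definition ald_likelihood ::
    "real \<Rightarrow> (nat \<Rightarrow> real^'d) \<Rightarrow> nat \<Rightarrow> (nat \<Rightarrow> real) \<Rightarrow> real^'d \<Rightarrow> real" where
  "ald_likelihood \<tau> X n y \<beta> =
     (\<Prod>i=1..n. \<tau> * (1 - \<tau>) * exp (- check_loss \<tau> (y i - X i \<bullet> \<beta>)))"

text \<open>
  The probability measure with \<open>B \<mapsto> (\<integral>\<^sub>B L \<pi>) / (\<integral> L \<pi>)\<close>, for a nonnegative likelihood \<open>L\<close>
  and a nonnegative prior density \<open>\<pi>\<close>.
\<close>

definition posterior :: "(real^'d \<Rightarrow> real) \<Rightarrow> (real^'d \<Rightarrow> real) \<Rightarrow> (real^'d) measure" where
  "posterior L \<pi> =
     density lborel (\<lambda>\<beta>. ennreal (L \<beta> * \<pi> \<beta>) / (\<integral>\<^sup>+ \<beta>'. ennreal (L \<beta>' * \<pi> \<beta>') \<partial>lborel))"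

definition mean_vec :: "(real^'d) measure \<Rightarrow> real^'d" where
  "mean_vec N = (\<integral>x. x \<partial>N)"

definition cov_mat :: "(real^'d) measure \<Rightarrow> real^'d^'d" where
  "cov_mat N = (\<chi> i j. \<integral>x. (x $ i - mean_vec N $ i) * (x $ j - mean_vec N $ j) \<partial>N)"

definition ald_posterior ::
    "real \<Rightarrow> (nat \<Rightarrow> real^'d) \<Rightarrow> (real^'d \<Rightarrow> real) \<Rightarrow> nat \<Rightarrow> (nat \<Rightarrow> real) \<Rightarrow> (real^'d) measure" where
  "ald_posterior \<tau> X \<pi> n y = posterior (ald_likelihood \<tau> X n y) \<pi>"

definition beta_tilde ::
    "real \<Rightarrow> (nat \<Rightarrow> real^'d) \<Rightarrow> (real^'d \<Rightarrow> real) \<Rightarrow> nat \<Rightarrow> (nat \<Rightarrow> real) \<Rightarrow> real^'d" where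
  "beta_tilde \<tau> X \<pi> n y = mean_vec (ald_posterior \<tau> X \<pi> n y)"

text \<open>\<open>V\<^sub>n\<close> is determined by: \<open>n\<^sup>-\<^sup>1 V\<^sub>n\<^sup>-\<^sup>1\<close> is the posterior covariance matrix.\<close>

definition V_post ::
    "real \<Rightarrow> (nat \<Rightarrow> real^'d) \<Rightarrow> (real^'d \<Rightarrow> real) \<Rightarrow> nat \<Rightarrow> (nat \<Rightarrow> real) \<Rightarrow> real^'d^'d" where
  "V_post \<tau> X \<pi> n y = matrix_inv (real n *\<^sub>R cov_mat (ald_posterior \<tau> X \<pi> n y))"

definition outer_square :: "real^'d \<Rightarrow> real^'d^'d" where
  "outer_square x = (columnvector x :: real^1^'d) ** (rowvector x :: real^'d^1)"

definition S_emp :: "(nat \<Rightarrow> real^'d) \<Rightarrow> nat \<Rightarrow> real^'d^'d" where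
  "S_emp X n = (1 / real n) *\<^sub>R (\<Sum>i=1..n. outer_square (X i))"

definition sandwich :: "real \<Rightarrow> real^'d^'d \<Rightarrow> real^'d^'d \<Rightarrow> real^'d^'d" where
  "sandwich \<tau> V S = (\<tau> * (1 - \<tau>)) *\<^sub>R (matrix_inv V ** S ** matrix_inv V)"

definition Sigma_post ::
    "real \<Rightarrow> (nat \<Rightarrow> real^'d) \<Rightarrow> (real^'d \<Rightarrow> real) \<Rightarrow> nat \<Rightarrow> (nat \<Rightarrow> real) \<Rightarrow> real^'d^'d" where
  "Sigma_post \<tau> X \<pi> n y = sandwich \<tau> (V_post \<tau> X \<pi> n y) (S_emp X n)"

definition sandwich_likelihood ::
    "real \<Rightarrow> (nat \<Rightarrow> real^'d) \<Rightarrow> (real^'d \<Rightarrow> real) \<Rightarrow> nat \<Rightarrow> (nat \<Rightarrow> real) \<Rightarrow> real^'d \<Rightarrow> real" where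
  "sandwich_likelihood \<tau> X \<pi> n y \<beta> =
     1 / sqrt (det ((1 / real n) *\<^sub>R Sigma_post \<tau> X \<pi> n y)) *
     exp (- (real n / 2) *
       ((beta_tilde \<tau> X \<pi> n y - \<beta>) \<bullet>
        (matrix_inv (Sigma_post \<tau> X \<pi> n y) *v (beta_tilde \<tau> X \<pi> n y - \<beta>))))"

definition sandwich_posterior ::
    "real \<Rightarrow> (nat \<Rightarrow> real^'d) \<Rightarrow> (real^'d \<Rightarrow> real) \<Rightarrow> nat \<Rightarrow> (nat \<Rightarrow> real) \<Rightarrow> (real^'d) measure" where
  "sandwich_posterior \<tau> X \<pi> n y = posterior (sandwich_likelihood \<tau> X \<pi> n y) \<pi>"

text \<open>
  Multivariate normal law, meaningful for a symmetric positive definite covariance matrix.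
\<close>

definition mvnormal :: "real^'d \<Rightarrow> real^'d^'d \<Rightarrow> (real^'d) measure" where
  "mvnormal \<mu> \<Sigma> = density lborel (\<lambda>x. ennreal
     (exp (- ((x - \<mu>) \<bullet> (matrix_inv \<Sigma> *v (x - \<mu>))) / 2) / sqrt ((2 * pi) ^ CARD('d) * det \<Sigma>)))"

text \<open>
  The sets \<open>{1} \<times> U\<^sub>2 \<times> \<dots> \<times> U\<^sub>p\<close> of the design condition: one coordinate \<open>j\<close> other than the
  intercept coordinate \<open>c1\<close> is bounded away from 0 by \<open>\<epsilon>\<close> with a prescribed sign, all remaining
  non-intercept coordinates have a prescribed strict sign.
\<close>

definition orthant_cells :: "'d \<Rightarrow> real \<Rightarrow> (real^'d) set set" where
  "orthant_cells c1 \<epsilon> =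
     {D. \<exists>(j::'d) U. j \<noteq> c1 \<and> U c1 = {1} \<and> (U j = {\<epsilon><..} \<or> U j = {..<-\<epsilon>}) \<and>
           (\<forall>k. k \<noteq> c1 \<and> k \<noteq> j \<longrightarrow> U k = {0<..} \<or> U k = {..<0}) \<and>
           D = {x. \<forall>k. x $ k \<in> U k}}"

text \<open>
  Convergence in probability. Measurability is required only eventually, so that finitely many
  \<open>n\<close> for which \<open>W n\<close> is not well defined do not matter (the empirical matrix \<open>S\<^sub>n\<close> can be
  singular for small \<open>n\<close>).
\<close>

definition tendsto_in_prob :: "'a measure \<Rightarrow> (nat \<Rightarrow> 'a \<Rightarrow> real) \<Rightarrow> real \<Rightarrow> bool" where
  "tendsto_in_prob M W l \<longleftrightarrow>
     (\<forall>\<^sub>F n in sequentially. W n \<in> borel_measurable M) \<and>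
     (\<forall>\<epsilon>>0. (\<lambda>n. measure M {\<omega> \<in> space M. \<epsilon> < \<bar>W n \<omega> - l\<bar>}) \<longlonglongrightarrow> 0)"

end

(*
Write h = sqrt n (beta - beta0). Knight's identity turns the increment of the check losses into a
convex function of h that equals -W_n.h plus a sum of nonnegative independent remainders. By the
density assumptions and Chebyshev's inequality that sum converges in probability to h.Vh / 2 for
every fixed h, while W_n is tight. Along any sequence on which W_n converges and the remainders
converge on a suitable countable dense set of h, convexity upgrades pointwise convergence to locally
uniform convergence and linear growth of the exponents, so dominated convergence gives the limit of
the mean, of the covariance and (by Scheffe's lemma) of the law of h in total variation. The sandwich
posterior has a quadratic exponent whose matrix converges, so the same argument applies to it.
*)
theory Submission
  imports Defs "HOL-Real_Asymp.Real_Asymp"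
begin

section \<open>Positive definite matrices\<close>

text \<open>Convergence of the local posterior in total variation would not suffice: the sandwich
  posterior is built from its mean and covariance, so second moments have to converge as well. This
  is why the dominating function must integrate a density weighted by (1 + norm h)^2. The normal
  laws of the statement are centred at the random posterior mean, which in general has no limit in
  probability. Along a sequence whose score tends to w it does converge, to V^-1 w; there the moving
  centre is exchanged for this limit by continuity of the normal law in its mean. The sample points
  along such a sequence are arbitrary, one for each index, so no almost sure version is chosen and
  the limit argument is purely deterministic. Both posteriors are instances of one limit theorem for
  densities exp(-f_k) g_k with f_k convex and f_k(0) = 0. The density assumption is stated in terms
  of beta, while the remainders need a modulus in a scalar shift, uniform in i. The intercept
  coordinate provides it.\<close>

definition pos_def :: "real^'n^'n \<Rightarrow> bool" where
  "pos_def A \<longleftrightarrow> transpose A = A \<and> (\<forall>x. x \<noteq> 0 \<longrightarrow> 0 < x \<bullet> (A *v x))"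

lemma pos_defD:
  assumes "pos_def A"
  shows "transpose A = A" "x \<noteq> 0 \<Longrightarrow> 0 < x \<bullet> (A *v x)"
  using assms by (auto simp: pos_def_def)

lemma symmetric_matrix_inner:
  fixes A :: "real^'n^'n"
  assumes "transpose A = A"
  shows "x \<bullet> (A *v y) = (A *v x) \<bullet> y"
  by (metis assms dot_lmul_matrix transpose_matrix_vector)

lemma pos_def_invertible:
  assumes "pos_def A" shows "invertible A"
proof -
  have "\<forall>x. A *v x = 0 \<longrightarrow> x = 0"
    using pos_defD(2)[OF assms] by (metis inner_zero_right less_irrefl)
  then show ?thesis
    by (metis invertible_left_inverse matrix_left_invertible_ker)
qed

lemma matrix_inv:
  fixes A :: "real^'n^'n"
  assumes "invertible A"
  shows "A ** matrix_inv A = mat 1" "matrix_inv A ** A = mat 1"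
proof -
  obtain B where "A ** B = mat 1 \<and> B ** A = mat 1" using assms by (auto simp: invertible_def)
  then have "A ** matrix_inv A = mat 1 \<and> matrix_inv A ** A = mat 1"
    unfolding matrix_inv_def by (rule someI)
  then show "A ** matrix_inv A = mat 1" "matrix_inv A ** A = mat 1" by auto
qed

lemma matrix_inv_eqI:
  fixes A B :: "real^'n^'n"
  assumes "A ** B = mat 1"
  shows "matrix_inv A = B"
proof -
  have "B ** A = mat 1" using assms matrix_left_right_inverse by blast
  then have "invertible A" using assms by (auto simp: invertible_def)
  then have "matrix_inv A = matrix_inv A ** (A ** B)" using assms by simp
  also have "\<dots> = B" by (metis matrix_inv(2)[OF \<open>invertible A\<close>] matrix_mul_assoc matrix_mul_lid)
  finally show ?thesis .
qed

lemma matrix_inv_mult_vec: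
  fixes A :: "real^'n^'n"
  assumes "invertible A"
  shows "A *v (matrix_inv A *v x) = x" "matrix_inv A *v (A *v x) = x"
  by (simp_all add: matrix_vector_mul_assoc matrix_inv[OF assms])

lemma matrix_inv_matrix_inv:
  fixes A :: "real^'n^'n"
  assumes "invertible A"
  shows "matrix_inv (matrix_inv A) = A"
  using matrix_inv_eqI matrix_inv(2)[OF assms] by blast

lemma transpose_matrix_inv:
  fixes A :: "real^'n^'n"
  assumes "invertible A"
  shows "transpose (matrix_inv A) = matrix_inv (transpose A)"
  by (metis assms matrix_inv(2) matrix_inv_eqI matrix_transpose_mul transpose_mat)

lemma pos_def_matrix_inv:
  assumes "pos_def A" shows "pos_def (matrix_inv A)"
proof -
  note inv = pos_def_invertible[OF assms]
  show ?thesis unfolding pos_def_def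
  proof (intro conjI allI impI)
    show "transpose (matrix_inv A) = matrix_inv A"
      by (simp add: transpose_matrix_inv inv pos_defD[OF assms])
    fix x :: "real^'a" assume "x \<noteq> 0"
    define y where "y = matrix_inv A *v x"
    have x: "x = A *v y" by (simp add: y_def matrix_inv_mult_vec[OF inv])
    then have "y \<noteq> 0" using \<open>x \<noteq> 0\<close> by auto
    then show "0 < x \<bullet> (matrix_inv A *v x)"
      using pos_defD(2)[OF assms, of y] x by (metis inner_commute y_def)
  qed
qed

lemma scaleR_matrix_vector: "(c *\<^sub>R (A::real^'n^'m)) *v x = c *\<^sub>R (A *v x)"
  by (simp add: vec_eq_iff matrix_vector_mult_def sum_distrib_left mult.assoc)

lemma transpose_scaleR: "transpose (c *\<^sub>R (A::real^'n^'m)) = c *\<^sub>R transpose A"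
  by (simp add: vec_eq_iff transpose_def)

lemma pos_def_scaleR: "pos_def A \<Longrightarrow> 0 < c \<Longrightarrow> pos_def (c *\<^sub>R A)"
  by (auto simp: pos_def_def transpose_scaleR scaleR_matrix_vector)

text \<open>Up to the factor \<open>\<tau> * (1 - \<tau>)\<close>, the form at \<open>x\<close> is
  the form of \<open>S\<close> at \<open>matrix_inv V *v x\<close>, and this vector is nonzero
  because \<open>matrix_inv V\<close> is itself positive definite.\<close>

lemma pos_def_sandwich:
  assumes "pos_def V" "pos_def S" "0 < \<tau>" "\<tau> < 1"
  shows "pos_def (sandwich \<tau> V S)"
  unfolding sandwich_def
proof (rule pos_def_scaleR)
  let ?W = "matrix_inv V"
  have W: "pos_def ?W" by (rule pos_def_matrix_inv[OF assms(1)])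
  show "pos_def (?W ** S ** ?W)" unfolding pos_def_def
  proof (intro conjI allI impI)
    show "transpose (?W ** S ** ?W) = ?W ** S ** ?W"
      by (simp add: matrix_transpose_mul pos_defD(1)[OF W] pos_defD(1)[OF assms(2)] matrix_mul_assoc)
    fix x :: "real^'a" assume "x \<noteq> 0"
    then have "?W *v x \<noteq> 0" by (metis inner_zero_right less_irrefl pos_defD(2)[OF W])
    then have "0 < (?W *v x) \<bullet> (S *v (?W *v x))" by (rule pos_defD(2)[OF assms(2)])
    then show "0 < x \<bullet> ((?W ** S ** ?W) *v x)"
      by (simp add: symmetric_matrix_inner[OF pos_defD(1)[OF W]] flip: matrix_vector_mul_assoc)
  qed
qed (use assms in simp)

text \<open>A zero of a nonnegative form lies in the kernel of its matrix. Averages of outer squares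
  and their limits have nonnegative forms for free, so invertibility is what makes \<open>V\<close>,
  \<open>S\<close> and, eventually, \<open>S_emp X n\<close> positive definite.\<close>

lemma pos_semidef_invertible_imp_pos_def:
  fixes A :: "real^'n^'n"
  assumes sym: "transpose A = A" and nn: "\<And>x. 0 \<le> x \<bullet> (A *v x)" and inv: "invertible A"
  shows "pos_def A"
  unfolding pos_def_def
proof (intro conjI allI impI sym)
  fix x :: "real^'n" assume "x \<noteq> 0"
  show "0 < x \<bullet> (A *v x)"
  proof (rule ccontr)
    assume "\<not> ?thesis"
    with nn have 0: "x \<bullet> (A *v x) = 0" by (metis less_eq_real_def)
    define y where "y = A *v x"
    define a where "a = y \<bullet> y"
    define b where "b = y \<bullet> (A *v y)"
    \<comment> \<open>The form at \<open>x + t y\<close> equals \<open>2 t a + t\<^sup>2 b\<close>; it is nonnegative for small negative \<open>t\<close> only if \<open>a = 0\<close>.\<close>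
    have expand: "0 \<le> 2 * t * a + t\<^sup>2 * b" for t
    proof -
      have "(x + t *\<^sub>R y) \<bullet> (A *v (x + t *\<^sub>R y)) = x \<bullet> (A *v x) + t * (x \<bullet> (A *v y)) + t * (y \<bullet> (A *v x)) + t\<^sup>2 * b"
        by (simp add: matrix_vector_right_distrib matrix_vector_mult_scaleR inner_simps b_def power2_eq_square algebra_simps)
      also have "x \<bullet> (A *v y) = a" by (simp add: symmetric_matrix_inner[OF sym] a_def y_def)
      also have "y \<bullet> (A *v x) = a" by (simp add: a_def y_def)
      finally show ?thesis using nn[of "x + t *\<^sub>R y"] 0 by (simp add: mult_ac)
    qed
    have "y \<noteq> 0" using inv \<open>x \<noteq> 0\<close> unfolding y_def
      by (metis matrix_inv_mult_vec(2) matrix_vector_mult_0_right)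
    then have a: "a > 0" by (simp add: a_def)
    have b: "b \<ge> 0" using nn[of y] by (simp add: b_def)
    \<comment> \<open>At t = -s the quadratic in \<open>expand\<close> equals -s^2 (b + 2); the
      summand 1 in the denominator covers b = 0.\<close>
    define s where "s = a / (b + 1)"
    have s: "s > 0" "a = s * (b + 1)" using a b by (auto simp: s_def)
    have "2 * (- s) * a + (- s)\<^sup>2 * b = - (s\<^sup>2 * (b + 2))"
      by (simp add: s(2) power2_eq_square algebra_simps)
    also have "\<dots> < 0" using s(1) b by simp
    finally show False using expand[of "- s"] by simp
  qed
qed

text \<open>The constant is the minimum of the form on the compact unit sphere; homogeneity of
  degree two carries the bound to all \<open>x\<close>.\<close>

lemma pos_def_coercive:
  assumes "pos_def (A::real^'n^'n)"
  obtains l where "0 < l" "\<And>x. l * (norm x)\<^sup>2 \<le> x \<bullet> (A *v x)"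
proof -
  have cont: "continuous_on (sphere 0 1) (\<lambda>x. x \<bullet> (A *v x))"
    by (intro continuous_intros matrix_vector_mult_linear_continuous_on)
  have "sphere (0::real^'n) 1 \<noteq> {}" by (metis norm_axis_1 mem_sphere_0 empty_iff)
  then obtain u where u: "u \<in> sphere 0 1" "\<And>y. y \<in> sphere 0 1 \<Longrightarrow> u \<bullet> (A *v u) \<le> y \<bullet> (A *v y)"
    using continuous_attains_inf[OF compact_sphere _ cont] by blast
  show ?thesis
  proof (rule that)
    show "0 < u \<bullet> (A *v u)" using u(1) by (intro pos_defD[OF assms]) auto
    fix x :: "real^'n"
    show "u \<bullet> (A *v u) * (norm x)\<^sup>2 \<le> x \<bullet> (A *v x)"
    proof (cases "x = 0")
      case False
      have "u \<bullet> (A *v u) \<le> ((1 / norm x) *\<^sub>R x) \<bullet> (A *v ((1 / norm x) *\<^sub>R x))"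
        using False by (intro u(2)) simp
      also have "\<dots> = (x \<bullet> (A *v x)) / (norm x)\<^sup>2"
        by (simp add: matrix_vector_mult_scaleR power2_eq_square)
      finally show ?thesis using False by (simp add: field_simps)
    qed simp
  qed
qed

text \<open>Gram-Schmidt orthogonalisation for the inner product \<open>x \<bullet> (A *v y)\<close>.\<close>

lemma pos_def_orthonormal_vectors:
  fixes A :: "real^'n^'n"
  assumes A: "pos_def A" and "finite I" "card I \<le> CARD('n)"
  shows "\<exists>b. \<forall>i\<in>I. \<forall>j\<in>I. b i \<bullet> (A *v b j) = (if i = j then 1 else 0)"
  using assms(2,3)
proof (induction I)
  case (insert k I)
  then obtain b where b: "\<And>i j. i\<in>I \<Longrightarrow> j\<in>I \<Longrightarrow> b i \<bullet> (A *v b j) = (if i = j then 1 else 0)"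
    by auto
  \<comment> \<open>The vectors \<open>A *v b i\<close> cannot span the whole space, so some nonzero
    \<open>x\<close> is orthogonal to all of them, that is, orthogonal to every \<open>b i\<close>
    with respect to \<open>A\<close>. Rescaling \<open>x\<close> gives the next vector.\<close>
  have "dim ((\<lambda>i. A *v b i) ` I) \<le> card I"
    by (metis card_image_le dim_le_card' finite_imageI insert.hyps(1) le_trans)
  also have "\<dots> < DIM(real^'n)" using insert by simp
  finally obtain x where x: "x \<noteq> 0" "\<And>y. y \<in> span ((\<lambda>i. A *v b i) ` I) \<Longrightarrow> orthogonal x y"
    using orthogonal_to_subspace_exists by blast
  have xb: "x \<bullet> (A *v b i) = 0" if "i \<in> I" for i
    using x(2) that by (simp add: orthogonal_def span_base)
  have bx: "b i \<bullet> (A *v x) = 0" if "i \<in> I" for i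
    using xb[OF that] by (metis inner_commute symmetric_matrix_inner pos_defD(1)[OF A])
  have pos: "0 < x \<bullet> (A *v x)" by (rule pos_defD(2)[OF A x(1)])
  define c where "c = 1 / sqrt (x \<bullet> (A *v x))"
  have c: "c * (c * (x \<bullet> (A *v x))) = 1"
    using pos by (simp add: c_def field_simps)
  show ?case
    using insert.hyps b xb bx c
    by (intro exI[of _ "b(k := c *\<^sub>R x)"]) (auto simp: matrix_vector_mult_scaleR)
qed simp

text \<open>The columns of \<open>B\<close> form an \<open>A\<close>-orthonormal basis, so the
  entries of the product are the \<open>A\<close>-inner products of the basis vectors. The factor
  plays the role of an inverse square root of \<open>A\<close>: it yields positivity of the
  determinant and exhibits a normal law as an affine image of the standard one.\<close>

lemma pos_def_whitening:
  fixes A :: "real^'n^'n"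
  assumes A: "pos_def A"
  obtains B :: "real^'n^'n" where "transpose B ** A ** B = mat 1"
proof -
  obtain b :: "'n \<Rightarrow> real^'n" where b: "\<And>i j. b i \<bullet> (A *v b j) = (if i = j then 1 else 0)"
    using pos_def_orthonormal_vectors[OF A, of "UNIV::'n set"] by auto
  define B where "B = transpose (\<chi> i. b i)"
  have col: "column j B = b j" for j by (simp add: B_def column_def transpose_def)
  have "(transpose B ** (A ** B)) $ i $ j = b i \<bullet> (A *v b j)" for i j
  proof -
    have "(transpose B ** (A ** B)) $ i $ j = row i (transpose B) \<bullet> column j (A ** B)"
      by (simp add: matrix_matrix_mult_def inner_vec_def row_def column_def)
    also have "column j (A ** B) = A *v column j B"
      by (simp add: vec_eq_iff column_def matrix_matrix_mult_def matrix_vector_mult_def)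
    finally show ?thesis by (simp add: col)
  qed
  then show ?thesis
    by (intro that[of B]) (simp add: vec_eq_iff mat_def b flip: matrix_mul_assoc)
qed

lemma whitening_det:
  fixes A B :: "real^'n^'n"
  assumes "transpose B ** A ** B = mat 1"
  shows "(det B)\<^sup>2 * det A = 1"
proof -
  have "det (transpose B ** A ** B) = 1" using assms by simp
  then show ?thesis by (simp add: det_mul power2_eq_square algebra_simps)
qed

lemma pos_def_det_pos: "pos_def A \<Longrightarrow> 0 < det A"
  by (metis pos_def_whitening whitening_det mult_eq_0_iff not_one_less_zero zero_le_square power2_eq_square
      zero_less_mult_pos zero_less_one not_less_iff_gr_or_eq zero_le_power2 mult_nonneg_nonpos not_le)

text \<open>\<open>B\<close> is a two-sided inverse of \<open>transpose B ** A\<close>, so the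
  factors may be rotated cyclically. Applied to a precision matrix, this recovers the covariance as
  \<open>B ** transpose B\<close>.\<close>

lemma whitening_inv:
  fixes A B :: "real^'n^'n"
  assumes "transpose B ** A ** B = mat 1"
  shows "B ** transpose B = matrix_inv A"
proof -
  have "B ** (transpose B ** A) = mat 1"
    by (metis assms matrix_left_right_inverse)
  then have "(B ** transpose B) ** A = mat 1" by (simp add: matrix_mul_assoc)
  then have "A ** (B ** transpose B) = mat 1" using matrix_left_right_inverse by blast
  then show ?thesis by (metis matrix_inv_eqI)
qed

text \<open>Cramer's rule. Each entry of the inverse becomes a quotient of polynomials in the
  entries of \<open>A\<close>, from which both continuity and measurability of inversion are read
  off.\<close>

lemma matrix_inv_nth:
  fixes A :: "real^'n^'n"
  assumes "invertible A"
  shows "matrix_inv A $ k $ l = det (\<chi> i j. if j = k then axis l 1 $ i else A $ i $ j) / det A"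
proof -
  have "A *v (matrix_inv A *v axis l 1) = axis l 1" by (rule matrix_inv_mult_vec[OF assms])
  then have "matrix_inv A *v axis l 1 = (\<chi> k. det (\<chi> i j. if j = k then axis l 1 $ i else A $ i $ j) / det A)"
    using cramer[of A] assms invertible_det_nz by blast
  then have "(matrix_inv A *v axis l 1) $ k = det (\<chi> i j. if j = k then axis l 1 $ i else A $ i $ j) / det A"
    by simp
  then show ?thesis
    by (simp add: matrix_vector_mult_basis column_def)
qed

section \<open>Continuity and measurability of matrix operations\<close>

lemma tendsto_matrixI:
  fixes f :: "'b \<Rightarrow> real^'n^'m"
  assumes "\<And>i j. ((\<lambda>x. f x $ i $ j) \<longlongrightarrow> A $ i $ j) F"
  shows "(f \<longlongrightarrow> A) F"
  using assms by (intro vec_tendstoI)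

lemma tendsto_det:
  fixes f :: "'b \<Rightarrow> real^'n^'n"
  assumes "(f \<longlongrightarrow> A) F"
  shows "((\<lambda>x. det (f x)) \<longlongrightarrow> det A) F"
  unfolding det_def by (intro tendsto_intros assms)

lemma tendsto_matrix_inv:
  fixes f :: "'b \<Rightarrow> real^'n^'n"
  assumes f: "(f \<longlongrightarrow> A) F" and inv: "invertible A" 
  shows "((\<lambda>x. matrix_inv (f x)) \<longlongrightarrow> matrix_inv A) F"
proof (rule tendsto_matrixI)
  fix k l
  have nz: "det A \<noteq> 0" using inv by (simp add: invertible_det_nz)
  have ev: "\<forall>\<^sub>F x in F. det (f x) \<noteq> 0"
    using tendsto_imp_eventually_ne[OF tendsto_det[OF f] nz] .
  have "((\<lambda>x. det (\<chi> i j. if j = k then axis l 1 $ i else f x $ i $ j) / det (f x)) \<longlongrightarrow> matrix_inv A $ k $ l) F"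
    unfolding matrix_inv_nth[OF inv]
    by (intro tendsto_divide tendsto_det f nz tendsto_matrixI) (auto intro!: tendsto_intros f)
  then show "((\<lambda>x. matrix_inv (f x) $ k $ l) \<longlongrightarrow> matrix_inv A $ k $ l) F"
    by (rule Lim_transform_eventually) (use ev in eventually_elim, simp add: matrix_inv_nth invertible_det_nz)
qed

lemma tendsto_matrix_mult:
  fixes f :: "'b \<Rightarrow> real^'n^'m" and g :: "'b \<Rightarrow> real^'k^'n"
  assumes "(f \<longlongrightarrow> A) F" "(g \<longlongrightarrow> B) F"
  shows "((\<lambda>x. f x ** g x) \<longlongrightarrow> A ** B) F"
  by (rule tendsto_matrixI) (simp add: matrix_matrix_mult_def, intro tendsto_intros assms)

lemma tendsto_matrix_vector_mult:
  fixes f :: "'b \<Rightarrow> real^'n^'m" and g :: "'b \<Rightarrow> real^'n"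
  assumes "(f \<longlongrightarrow> A) F" "(g \<longlongrightarrow> B) F"
  shows "((\<lambda>x. f x *v g x) \<longlongrightarrow> A *v B) F"
  by (rule vec_tendstoI) (simp add: matrix_vector_mult_def, intro tendsto_intros assms)

lemma tendsto_sandwich_matrix:
  fixes f g :: "'b \<Rightarrow> real^'n^'n"
  assumes "(f \<longlongrightarrow> V) F" "(g \<longlongrightarrow> S) F" "invertible V"
  shows "((\<lambda>x. sandwich \<tau> (f x) (g x)) \<longlongrightarrow> sandwich \<tau> V S) F"
  unfolding sandwich_def by (intro tendsto_intros tendsto_matrix_mult tendsto_matrix_inv assms)

lemma borel_measurable_vecI:
  fixes f :: "'b \<Rightarrow> 'c::{euclidean_space}^'n"
  assumes "\<And>i. (\<lambda>x. f x $ i) \<in> borel_measurable M"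
  shows "f \<in> borel_measurable M"
proof (subst borel_measurable_euclidean_space, intro ballI)
  fix b :: "'c^'n" assume "b \<in> Basis"
  then obtain i u where "b = axis i u" "u \<in> Basis" by (auto simp: Basis_vec_def)
  moreover have "(\<lambda>x. f x $ i \<bullet> u) \<in> borel_measurable M" using assms by measurable
  ultimately show "(\<lambda>x. f x \<bullet> b) \<in> borel_measurable M" by (simp add: inner_axis)
qed

lemma borel_measurable_vec_nth [measurable (raw)]:
  fixes f :: "'b \<Rightarrow> 'c::{euclidean_space}^'n"
  assumes "f \<in> borel_measurable M"
  shows "(\<lambda>x. f x $ i) \<in> borel_measurable M"
  by (rule borel_measurable_continuous_on[OF _ assms]) (intro continuous_intros)

lemma borel_measurable_vec_lambda [measurable (raw)]:
  fixes f :: "'n::finite \<Rightarrow> 'b \<Rightarrow> 'c::{euclidean_space}"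
  assumes "\<And>i. f i \<in> borel_measurable M"
  shows "(\<lambda>x. \<chi> i. f i x) \<in> borel_measurable M"
  by (rule borel_measurable_vecI) (simp add: assms)

lemma borel_measurable_det [measurable (raw)]:
  fixes f :: "'b \<Rightarrow> real^'n^'n"
  assumes [measurable]: "f \<in> borel_measurable M"
  shows "(\<lambda>x. det (f x)) \<in> borel_measurable M"
  unfolding det_def by measurable

text \<open>Invertibility is required on the whole space because Cramer's formula agrees with
  \<open>matrix_inv\<close> only there; at a singular matrix \<open>matrix_inv\<close> is an
  arbitrary choice.\<close>

lemma borel_measurable_matrix_inv:
  fixes f :: "'b \<Rightarrow> real^'n^'n"
  assumes [measurable]: "f \<in> borel_measurable M" and "\<And>x. x \<in> space M \<Longrightarrow> invertible (f x)"
  shows "(\<lambda>x. matrix_inv (f x)) \<in> borel_measurable M"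
proof (intro borel_measurable_vecI)
  fix k l
  have "(\<lambda>x. det (\<chi> i j. if j = k then axis l 1 $ i else f x $ i $ j) / det (f x)) \<in> borel_measurable M"
    by measurable
  then show "(\<lambda>x. matrix_inv (f x) $ k $ l) \<in> borel_measurable M"
    by (rule measurable_cong[THEN iffD1, rotated]) (simp add: matrix_inv_nth assms)
qed

lemma borel_measurable_matrix_mult [measurable (raw)]:
  fixes f :: "'b \<Rightarrow> real^'n^'m" and g :: "'b \<Rightarrow> real^'k^'n"
  assumes [measurable]: "f \<in> borel_measurable M" "g \<in> borel_measurable M"
  shows "(\<lambda>x. f x ** g x) \<in> borel_measurable M"
  unfolding matrix_matrix_mult_def by measurable

lemma borel_measurable_matrix_vector_mult [measurable (raw)]:
  fixes f :: "'b \<Rightarrow> real^'n^'m" and g :: "'b \<Rightarrow> real^'n"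
  assumes [measurable]: "f \<in> borel_measurable M" "g \<in> borel_measurable M"
  shows "(\<lambda>x. f x *v g x) \<in> borel_measurable M"
  unfolding matrix_vector_mult_def by measurable

text \<open>The gap in the convexity inequality is t (1 - t) / 2 times the form at the difference of
  the two points.\<close>

lemma convex_on_quadratic:
  fixes A :: "real^'n^'n"
  assumes "pos_def A"
  shows "convex_on UNIV (\<lambda>x. (x - a) \<bullet> (A *v (x - a)) / 2)"
proof (rule convex_onI)
  fix t :: real and x y :: "real^'n" assume t: "0 < t" "t < 1"
  define u v where "u = x - a" and "v = y - a"
  have uv: "(1 - t) *\<^sub>R x + t *\<^sub>R y - a = (1 - t) *\<^sub>R u + t *\<^sub>R v"
    by (simp add: u_def v_def algebra_simps)
  define p q r s where "p = u \<bullet> (A *v u)" and "q = v \<bullet> (A *v v)" and "r = u \<bullet> (A *v v)" and "s = v \<bullet> (A *v u)"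
  have "0 \<le> (u - v) \<bullet> (A *v (u - v))"
    using pos_defD(2)[OF assms, of "u - v"] by (cases "u = v") (auto intro: less_imp_le)
  then have nn: "0 \<le> p + q - r - s"
    by (simp add: matrix_vector_mult_diff_distrib inner_simps p_def q_def r_def s_def)
  have "((1 - t) *\<^sub>R u + t *\<^sub>R v) \<bullet> (A *v ((1 - t) *\<^sub>R u + t *\<^sub>R v))
      = (1-t)^2 * p + t^2 * q + t * (1 - t) * (r + s)"
    by (simp add: matrix_vector_right_distrib matrix_vector_mult_scaleR inner_simps p_def q_def r_def s_def power2_eq_square algebra_simps)
  also have "\<dots> = (1-t) * p + t * q - t * (1 - t) * (p + q - r - s)"
    by (simp add: power2_eq_square algebra_simps)
  also have "\<dots> \<le> (1-t) * p + t * q" using nn t by simp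
  finally show "((1 - t) *\<^sub>R x + t *\<^sub>R y - a) \<bullet> (A *v ((1 - t) *\<^sub>R x + t *\<^sub>R y - a)) / 2
      \<le> (1 - t) * ((x - a) \<bullet> (A *v (x - a)) / 2) + t * ((y - a) \<bullet> (A *v (y - a)) / 2)"
    unfolding uv by (simp add: u_def v_def p_def q_def field_simps)
qed simp

section \<open>Normalized densities and total variation\<close>

abbreviation (input) mass :: "('b::euclidean_space \<Rightarrow> real) \<Rightarrow> real" where
  "mass u \<equiv> integral\<^sup>L lborel u"

abbreviation (input) tv_dist :: "'b::topological_space measure \<Rightarrow> 'b measure \<Rightarrow> real" where
  "tv_dist P Q \<equiv> SUP B\<in>sets borel. \<bar>measure P B - measure Q B\<bar>"

text \<open>Densities are carried without their normalising constant, so that factors independent of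
  the parameter, such as the likelihood at \<open>\<beta>0\<close> or the determinant in the
  sandwich likelihood, can simply be dropped.\<close>

definition unnorm_density :: "('b::euclidean_space \<Rightarrow> real) \<Rightarrow> bool" where
  "unnorm_density u \<longleftrightarrow> (\<forall>x. 0 \<le> u x) \<and> integrable lborel u \<and> 0 < mass u"

definition normalized :: "('b::euclidean_space \<Rightarrow> real) \<Rightarrow> 'b measure" where
  "normalized u = density lborel (\<lambda>x. ennreal (u x / mass u))"

lemma unnorm_densityD:
  assumes "unnorm_density u"
  shows "0 \<le> u x" "integrable lborel u" "u \<in> borel_measurable borel" "0 < mass u"
  using assms by (auto simp: unnorm_density_def dest: borel_measurable_integrable)

lemma sets_normalized [simp, measurable_cong]: "sets (normalized u) = sets borel"
  by (simp add: normalized_def)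

lemma space_normalized [simp]: "space (normalized u) = UNIV"
  by (simp add: normalized_def)

lemma prob_space_normalized:
  assumes "unnorm_density u" shows "prob_space (normalized u)"
proof
  note [measurable] = unnorm_densityD(3)[OF assms]
  have "emeasure (normalized u) (space (normalized u)) = (\<integral>\<^sup>+x. ennreal (u x / mass u) \<partial>lborel)"
    by (simp add: normalized_def emeasure_density)
  also have "\<dots> = ennreal (\<integral>x. u x / mass u \<partial>lborel)"
    using unnorm_densityD[OF assms] by (intro nn_integral_eq_integral) (auto intro: less_imp_le)
  also have "\<dots> = 1" using unnorm_densityD(4)[OF assms] by simp
  finally show "emeasure (normalized u) (space (normalized u)) = 1" .
qed

lemma integral_normalized:
  fixes f :: "'b::euclidean_space \<Rightarrow> 'c::{banach, second_countable_topology}"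
  assumes "unnorm_density u" and [measurable]: "f \<in> borel_measurable borel"
  shows "(\<integral>x. f x \<partial>normalized u) = (1 / mass u) *\<^sub>R (\<integral>x. u x *\<^sub>R f x \<partial>lborel)"
proof -
  note [measurable] = unnorm_densityD(3)[OF assms(1)]
  have "(\<integral>x. f x \<partial>normalized u) = (\<integral>x. (u x / mass u) *\<^sub>R f x \<partial>lborel)"
    unfolding normalized_def using unnorm_densityD(1,4)[OF assms(1)]
    by (intro integral_density) (auto intro: less_imp_le)
  also have "\<dots> = (\<integral>x. (1 / mass u) *\<^sub>R (u x *\<^sub>R f x) \<partial>lborel)"
    by simp
  also have "\<dots> = (1 / mass u) *\<^sub>R (\<integral>x. u x *\<^sub>R f x \<partial>lborel)"
    by (rule integral_scaleR_right)
  finally show ?thesis .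
qed

lemma integrable_scaleR_right_iff:
  fixes f :: "'b \<Rightarrow> 'c::{banach, second_countable_topology}"
  assumes "c \<noteq> (0::real)"
  shows "integrable M (\<lambda>x. c *\<^sub>R f x) \<longleftrightarrow> integrable M f"
  using integrable_scaleR_right[of "1 / c" M "\<lambda>x. c *\<^sub>R f x"] integrable_scaleR_right[of c M f] assms
  by auto

lemma integrable_normalized_iff:
  fixes f :: "'b::euclidean_space \<Rightarrow> 'c::{banach, second_countable_topology}"
  assumes "unnorm_density u" and [measurable]: "f \<in> borel_measurable borel"
  shows "integrable (normalized u) f \<longleftrightarrow> integrable lborel (\<lambda>x. u x *\<^sub>R f x)"
proof -
  note [measurable] = unnorm_densityD(3)[OF assms(1)]
  note pos = unnorm_densityD(4)[OF assms(1)]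
  have "integrable (normalized u) f \<longleftrightarrow> integrable lborel (\<lambda>x. (u x / mass u) *\<^sub>R f x)"
    unfolding normalized_def using unnorm_densityD(1,4)[OF assms(1)]
    by (intro integrable_density) (auto intro: less_imp_le)
  also have "\<dots> \<longleftrightarrow> integrable lborel (\<lambda>x. (1 / mass u) *\<^sub>R (u x *\<^sub>R f x))"
    by simp
  also have "\<dots> \<longleftrightarrow> integrable lborel (\<lambda>x. u x *\<^sub>R f x)"
    using pos by (subst integrable_scaleR_right_iff) auto
  finally show ?thesis .
qed

lemma measure_normalized:
  assumes "unnorm_density u" and [measurable]: "B \<in> sets borel"
  shows "measure (normalized u) B = (\<integral>x. indicator B x * (u x / mass u) \<partial>lborel)"
proof -
  note [measurable] = unnorm_densityD(3)[OF assms(1)]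
  have "measure (normalized u) B = (\<integral>x. indicator B x \<partial>normalized u)" by simp
  also have "\<dots> = (1 / mass u) *\<^sub>R (\<integral>x. u x *\<^sub>R indicator B x \<partial>lborel)"
    by (rule integral_normalized) (use assms in simp_all)
  also have "\<dots> = (\<integral>x. (1 / mass u) *\<^sub>R (u x *\<^sub>R indicator B x) \<partial>lborel)" by simp
  also have "\<dots> = (\<integral>x. indicator B x * (u x / mass u) \<partial>lborel)"
    by (simp add: mult_ac)
  finally show ?thesis .
qed

lemma unnorm_density_scale: "unnorm_density u \<Longrightarrow> 0 < c \<Longrightarrow> unnorm_density (\<lambda>x. c * u x)"
  by (auto simp: unnorm_density_def)

lemma normalized_scale: "0 < c \<Longrightarrow> normalized (\<lambda>x. c * u x) = normalized u"
  by (simp add: normalized_def)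

lemma posterior_eq_normalized:
  assumes "unnorm_density (\<lambda>\<beta>. L \<beta> * \<pi> \<beta>)"
  shows "posterior L \<pi> = normalized (\<lambda>\<beta>. L \<beta> * \<pi> \<beta>)"
proof -
  note u = unnorm_densityD[OF assms]
  have "(\<integral>\<^sup>+ \<beta>. ennreal (L \<beta> * \<pi> \<beta>) \<partial>lborel) = ennreal (\<integral>\<beta>. L \<beta> * \<pi> \<beta> \<partial>lborel)"
    using u by (intro nn_integral_eq_integral) auto
  then show ?thesis
    unfolding posterior_def normalized_def using u by (simp add: divide_ennreal)
qed

lemma lborel_scale:
  fixes a :: "'b::euclidean_space" and f :: "'b \<Rightarrow> 'c::{banach, second_countable_topology}"
  assumes "0 < c" and [measurable]: "f \<in> borel_measurable borel"
  shows "(\<integral>x. f (a + x /\<^sub>R c) \<partial>lborel) = c ^ DIM('b) *\<^sub>R (\<integral>x. f x \<partial>lborel)" (is ?int)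
    and "integrable lborel (\<lambda>x. f (a + x /\<^sub>R c)) \<longleftrightarrow> integrable lborel f" (is ?able)
proof -
  let ?k = "\<bar>inverse c\<bar> ^ DIM('b)"
  have eq: "lborel = density (distr lborel borel (\<lambda>x. a + inverse c *\<^sub>R x)) (\<lambda>_. ennreal ?k)"
    using lborel_affine[of "inverse c" a] assms by (simp add: ennreal_power)
  have "(\<integral>x. f x \<partial>lborel) = (\<integral>x. ?k *\<^sub>R f x \<partial>distr lborel borel (\<lambda>x. a + inverse c *\<^sub>R x))"
    by (subst eq, subst integral_density) auto
  also have "\<dots> = ?k *\<^sub>R (\<integral>x. f (a + x /\<^sub>R c) \<partial>lborel)"
    by (subst integral_distr) auto
  finally show ?int using assms(1) by (simp add: power_inverse)
  have "integrable lborel f \<longleftrightarrow> integrable (distr lborel borel (\<lambda>x. a + inverse c *\<^sub>R x)) (\<lambda>x. ?k *\<^sub>R f x)"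
    by (subst eq, subst integrable_density) auto
  also have "\<dots> \<longleftrightarrow> integrable lborel (\<lambda>x. f (a + x /\<^sub>R c))"
    using assms(1) by (subst integrable_distr_eq) (auto simp: integrable_scaleR_right_iff)
  finally show ?able ..
qed

lemma unnorm_density_affine:
  fixes u :: "'b::euclidean_space \<Rightarrow> real"
  assumes "unnorm_density u" "0 < c"
  shows "unnorm_density (\<lambda>x. u (a + x /\<^sub>R c))"
  using assms lborel_scale[OF assms(2) unnorm_densityD(3)[OF assms(1)], of a]
  by (auto simp: unnorm_density_def)

text \<open>The passage to a local parameter. The Jacobian enters both the density and its mass and
  cancels, so no power of \<open>c\<close> survives.\<close>

lemma distr_normalized_affine:
  fixes u :: "'b::euclidean_space \<Rightarrow> real"
  assumes u: "unnorm_density u" and c: "0 < c"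
  shows "distr (normalized u) borel (\<lambda>x. c *\<^sub>R (x - a)) = normalized (\<lambda>x. u (a + x /\<^sub>R c))"
proof -
  note [measurable] = unnorm_densityD(3)[OF u]
  let ?Z = "\<integral>y. u y \<partial>lborel"
  let ?T = "\<lambda>x. a + inverse c *\<^sub>R x"
  let ?k = "\<bar>inverse c\<bar> ^ DIM('b)"
  have eq: "lborel = density (distr lborel borel ?T) (\<lambda>_. ennreal ?k)"
    using lborel_affine[of "inverse c" a] c by (simp add: ennreal_power)
  have "normalized u = density (density (distr lborel borel ?T) (\<lambda>_. ennreal ?k)) (\<lambda>x. ennreal (u x / ?Z))"
    unfolding normalized_def by (subst (1) eq) simp
  also have "\<dots> = density (distr lborel borel ?T) (\<lambda>x. ennreal ?k * ennreal (u x / ?Z))"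
    by (rule density_density_eq) simp_all
  also have "\<dots> = distr (density lborel (\<lambda>x. ennreal ?k * ennreal (u (?T x) / ?Z))) borel ?T"
    by (rule density_distr) simp_all
  finally have "distr (normalized u) borel (\<lambda>x. c *\<^sub>R (x - a))
      = distr (distr (density lborel (\<lambda>x. ennreal ?k * ennreal (u (?T x) / ?Z))) borel ?T) borel (\<lambda>x. c *\<^sub>R (x - a))"
    by simp
  also have "\<dots> = distr (density lborel (\<lambda>x. ennreal ?k * ennreal (u (?T x) / ?Z))) borel (\<lambda>x. x)"
    using c by (subst distr_distr) (auto simp: o_def)
  also have "\<dots> = density lborel (\<lambda>x. ennreal ?k * ennreal (u (?T x) / ?Z))"
    by (rule distr_id2) simp
  also have "\<dots> = normalized (\<lambda>x. u (a + x /\<^sub>R c))"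
    unfolding normalized_def
    using c lborel_scale(1)[OF c unnorm_densityD(3)[OF u], of a]
    by (simp add: power_inverse field_simps ennreal_mult''[symmetric] unnorm_densityD(1)[OF u] less_imp_le unnorm_densityD(4)[OF u] flip: ennreal_mult)
  finally show ?thesis .
qed

text \<open>The difference \<open>d\<close> of the two densities has integral zero, so its integral
  over \<open>B\<close> is half the integral of \<open>d\<close> weighted by +1 on \<open>B\<close>
  and by -1 off \<open>B\<close>. This turns a supremum over all Borel sets into one integral, which
  Scheffe's lemma can bound and which is visibly measurable in a parameter.\<close>

lemma tv_dist_normalized:
  fixes u v :: "'b::euclidean_space \<Rightarrow> real"
  assumes u: "unnorm_density u" and v: "unnorm_density v"
  shows "tv_dist (normalized u) (normalized v)
     = (\<integral>x. \<bar>u x / mass u - v x / mass v\<bar> \<partial>lborel) / 2"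
proof -
  note [measurable] = unnorm_densityD(3)[OF u] unnorm_densityD(3)[OF v]
  define d where "d x = u x / mass u - v x / mass v" for x
  have [measurable]: "d \<in> borel_measurable borel" unfolding d_def by measurable
  have iu: "integrable lborel (\<lambda>x. u x / mass u)" "integrable lborel (\<lambda>x. v x / mass v)"
    using unnorm_densityD(2)[OF u] unnorm_densityD(2)[OF v] by auto
  have id: "integrable lborel d" unfolding d_def using iu by (rule Bochner_Integration.integrable_diff)
  have d0: "(\<integral>x. d x \<partial>lborel) = 0"
    unfolding d_def using unnorm_densityD(4)[OF u] unnorm_densityD(4)[OF v]
    by (subst Bochner_Integration.integral_diff[OF iu]) simp
  have meas: "measure (normalized u) B - measure (normalized v) B = (\<integral>x. indicator B x * d x \<partial>lborel)"
    if [measurable]: "B \<in> sets borel" for B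
  proof -
    have "integrable lborel (\<lambda>x. indicator B x * (u x / mass u))"
       "integrable lborel (\<lambda>x. indicator B x * (v x / mass v))"
      using integrable_mult_indicator[of B lborel, OF _ iu(1)] integrable_mult_indicator[of B lborel, OF _ iu(2)]
      unfolding real_scaleR_def by simp_all
    then have "(\<integral>x. indicator B x * (u x / mass u) \<partial>lborel) - (\<integral>x. indicator B x * (v x / mass v) \<partial>lborel)
      = (\<integral>x. indicator B x * (u x / mass u) - indicator B x * (v x / mass v) \<partial>lborel)"
      by (rule Bochner_Integration.integral_diff[symmetric])
    then show ?thesis
      unfolding measure_normalized[OF u that] measure_normalized[OF v that] by (simp only: d_def right_diff_distrib)
  qed
  have ib: "integrable lborel (\<lambda>x. indicator B x * d x)" if "B \<in> sets borel" for B
    using id that by (auto intro!: integrable_real_mult_indicator simp: mult.commute[of "indicator _ _"])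
  have half: "2 * (\<integral>x. indicator B x * d x \<partial>lborel) = (\<integral>x. (indicator B x - indicator (- B) x) * d x \<partial>lborel)"
    if B: "B \<in> sets borel" for B
  proof -
    have "(\<integral>x. indicator B x * d x \<partial>lborel) + (\<integral>x. indicator (-B) x * d x \<partial>lborel) = (\<integral>x. d x \<partial>lborel)"
    proof -
      have eq: "indicator B x * d x + indicator (- B) x * d x = d x" for x by (auto simp: indicator_def)
      have "integrable lborel (\<lambda>x. indicator (- B) x * d x)" using ib[of "- B"] B by auto
      from Bochner_Integration.integral_add[OF ib[OF B] this] show ?thesis unfolding eq by simp
    qed
    moreover have "(\<integral>x. indicator B x * d x \<partial>lborel) - (\<integral>x. indicator (-B) x * d x \<partial>lborel)
        = (\<integral>x. (indicator B x - indicator (- B) x) * d x \<partial>lborel)"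
      using ib[OF B] ib[of "- B"] B
      by (subst Bochner_Integration.integral_diff[symmetric]) (auto simp: left_diff_distrib)
    ultimately show ?thesis using d0 by simp
  qed
  have upper: "\<bar>measure (normalized u) B - measure (normalized v) B\<bar> \<le> (\<integral>x. \<bar>d x\<bar> \<partial>lborel) / 2" if B: "B \<in> sets borel" for B
  proof -
    have "\<bar>\<integral>x. (indicator B x - indicator (- B) x) * d x \<partial>lborel\<bar> \<le> (\<integral>x. \<bar>(indicator B x - indicator (- B) x) * d x\<bar> \<partial>lborel)"
      by (rule integral_abs_bound)
    also have "\<dots> = (\<integral>x. \<bar>d x\<bar> \<partial>lborel)"
      by (intro Bochner_Integration.integral_cong) (auto simp: indicator_def)
    finally show ?thesis using half[OF B] meas[OF B] by simp
  qed
  \<comment> \<open>The extremal set: here the weight agrees with the sign of \<open>d\<close> and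
    the supremum is attained.\<close>
  define P where "P = {x. 0 \<le> d x}"
  have P: "P \<in> sets borel" unfolding P_def by measurable
  have "(\<integral>x. (indicator P x - indicator (- P) x) * d x \<partial>lborel) = (\<integral>x. \<bar>d x\<bar> \<partial>lborel)"
    by (intro Bochner_Integration.integral_cong) (auto simp: indicator_def P_def)
  then have attained: "(\<integral>x. \<bar>d x\<bar> \<partial>lborel) / 2 \<le> \<bar>measure (normalized u) P - measure (normalized v) P\<bar>"
    using half[OF P] meas[OF P] by simp
  have "tv_dist (normalized u) (normalized v) = (\<integral>x. \<bar>d x\<bar> \<partial>lborel) / 2"
  proof (rule antisym)
    show "tv_dist (normalized u) (normalized v) \<le> (\<integral>x. \<bar>d x\<bar> \<partial>lborel) / 2"
      by (rule cSUP_least) (use P upper in auto)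
    show "(\<integral>x. \<bar>d x\<bar> \<partial>lborel) / 2 \<le> tv_dist (normalized u) (normalized v)"
      using upper attained P by (intro cSUP_upper2[where x = P] bdd_aboveI2)
  qed
  then show ?thesis by (simp add: d_def)
qed

text \<open>Convergence of the masses makes the normalized densities converge pointwise; all of them
  have integral one, which is the remaining requirement of Scheffe's lemma.\<close>

lemma integral_abs_diff_normalized_tendsto_0:
  fixes u :: "nat \<Rightarrow> 'b::euclidean_space \<Rightarrow> real"
  assumes u: "\<And>k. unnorm_density (u k)" and v: "unnorm_density v"
    and lim: "\<And>x. (\<lambda>k. u k x) \<longlonglongrightarrow> v x" 
    and Z: "(\<lambda>k. mass (u k)) \<longlonglongrightarrow> mass v"
  shows "(\<lambda>k. \<integral>x. \<bar>u k x / mass (u k) - v x / mass v\<bar> \<partial>lborel) \<longlonglongrightarrow> 0"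
proof -
  let ?F = "\<lambda>k x. u k x / mass (u k)" and ?f = "\<lambda>x. v x / mass v"
  note [measurable] = unnorm_densityD(3)[OF u] unnorm_densityD(3)[OF v]
  have one: "(\<integral>\<^sup>+x. norm (w x / mass w) \<partial>lborel) = 1" if "unnorm_density w" for w :: "'b \<Rightarrow> real"
  proof -
    note w = unnorm_densityD[OF that]
    have "(\<integral>\<^sup>+x. norm (w x / mass w) \<partial>lborel) = ennreal (\<integral>x. norm (w x / mass w) \<partial>lborel)"
      using w by (intro nn_integral_eq_integral) auto
    also have "\<dots> = 1" using w by (simp add: abs_of_nonneg)
    finally show ?thesis .
  qed
  have iF: "integrable lborel (?F k)" for k using unnorm_densityD(2)[OF u] by simp
  have "integrable lborel ?f" using unnorm_densityD(2)[OF v] by simp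
  have "(\<lambda>k. \<integral>\<^sup>+x. norm (?F k x - ?f x) \<partial>lborel) \<longlonglongrightarrow> 0"
  proof (rule Scheffe_lemma2)
    show "AE x in lborel. (\<lambda>k. ?F k x) \<longlonglongrightarrow> ?f x"
      using unnorm_densityD(4)[OF v] by (auto intro!: tendsto_divide lim Z)
  qed (use \<open>integrable lborel ?f\<close> one u v in simp_all)
  moreover have "(\<integral>\<^sup>+x. norm (?F k x - ?f x) \<partial>lborel) = ennreal (\<integral>x. \<bar>?F k x - ?f x\<bar> \<partial>lborel)" for k
    using iF \<open>integrable lborel ?f\<close> by (subst nn_integral_eq_integral) auto
  ultimately have "(\<lambda>k. ennreal (\<integral>x. \<bar>?F k x - ?f x\<bar> \<partial>lborel)) \<longlonglongrightarrow> ennreal 0" by simp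
  then show ?thesis by (subst (asm) tendsto_ennreal_iff) auto
qed

section \<open>Multivariate normal distributions\<close>

lemma lborel_product_integral:
  fixes f :: "'b::euclidean_space \<Rightarrow> real \<Rightarrow> real"
  assumes "\<And>b. b \<in> Basis \<Longrightarrow> integrable lborel (f b)"
  shows "integrable lborel (\<lambda>x. \<Prod>b\<in>Basis. f b (x \<bullet> b))" (is ?int)
    and "(\<integral>x. (\<Prod>b\<in>Basis. f b (x \<bullet> b)) \<partial>lborel) = (\<Prod>b\<in>Basis. \<integral>x. f b x \<partial>lborel)" (is ?eq)
proof -
  interpret product_sigma_finite "\<lambda>_::'b. lborel :: real measure" ..
  have [measurable]: "b \<in> Basis \<Longrightarrow> f b \<in> borel_measurable borel" for b
    using assms by (auto dest: borel_measurable_integrable)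
  have [simp]: "(\<Prod>b\<in>Basis. f b ((\<Sum>c\<in>Basis. x c *\<^sub>R c) \<bullet> b)) = (\<Prod>b\<in>Basis. f b (x b))" for x
    by (intro prod.cong refl) simp
  show ?int
    by (subst lborel_eq, subst integrable_distr_eq) (auto intro!: product_integrable_prod assms)
  show ?eq
    by (subst lborel_eq, subst integral_distr) (auto intro!: product_integral_prod assms)
qed

text \<open>Written as a product over the basis so that moments split into one-dimensional ones; the
  closed form follows in \<open>std_gauss_eq\<close>.\<close>

definition std_gauss :: "'b::euclidean_space \<Rightarrow> real" where
  "std_gauss x = (\<Prod>b\<in>Basis. std_normal_density (x \<bullet> b))"

lemma std_gauss_eq: "std_gauss (x::'b::euclidean_space) = exp (- (x \<bullet> x) / 2) / sqrt (2 * pi) ^ DIM('b)"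
proof -
  have "std_gauss x = (\<Prod>b\<in>Basis. exp (- (x \<bullet> b)\<^sup>2 / 2)) / (\<Prod>b\<in>(Basis::'b set). sqrt (2 * pi))"
    unfolding std_gauss_def std_normal_density_def by (subst prod_dividef[symmetric]) simp
  also have "(\<Prod>b\<in>Basis. exp (- (x \<bullet> b)\<^sup>2 / 2)) = exp (- (x \<bullet> x) / 2)"
    by (simp add: euclidean_inner[of x x] power2_eq_square sum_negf sum_divide_distrib flip: exp_sum)
  finally show ?thesis by simp
qed

text \<open>Multiplication by \<open>x \<bullet> b\<close> changes only the factor at the coordinate
  \<open>b\<close>, so every moment is again a product of one-dimensional integrals. It vanishes as
  soon as one factor is a first moment.\<close>

lemma std_gauss_moments:
  fixes b c :: "'b::euclidean_space"
  assumes "b \<in> Basis" "c \<in> Basis"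
  shows "integrable lborel (std_gauss :: 'b \<Rightarrow> real)" (is ?g1) "(\<integral>x. std_gauss (x::'b) \<partial>lborel) = 1"
    "integrable lborel (\<lambda>x. std_gauss x * (x \<bullet> b))" (is ?g2) "(\<integral>x. std_gauss x * (x \<bullet> b) \<partial>lborel) = 0" (is ?g3)
    "integrable lborel (\<lambda>x. std_gauss x * ((x \<bullet> b) * (x \<bullet> c)))" (is ?g4)
    "(\<integral>x. std_gauss x * ((x \<bullet> b) * (x \<bullet> c)) \<partial>lborel) = (if b = c then 1 else 0)" (is ?g5)
proof -
  have m0: "(\<integral>x. std_normal_density x \<partial>lborel) = 1" by simp
  have m1: "integrable lborel (\<lambda>x. std_normal_density x * x)" "(\<integral>x. std_normal_density x * x \<partial>lborel) = 0"
    using integrable_std_normal_moment[of 1] integral_std_normal_moment_odd[of 0] by simp_all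
  have m2: "integrable lborel (\<lambda>x. std_normal_density x * (x * x))" "(\<integral>x. std_normal_density x * (x * x) \<partial>lborel) = 1"
    using integrable_std_normal_moment[of 2] integral_std_normal_moment_even[of 1]
    by (simp_all add: power2_eq_square fact_numeral)
  show ?g1 "(\<integral>x. std_gauss (x::'b) \<partial>lborel) = 1"
    unfolding std_gauss_def[abs_def]
    by (subst lborel_product_integral; simp)+
  define f where "f d t = std_normal_density t * (if d = b then t else 1)" for d :: 'b and t
  have f: "std_gauss x * (x \<bullet> b) = (\<Prod>d\<in>Basis. f d (x \<bullet> d))" for x
    using assms by (simp add: f_def std_gauss_def prod.distrib)
  have fi: "integrable lborel (f d)" for d by (cases "d = b") (auto simp: f_def[abs_def] m1)
  show ?g2
    unfolding f by (rule lborel_product_integral) (rule fi)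
  show ?g3
    unfolding f using assms(1) m1
    by (subst lborel_product_integral[OF fi]) (auto simp: f_def[abs_def] intro!: bexI[of _ b])
  define g where "g d t = std_normal_density t * ((if d = b then t else 1) * (if d = c then t else 1))" for d :: 'b and t
  have g: "std_gauss x * ((x \<bullet> b) * (x \<bullet> c)) = (\<Prod>d\<in>Basis. g d (x \<bullet> d))" for x
    using assms by (simp add: g_def std_gauss_def prod.distrib)
  have gi: "integrable lborel (g d)" for d
    by (cases "d = b"; cases "d = c") (auto simp: g_def[abs_def] m1 m2)
  show ?g4
    unfolding g by (rule lborel_product_integral) (rule gi)
  have "(\<Prod>d\<in>Basis. \<integral>t. g d t \<partial>lborel) = (if b = c then 1 else 0)"
  proof (cases "b = c")
    case True
    then have "(\<integral>t. g d t \<partial>lborel) = 1" for d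
      using m2 by (cases "d = b") (auto simp: g_def[abs_def])
    then show ?thesis using True by simp
  next
    case False
    then have "(\<integral>t. g b t \<partial>lborel) = 0"
      using m1 by (auto simp: g_def[abs_def])
    then show ?thesis using False assms(1) by (auto intro!: bexI[of _ b])
  qed
  then show ?g5
    unfolding g by (subst lborel_product_integral[OF gi])
qed

lemma integral_std_gauss: "(\<integral>x. std_gauss (x::'b::euclidean_space) \<partial>lborel) = 1"
  and unnorm_density_std_gauss: "unnorm_density (std_gauss :: 'b \<Rightarrow> real)"
proof -
  obtain b :: 'b where "b \<in> Basis" using nonempty_Basis by blast
  note m = std_gauss_moments[OF this this]
  have "0 \<le> std_gauss x" for x :: 'b by (simp add: std_gauss_eq)
  with m show "unnorm_density (std_gauss :: 'b \<Rightarrow> real)" by (simp add: unnorm_density_def)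
qed (rule std_gauss_moments, rule SOME_Basis, rule SOME_Basis)

section \<open>Change of variables under invertible linear maps\<close>

text \<open>By Fubini it suffices to integrate first over the coordinate \<open>a\<close> with all
  others fixed; on such a line the shear is a translation by the value of the coordinate
  \<open>b\<close>.\<close>

lemma lborel_shear:
  fixes a b :: "'b::euclidean_space"
  assumes ab: "a \<in> Basis" "b \<in> Basis" "a \<noteq> b"
  shows "lborel = distr lborel borel (\<lambda>x. x + (x \<bullet> b) *\<^sub>R a)" (is "_ = distr _ _ ?T")
proof (rule measure_eqI)
  interpret product_sigma_finite "\<lambda>_::'b. lborel :: real measure" ..
  fix A :: "'b set" assume "A \<in> sets lborel"
  then have [measurable]: "A \<in> sets borel" by simp
  define I where "I = Basis - {a}"
  have I: "finite I" "a \<notin> I" "insert a I = Basis" "b \<in> I" using ab by (auto simp: I_def)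
  define F where "F f = (indicator A (\<Sum>c\<in>Basis. f c *\<^sub>R c) :: ennreal)" for f :: "'b \<Rightarrow> real"
  define G where "G f = F (f(a := f a + f b))" for f :: "'b \<Rightarrow> real"
  have [measurable]: "F \<in> borel_measurable (\<Pi>\<^sub>M c\<in>Basis. lborel)" unfolding F_def by measurable
  have T: "?T (\<Sum>c\<in>Basis. f c *\<^sub>R c) = (\<Sum>c\<in>Basis. (f(a := f a + f b)) c *\<^sub>R c)" for f
  proof (rule euclidean_eqI)
    fix c :: 'b assume "c \<in> Basis"
    then show "?T (\<Sum>c\<in>Basis. f c *\<^sub>R c) \<bullet> c = (\<Sum>c\<in>Basis. (f(a := f a + f b)) c *\<^sub>R c) \<bullet> c"
      using ab by (simp only: inner_add_left inner_scaleR_left inner_sum_left_Basis) (auto simp: inner_Basis)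
  qed
  have G: "G f = indicator A (?T (\<Sum>c\<in>Basis. f c *\<^sub>R c))" for f
    by (simp add: G_def F_def T)
  have [measurable]: "G \<in> borel_measurable (\<Pi>\<^sub>M c\<in>Basis. lborel)" unfolding G by measurable
  have "emeasure (distr lborel borel ?T) A = (\<integral>\<^sup>+x. indicator A x \<partial>distr lborel borel ?T)" by simp
  also have "\<dots> = (\<integral>\<^sup>+x. indicator A (?T x) \<partial>lborel)" by (rule nn_integral_distr) simp_all
  also have "\<dots> = (\<integral>\<^sup>+f. G f \<partial>(\<Pi>\<^sub>M c\<in>Basis. lborel))"
    unfolding G by (subst lborel_eq) (simp add: nn_integral_distr)
  also have "\<dots> = (\<integral>\<^sup>+f. \<integral>\<^sup>+y. G (f(a := y)) \<partial>lborel \<partial>(\<Pi>\<^sub>M c\<in>I. lborel))"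
    unfolding I(3)[symmetric] by (rule product_nn_integral_insert) (use I in simp_all)
  also have "\<dots> = (\<integral>\<^sup>+f. \<integral>\<^sup>+y. F (f(a := y)) \<partial>lborel \<partial>(\<Pi>\<^sub>M c\<in>I. lborel))"
  proof (rule nn_integral_cong)
    fix f assume f: "f \<in> space (\<Pi>\<^sub>M c\<in>I. (lborel :: real measure))"
    have "(\<lambda>y. f(a := y)) \<in> measurable borel (\<Pi>\<^sub>M c\<in>insert a I. lborel)"
      using measurable_component_update[OF f I(2)] by simp
    then have [measurable]: "(\<lambda>y. F (f(a := y))) \<in> borel_measurable borel"
      unfolding I(3) by measurable
    have "(\<integral>\<^sup>+y. G (f(a := y)) \<partial>lborel) = (\<integral>\<^sup>+y. F (f(a := f b + 1 * y)) \<partial>lborel)"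
      using I ab by (simp add: G_def add.commute)
    also have "\<dots> = (\<integral>\<^sup>+y. F (f(a := y)) \<partial>lborel)"
      using nn_integral_real_affine[of "\<lambda>y. F (f(a := y))" 1 "f b"] by simp
    finally show "(\<integral>\<^sup>+y. G (f(a := y)) \<partial>lborel) = (\<integral>\<^sup>+y. F (f(a := y)) \<partial>lborel)" .
  qed
  also have "\<dots> = (\<integral>\<^sup>+f. F f \<partial>(\<Pi>\<^sub>M c\<in>Basis. lborel))"
    unfolding I(3)[symmetric] by (rule product_nn_integral_insert[symmetric]) (use I in simp_all)
  also have "\<dots> = (\<integral>\<^sup>+x. indicator A x \<partial>lborel)"
  proof -
    have "(\<integral>\<^sup>+f. F f \<partial>(\<Pi>\<^sub>M c\<in>Basis. lborel))
        = (\<integral>\<^sup>+x. indicator A x \<partial>distr (\<Pi>\<^sub>M c\<in>Basis. lborel) borel (\<lambda>f. \<Sum>c\<in>Basis. f c *\<^sub>R c))"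
      unfolding F_def by (rule nn_integral_distr[symmetric]) simp_all
    then show ?thesis by (simp only: lborel_eq[symmetric])
  qed
  finally show "emeasure lborel A = emeasure (distr lborel borel ?T) A" by simp
qed simp

lemma lborel_swap_coordinates:
  "lborel = distr lborel borel (\<lambda>x::real^'n. \<chi> i. x $ Transposition.transpose m n i)" (is "_ = distr _ _ ?T")
proof (rule lborel_eqI)
  have [simp]: "Transposition.transpose m n (Transposition.transpose m n i) = i" for i by simp
  fix l u :: "real^'n" assume le: "\<And>b. b \<in> Basis \<Longrightarrow> l \<bullet> b \<le> u \<bullet> b"
  then have le': "l $ i \<le> u $ i" for i by (metis axis_in_Basis_iff inner_axis inner_real_def mult.right_neutral insertI1 Basis_real_def)
  have "?T -` box l u = box (?T l) (?T u)"
    by (auto simp: mem_box_cart) (metis Transposition.transpose_involutory)+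
  moreover have prod: "(\<Prod>b\<in>Basis. (u - l) \<bullet> b) = (\<Prod>i\<in>UNIV. u $ i - l $ i)" for u l :: "real^'n"
  proof -
    have B: "(Basis :: (real^'n) set) = (\<lambda>i. axis i 1) ` UNIV" by (auto simp: Basis_vec_def)
    show ?thesis unfolding B by (subst prod.reindex) (auto simp: inj_on_def axis_eq_axis inner_axis)
  qed
  moreover have "(\<Prod>i\<in>UNIV. u $ Transposition.transpose m n i - l $ Transposition.transpose m n i) = (\<Prod>i\<in>UNIV. u $ i - l $ i)"
    by (rule prod.reindex_bij_witness[of _ "Transposition.transpose m n" "Transposition.transpose m n"]) auto
  ultimately show "emeasure (distr lborel borel ?T) (box l u) = (\<Prod>b\<in>Basis. (u - l) \<bullet> b)"
    using le' by (subst emeasure_distr) (auto simp: emeasure_lborel_box_eq Basis_vec_def inner_axis)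
qed simp

text \<open>The formula is multiplicative in \<open>B\<close>, so elementary matrices suffice: a
  zero row is excluded by the determinant, a diagonal matrix scales the axes, and transpositions and
  shears preserve the measure.\<close>

lemma lborel_linear_image:
  fixes B :: "real^'n^'n"
  assumes "det B \<noteq> 0"
  shows "lborel = density (distr lborel borel (\<lambda>x. B *v x)) (\<lambda>_. ennreal \<bar>det B\<bar>)"
  using assms
proof (induction B rule: induct_matrix_elementary_alt)
  case (1 A B)
  then have nz: "det A \<noteq> 0" "det B \<noteq> 0" by (auto simp: det_mul)
  have "lborel = density (distr (density (distr lborel borel (\<lambda>x. B *v x)) (\<lambda>_. ennreal \<bar>det B\<bar>)) borel (\<lambda>x. A *v x)) (\<lambda>_. ennreal \<bar>det A\<bar>)"
    using 1(1)[OF nz(1)] 1(2)[OF nz(2)] by simp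
  also have "distr (density (distr lborel borel (\<lambda>x. B *v x)) (\<lambda>_. ennreal \<bar>det B\<bar>)) borel (\<lambda>x. A *v x)
     = density (distr (distr lborel borel (\<lambda>x. B *v x)) borel (\<lambda>x. A *v x)) (\<lambda>_. ennreal \<bar>det B\<bar>)"
    by (rule density_distr[symmetric]) simp_all
  also have "distr (distr lborel borel (\<lambda>x. B *v x)) borel (\<lambda>x. A *v x) = distr lborel borel (\<lambda>x. (A ** B) *v x)"
    by (subst distr_distr) (simp_all add: o_def matrix_vector_mul_assoc)
  finally show ?case
    by (simp add: density_density_eq det_mul abs_mult ennreal_mult' mult.commute)
next
  case (2 A i)
  then show ?case using det_zero_row(2) by blast
next
  case (3 A)
  define c where "c b = b \<bullet> (A *v b)" for b :: "real^'n"
  have B: "(Basis :: (real^'n) set) = (\<lambda>i. axis i 1) ` UNIV" by (auto simp: Basis_vec_def)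
  have c: "c (axis i 1) = A $ i $ i" for i
    by (simp add: c_def matrix_vector_mult_basis inner_axis' column_def)
  have det: "det A = (\<Prod>i\<in>UNIV. A $ i $ i)" using 3(1) by (rule det_diagonal)
  have nz: "A $ i $ i \<noteq> 0" for i using 3(2) by (simp add: det)
  have T: "A *v x = 0 + (\<Sum>j\<in>Basis. (c j * (x \<bullet> j)) *\<^sub>R j)" for x
  proof -
    have "(A *v x) $ i = A $ i $ i * x $ i" for i
    proof -
      have "(A *v x) $ i = (\<Sum>j\<in>UNIV. A $ i $ j * x $ j)" by (simp add: matrix_vector_mult_def)
      also have "\<dots> = (\<Sum>j\<in>UNIV. if j = i then A $ i $ i * x $ i else 0)"
        using 3(1)[of i] by (intro sum.cong) auto
      finally have "(A *v x) $ i = (\<Sum>j\<in>UNIV. if j = i then A $ i $ i * x $ i else 0)" .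
      then show ?thesis by simp
    qed
    moreover have "(\<Sum>j\<in>Basis. (c j * (x \<bullet> j)) *\<^sub>R j) = (\<Sum>k\<in>UNIV. (A $ k $ k * x $ k) *\<^sub>R axis k 1)"
      unfolding B by (subst sum.reindex) (auto simp: inj_on_def axis_eq_axis c inner_axis)
    ultimately show ?thesis
      by (auto simp: vec_eq_iff axis_def if_distrib cong: if_cong)
  qed
  have "lborel = density (distr lborel borel (\<lambda>x. 0 + (\<Sum>j\<in>Basis. (c j * (x \<bullet> j)) *\<^sub>R j))) (\<lambda>_. (\<Prod>j\<in>Basis. \<bar>c j\<bar>))"
    by (rule lborel_affine_euclidean) (auto simp: B c nz)
  moreover have "(\<Prod>j\<in>Basis. \<bar>c j\<bar>) = \<bar>det A\<bar>"
    unfolding B by (subst prod.reindex) (auto simp: inj_on_def axis_eq_axis c det abs_prod)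
  ultimately show ?case by (simp add: T[abs_def])
next
  case (4 m n)
  let ?t = "Transposition.transpose m n" and ?T = "(\<chi> i j. (mat 1 :: real^'n^'n) $ i $ Transposition.transpose m n j)"
  have mat: "?T *v x = (\<chi> i. x $ ?t i)" for x
  proof -
    have "(\<Sum>j\<in>UNIV. (if i = ?t j then 1 else 0) * x $ j) = (\<Sum>j\<in>UNIV. if j = ?t i then x $ j else 0)" for i
    proof (intro sum.cong refl)
      fix j
      have "i = ?t j \<longleftrightarrow> j = ?t i"
        by (metis Transposition.transpose_involutory)
      then show "(if i = ?t j then 1 else 0) * x $ j = (if j = ?t i then x $ j else 0)"
        by simp
    qed
    then show ?thesis by (simp add: vec_eq_iff matrix_vector_mult_def mat_def)
  qed
  have "det ?T = of_int (sign (?t)) * det (mat 1 :: real^'n^'n)"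
    by (rule det_permute_columns) (simp add: permutes_swap_id)
  then have "\<bar>det ?T\<bar> = 1"
    by (simp add: sign_def)
  then show ?case
    unfolding mat using lborel_swap_coordinates[of m n] by (simp add: density_1)
next
  case (5 m n)
  have sum: "(\<chi> i j. of_bool (i = m \<and> j = n \<or> i = j)) *v x = x + (x \<bullet> axis n 1) *\<^sub>R axis m 1" for x :: "real^'n"
  proof -
    have "(\<Sum>j\<in>UNIV. of_bool (i = m \<and> j = n \<or> i = j) * x $ j) = x $ i + (if i = m then x $ n else 0)" for i
    proof -
      have "(\<Sum>j\<in>UNIV. of_bool (i = m \<and> j = n \<or> i = j) * x $ j)
        = (\<Sum>j\<in>UNIV. (if j = i then x $ j else 0) + (if j = n then (if i = m then x $ n else 0) else 0))"
        using 5(1) by (intro sum.cong) auto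
      then show ?thesis by (simp add: sum.distrib)
    qed
    moreover have "x \<bullet> axis n 1 = x $ n" by (simp add: inner_axis)
    ultimately show ?thesis by (auto simp: vec_eq_iff matrix_vector_mult_def axis_def)
  qed
  have "(\<chi> i j. of_bool (i = m \<and> j = n \<or> i = j)) = (\<chi> k. if k = m then row m (mat 1 :: real^'n^'n) + 1 *s row n (mat 1) else row k (mat 1))"
    using 5(1) by (auto simp: vec_eq_iff row_def mat_def)
  then have "det (\<chi> i j. of_bool (i = m \<and> j = n \<or> i = j) :: real^'n^'n) = 1"
    using det_row_operation[OF 5(1), of "mat 1 :: real^'n^'n" 1] by simp
  moreover have "lborel = distr lborel borel (\<lambda>x::real^'n. x + (x \<bullet> axis n 1) *\<^sub>R axis m 1)"
    by (rule lborel_shear) (use 5(1) in \<open>auto simp: axis_in_Basis_iff axis_eq_axis\<close>)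
  ultimately show ?case unfolding sum by (simp add: density_1)
qed

lemma lborel_affine_image:
  fixes B :: "real^'n^'n"
  assumes "invertible B"
  shows "lborel = density (distr lborel borel (\<lambda>x. a + B *v x)) (\<lambda>_. ennreal \<bar>det B\<bar>)"
proof -
  have nz: "det B \<noteq> 0" using assms by (simp add: invertible_det_nz)
  have shift: "lborel = distr lborel borel (\<lambda>x. a + x)"
    using lborel_affine[of 1 a] by (simp add: density_1)
  have "lborel = distr (density (distr lborel borel (\<lambda>x. B *v x)) (\<lambda>_. ennreal \<bar>det B\<bar>)) borel (\<lambda>x. a + x)"
    using shift lborel_linear_image[OF nz] by simp
  also have "\<dots> = density (distr (distr lborel borel (\<lambda>x. B *v x)) borel (\<lambda>x. a + x)) (\<lambda>_. ennreal \<bar>det B\<bar>)"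
    by (rule density_distr[symmetric]) simp_all
  also have "distr (distr lborel borel (\<lambda>x. B *v x)) borel (\<lambda>x. a + x) = distr lborel borel (\<lambda>x. a + B *v x)"
    by (subst distr_distr) (simp_all add: o_def)
  finally show ?thesis .
qed

section \<open>Normal laws as affine images of the standard normal law\<close>

text \<open>Since \<open>B\<close> whitens the precision matrix, the quadratic form at
  \<open>\<mu> + B *v y\<close> is \<open>y \<bullet> y\<close>, and the Jacobian
  \<open>\<bar>det B\<bar>\<close> is exactly the square root of \<open>det A\<close> in the
  normalising constant.\<close>

lemma mvnormal_eq_distr:
  fixes A B :: "real^'n^'n"
  assumes A: "pos_def A" and B: "transpose B ** matrix_inv A ** B = mat 1"
  shows "mvnormal \<mu> A = distr (normalized std_gauss) borel (\<lambda>y. \<mu> + B *v y)"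
proof -
  let ?T = "\<lambda>y. \<mu> + B *v y"
  let ?P = "matrix_inv A"
  define g where "g x = exp (- ((x - \<mu>) \<bullet> (?P *v (x - \<mu>))) / 2) / sqrt ((2 * pi) ^ CARD('n) * det A)" for x
  have [measurable]: "?T \<in> borel \<rightarrow>\<^sub>M borel" "g \<in> borel_measurable borel"
    unfolding g_def by measurable
  have BB: "B ** transpose B = A"
    using whitening_inv[OF B] by (simp add: matrix_inv_matrix_inv pos_def_invertible[OF A])
  then have det: "det A = (det B)\<^sup>2" by (metis det_mul det_transpose power2_eq_square)
  then have nz: "det B \<noteq> 0" using pos_def_det_pos[OF A] by auto
  then have inv: "invertible B" by (simp add: invertible_det_nz)
  have quad: "(B *v y) \<bullet> (?P *v (B *v y)) = y \<bullet> y" for y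
  proof -
    have "(B *v y) \<bullet> (?P *v (B *v y)) = y \<bullet> ((transpose B ** ?P ** B) *v y)"
      by (metis dot_lmul_matrix inner_commute matrix_vector_mul_assoc transpose_matrix_vector)
    then show ?thesis by (simp add: B)
  qed
  have sq: "sqrt ((2 * pi) ^ CARD('n) * (det B)\<^sup>2) = sqrt (2 * pi) ^ CARD('n) * \<bar>det B\<bar>"
    by (subst real_sqrt_mult) (simp only: real_sqrt_abs real_sqrt_power[of "2 * pi"])
  have gT: "\<bar>det B\<bar> * g (?T y) = std_gauss y" for y
    unfolding g_def det sq std_gauss_eq using nz by (simp add: quad)
  have "mvnormal \<mu> A = density lborel (\<lambda>x. ennreal (g x))" by (simp add: mvnormal_def g_def)
  also have "\<dots> = density (density (distr lborel borel ?T) (\<lambda>_. ennreal \<bar>det B\<bar>)) (\<lambda>x. ennreal (g x))"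
    by (subst (1) lborel_affine_image[OF inv, of \<mu>]) simp
  also have "\<dots> = density (distr lborel borel ?T) (\<lambda>x. ennreal \<bar>det B\<bar> * ennreal (g x))"
    by (rule density_density_eq) simp_all
  also have "\<dots> = distr (density lborel (\<lambda>y. ennreal \<bar>det B\<bar> * ennreal (g (?T y)))) borel ?T"
    by (rule density_distr) simp_all
  also have "(\<lambda>y. ennreal \<bar>det B\<bar> * ennreal (g (?T y))) = (\<lambda>y. ennreal (std_gauss y))"
    by (simp add: gT flip: ennreal_mult')
  also have "density lborel \<dots> = normalized std_gauss"
    by (simp add: normalized_def integral_std_gauss)
  finally show ?thesis .
qed

text \<open>The parameter \<open>P\<close> is the precision matrix, not the covariance: this is the
  matrix that occurs in the limiting exponent.\<close>

definition gauss_kernel :: "real^'n \<Rightarrow> real^'n^'n \<Rightarrow> real^'n \<Rightarrow> real" where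
  "gauss_kernel \<mu> P x = exp (- ((x - \<mu>) \<bullet> (P *v (x - \<mu>)) / 2))"

lemma borel_measurable_gauss_kernel [measurable]: "gauss_kernel \<mu> P \<in> borel_measurable borel"
  unfolding gauss_kernel_def by measurable

text \<open>The moments are transported from the standard normal along y -> mu + B y with B B^T = A,
  so the mean is mu and the covariance is B B^T.\<close>

lemma
  fixes A :: "real^'n^'n"
  assumes A: "pos_def A"
  shows prob_space_mvnormal: "prob_space (mvnormal \<mu> A)"
    and mean_vec_mvnormal: "mean_vec (mvnormal \<mu> A) = \<mu>" (is ?g1)
    and cov_mat_mvnormal: "cov_mat (mvnormal \<mu> A) = A"
    and unnorm_density_gauss_kernel: "unnorm_density (gauss_kernel \<mu> (matrix_inv A))" (is ?g2)
    and mvnormal_eq_normalized: "mvnormal \<mu> A = normalized (gauss_kernel \<mu> (matrix_inv A))" (is ?g3)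
proof -
  obtain B :: "real^'n^'n" where B: "transpose B ** matrix_inv A ** B = mat 1"
    using pos_def_whitening[OF pos_def_matrix_inv[OF A]] .
  have BB: "B ** transpose B = A"
    using whitening_inv[OF B] by (simp add: matrix_inv_matrix_inv pos_def_invertible[OF A])
  note eq = mvnormal_eq_distr[OF A B, of \<mu>]
  let ?N = "normalized (std_gauss :: real^'n \<Rightarrow> real)"
  interpret N: prob_space ?N by (rule prob_space_normalized[OF unnorm_density_std_gauss])
  note [simp] = integral_std_gauss
  have [measurable]: "std_gauss \<in> borel_measurable (borel :: (real^'n) measure)"
    by (rule unnorm_densityD[OF unnorm_density_std_gauss])
  have ax: "axis i (1::real) \<in> (Basis :: (real^'n) set)" for i by (simp add: axis_in_Basis_iff)
  have nth: "(x::real^'n) $ i = x \<bullet> axis i 1" for x i by (simp add: inner_axis)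
  note mom = std_gauss_moments[OF ax ax]
  have int1: "integrable ?N (\<lambda>x. x $ i)" "(\<integral>x. x $ i \<partial>?N) = 0" for i
    using mom(3)[of i] mom(4)[of i] by (simp_all add: integrable_normalized_iff integral_normalized unnorm_density_std_gauss nth)
  have int2: "integrable ?N (\<lambda>x. x $ i * x $ j)" "(\<integral>x. x $ i * x $ j \<partial>?N) = (if i = j then 1 else 0)" for i j
    using mom(5,6)[of i j] by (simp_all add: integrable_normalized_iff integral_normalized unnorm_density_std_gauss nth axis_eq_axis)
  show ps: "prob_space (mvnormal \<mu> A)"
    unfolding eq by (rule N.prob_space_distr) simp
  have intx: "integrable ?N (\<lambda>x. \<Sum>i\<in>UNIV. x $ i *\<^sub>R axis i (1::real))"
    using int1 by (intro Bochner_Integration.integrable_sum integrable_scaleR_left) auto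
  have rep: "(\<Sum>i\<in>UNIV. x $ i *\<^sub>R axis i (1::real)) = x" for x :: "real^'n"
    using basis_expansion[of x] by (simp add: scalar_mult_eq_scaleR)
  have intT: "integrable ?N (\<lambda>x. \<mu> + B *v x)"
    using intx[unfolded rep] by (intro Bochner_Integration.integrable_add integrable_bounded_linear[OF matrix_vector_mul_bounded_linear]) auto
  have "mean_vec (mvnormal \<mu> A) = (\<integral>x. \<mu> + B *v x \<partial>?N)"
    unfolding mean_vec_def eq by (subst integral_distr) auto
  moreover have "(\<integral>x. \<mu> + B *v x \<partial>?N) $ i = \<mu> $ i" for i
  proof -
    have "(\<integral>x. \<mu> + B *v x \<partial>?N) $ i = (\<integral>x. (\<mu> + B *v x) $ i \<partial>?N)"
      using integral_bounded_linear[OF bounded_linear_vec_nth[of i] intT] by simp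
    also have "\<dots> = \<mu> $ i"
      using int1 N.prob_space by (simp add: matrix_vector_mult_def)
    finally show ?thesis .
  qed
  ultimately show mean: ?g1 by (simp add: vec_eq_iff)
  have "cov_mat (mvnormal \<mu> A) $ i $ j = A $ i $ j" for i j
  proof -
    have "cov_mat (mvnormal \<mu> A) $ i $ j = (\<integral>x. (B *v x) $ i * (B *v x) $ j \<partial>?N)"
      unfolding cov_mat_def mean vec_lambda_beta unfolding eq by (subst integral_distr) auto
    also have "\<dots> = (\<integral>x. (\<Sum>k\<in>UNIV. \<Sum>l\<in>UNIV. (B $ i $ k * B $ j $ l) * (x $ k * x $ l)) \<partial>?N)"
      by (simp add: matrix_vector_mult_def sum_product mult_ac)
    also have "\<dots> = (\<Sum>k\<in>UNIV. \<Sum>l\<in>UNIV. (B $ i $ k * B $ j $ l) * (if k = l then 1 else 0))"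
      using int2 by simp
    also have "\<dots> = (B ** transpose B) $ i $ j"
      by (simp add: matrix_matrix_mult_def transpose_def if_distrib cong: if_cong)
    finally show ?thesis by (simp add: BB)
  qed
  then show "cov_mat (mvnormal \<mu> A) = A" by (simp add: vec_eq_iff)
  define k where "k = sqrt ((2 * pi) ^ CARD('n) * det A)"
  have k: "k > 0" using pos_def_det_pos[OF A] by (simp add: k_def)
  have dens: "mvnormal \<mu> A = density lborel (\<lambda>x. ennreal (gauss_kernel \<mu> (matrix_inv A) x / k))"
    by (simp add: mvnormal_def gauss_kernel_def k_def)
  \<comment> \<open>The mass of the kernel is not computed by integration: the law is already known
    to be a probability measure, which forces the mass to be \<open>k\<close>.\<close>
  have "emeasure (mvnormal \<mu> A) UNIV = 1"
    using prob_space.emeasure_space_1[OF ps] by (simp add: dens)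
  then have nn: "(\<integral>\<^sup>+x. ennreal (gauss_kernel \<mu> (matrix_inv A) x / k) \<partial>lborel) = 1"
    by (simp add: dens emeasure_density)
  have nonneg: "0 \<le> gauss_kernel \<mu> (matrix_inv A) x" for x by (simp add: gauss_kernel_def)
  have int: "integrable lborel (\<lambda>x. gauss_kernel \<mu> (matrix_inv A) x / k)"
    using k nonneg by (intro integrableI_nonneg) (auto simp: nn)
  then have int': "integrable lborel (gauss_kernel \<mu> (matrix_inv A))"
    using k integrable_scaleR_right_iff[of "1 / k" lborel "gauss_kernel \<mu> (matrix_inv A)"] by simp
  have "ennreal (\<integral>x. gauss_kernel \<mu> (matrix_inv A) x / k \<partial>lborel) = 1"
    using nn nn_integral_eq_integral[OF int] k nonneg by simp
  then have Z: "(\<integral>x. gauss_kernel \<mu> (matrix_inv A) x \<partial>lborel) = k" using k by simp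
  show ?g2
    using Z k nonneg int' by (simp add: unnorm_density_def)
  show ?g3
    by (simp add: dens normalized_def Z)
qed

section \<open>Pointwise limits of convex functions\<close>

text \<open>Mere density is not enough: upper bounds for a convex function at finitely many points of \<open>D\<close> must
  pass to a whole neighbourhood of \<open>x\<close>.\<close>

definition simplex_dense :: "'b::euclidean_space set \<Rightarrow> bool" where
  "simplex_dense D \<longleftrightarrow> (\<forall>x e. 0 < e \<longrightarrow> (\<exists>s. finite s \<and> s \<subseteq> D \<and> s \<subseteq> ball x e \<and> x \<in> interior (convex hull s)))"

text \<open>The corners of all cubes with centre in a countable dense set and half-width 1 / (n + 1)
  form such a set: every point lies in the interior of arbitrarily small cubes of this
  family.\<close>

lemma countable_simplex_dense_exists:
  obtains D :: "'b::euclidean_space set" where "countable D" "simplex_dense D"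
proof -
  obtain Q :: "'b set" where Q: "countable Q" "\<And>X. open X \<Longrightarrow> X \<noteq> {} \<Longrightarrow> \<exists>d\<in>Q. d \<in> X"
    using countable_dense_exists by blast
  define w :: "nat \<Rightarrow> 'b" where "w n = (\<Sum>i\<in>Basis. (1 / Suc n) *\<^sub>R i)" for n
  have wi: "w n \<bullet> i = 1 / Suc n" if "i \<in> Basis" for n i using that by (simp add: w_def inner_sum_left_Basis)
  have ex: "\<exists>s. finite s \<and> cbox (q - w n) (q + w n) = convex hull s" for q n
  proof -
    obtain s where "finite s" "cbox (q - (\<Sum>i\<in>Basis. (1 / Suc n) *\<^sub>R i)) (q + (\<Sum>i\<in>Basis. (1 / Suc n) *\<^sub>R i)) = convex hull s"
      by (rule cube_convex_hull[of "1 / Suc n" q]) simp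
    then show ?thesis unfolding w_def by blast
  qed
  define s where "s q n = (SOME s. finite s \<and> cbox (q - w n) (q + w n) = convex hull s)" for q n
  have s: "finite (s q n)" "cbox (q - w n) (q + w n) = convex hull (s q n)" for q n
    using someI_ex[OF ex[of q n]] by (auto simp: s_def)
  define D where "D = (\<Union>q\<in>Q. \<Union>n. s q n)"
  have "simplex_dense D" unfolding simplex_dense_def
  proof (intro allI impI)
    fix x :: 'b and e :: real assume e: "0 < e"
    \<comment> \<open>The centre is within 1 / (n + 1) of \<open>x\<close>, and a corner is within
      DIM / (n + 1) of the centre by the l1 bound of the norm. Together this is below
      \<open>e\<close>.\<close>
    obtain n where "(real DIM('b) + 2) / e < real n" using reals_Archimedean2 by blast
    then have n: "(real DIM('b) + 1) / Suc n < e" using e by (simp add: field_simps)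
    obtain q where q: "q \<in> Q" "q \<in> ball x (1 / Suc n)" using Q(2)[of "ball x (1 / Suc n)"] by auto
    have "x \<in> box (q - w n) (q + w n)" unfolding mem_box
    proof
      fix i :: 'b assume i: "i \<in> Basis"
      have "\<bar>(x - q) \<bullet> i\<bar> < 1 / Suc n"
        using Basis_le_norm[OF i, of "x - q"] q(2) by (simp add: dist_norm)
      then show "(q - w n) \<bullet> i < x \<bullet> i \<and> x \<bullet> i < (q + w n) \<bullet> i"
        using i by (auto simp: inner_simps wi abs_less_iff)
    qed
    then have "x \<in> interior (convex hull (s q n))"
      using s(2)[of q n] interior_cbox[of "q - w n" "q + w n"] by simp
    moreover have "s q n \<subseteq> ball x e"
    proof
      fix y assume "y \<in> s q n"
      then have "y \<in> cbox (q - w n) (q + w n)" unfolding s(2) by (rule hull_inc)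
      then have "\<bar>(y - q) \<bullet> i\<bar> \<le> 1 / Suc n" if "i \<in> Basis" for i
        using that by (auto simp: mem_box inner_simps wi abs_le_iff algebra_simps)
      then have "norm (y - q) \<le> (\<Sum>i\<in>(Basis::'b set). 1 / Suc n)"
        using norm_le_l1[of "y - q"] sum_mono[of "Basis" "\<lambda>i. \<bar>(y - q) \<bullet> i\<bar>"  "\<lambda>i. 1 / Suc n"] by fastforce
      then have "dist q y \<le> real DIM('b) / Suc n" by (simp add: dist_norm norm_minus_commute)
      moreover have "dist x q < 1 / Suc n" using q(2) by simp
      ultimately have "dist x y < (real DIM('b) + 1) / Suc n"
        using dist_triangle[of x y q] by (simp add: add_divide_distrib)
      then show "y \<in> ball x e" using n by simp
    qed
    moreover have "s q n \<subseteq> D" using q by (auto simp: D_def)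
    ultimately show "\<exists>s. finite s \<and> s \<subseteq> D \<and> s \<subseteq> ball x e \<and> x \<in> interior (convex hull s)"
      using s(1)[of q n] by (intro exI[of _ "s q n"] conjI)
  qed
  moreover have "countable D" unfolding D_def using Q(1) by (intro countable_UN countable_finite[OF s(1)]) auto
  ultimately show ?thesis using that by blast
qed

lemma simplex_denseE:
  assumes D: "simplex_dense D" and e: "0 < e"
  obtains s where "finite s" "s \<subseteq> D" "s \<subseteq> ball x e" "x \<in> interior (convex hull s)"
proof -
  have "\<exists>s. finite s \<and> s \<subseteq> D \<and> s \<subseteq> ball x e \<and> x \<in> interior (convex hull s)"
    using D e unfolding simplex_dense_def by blast
  then show ?thesis by (elim exE conjE) (rule that)
qed

text \<open>The argument may move with \<open>k\<close>, which amounts to local uniformity. The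
  upper bound holds because a convex function on a simplex is at most its largest vertex value. The
  lower bound comes from the upper one by reflection in a nearby point of \<open>D\<close>.\<close>

lemma convex_pointwise_imp_continuous_convergence:
  fixes f :: "nat \<Rightarrow> 'b::euclidean_space \<Rightarrow> real"
  assumes D: "simplex_dense D" and conv: "\<And>k. convex_on UNIV (f k)" and Q: "continuous_on UNIV Q"
    and lim: "\<And>d. d \<in> D \<Longrightarrow> (\<lambda>k. f k d) \<longlonglongrightarrow> Q d" and x: "x \<longlonglongrightarrow> a"
  shows "(\<lambda>k. f k (x k)) \<longlonglongrightarrow> Q a"
proof -
  have near: "\<exists>d. 0 < d \<and> (\<forall>y. y \<in> ball a d \<longrightarrow> \<bar>Q y - Q a\<bar> < e)" if e: "e > 0" for e a
  proof -
    have "isCont Q a" using Q by (simp add: continuous_on_eq_continuous_at)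
    then obtain d where "d > 0" "\<forall>y. dist y a < d \<longrightarrow> dist (Q y) (Q a) < e"
      using e unfolding continuous_at_eps_delta by blast
    then show ?thesis by (intro exI[of _ d]) (auto simp: dist_real_def dist_commute)
  qed
  have upper: "\<forall>\<^sub>F k in sequentially. f k (x k) < Q a + e" if x: "x \<longlonglongrightarrow> a" and e: "e > 0" for x a e
  proof -
    from near[OF half_gt_zero[OF e], of a]
    obtain d where dd: "0 < d \<and> (\<forall>y. y \<in> ball a d \<longrightarrow> \<bar>Q y - Q a\<bar> < e / 2)" ..
    note d = conjunct1[OF dd] conjunct2[OF dd, rule_format]
    obtain s where s: "finite s" "s \<subseteq> D" "s \<subseteq> ball a d" "a \<in> interior (convex hull s)"
      by (rule simplex_denseE[OF D d(1)])
    have "\<forall>\<^sub>F k in sequentially. x k \<in> interior (convex hull s)"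
      using topological_tendstoD[OF x open_interior s(4)] .
    moreover have "\<forall>\<^sub>F k in sequentially. \<forall>v\<in>s. f k v \<le> Q a + e / 2"
    proof (rule eventually_ball_finite[OF s(1)], rule ballI)
      fix v assume v: "v \<in> s"
      have "v \<in> ball a d" using s(3) v by (rule subsetD)
      from d(2)[OF this] have "Q v < Q a + e / 2" by linarith
      then have "\<forall>\<^sub>F k in sequentially. f k v < Q a + e / 2"
        using order_tendstoD(2)[OF lim] s(2) v by blast
      then show "\<forall>\<^sub>F k in sequentially. f k v \<le> Q a + e / 2" by eventually_elim simp
    qed
    ultimately show ?thesis
    proof eventually_elim
      case (elim k)
      have "x k \<in> convex hull s" using elim(1) interior_subset by blast
      then have "f k (x k) \<le> Q a + e / 2"
        using convex_on_convex_hull_bound[of s "f k" "Q a + e / 2"] conv elim(2)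
          convex_on_subset[OF conv, of "convex hull s"] by blast
      then show ?case using e by simp
    qed
  qed
  have lower: "\<forall>\<^sub>F k in sequentially. Q a - e < f k (x k)" if e: "e > 0" for e
  proof -
    \<comment> \<open>The midpoint inequality is used as f(x) >= 2 f(y) - f(2 y - x). Two errors at
      \<open>y\<close>, counted twice, and two at its reflection add up to 6 e / 8. The radius
      \<open>d / 2\<close> below is due to the reflection doubling the distance from
      \<open>a\<close>.\<close>
    have "e / 8 > 0" using e by simp
    from near[OF this, of a]
    obtain d where dd: "0 < d \<and> (\<forall>y. y \<in> ball a d \<longrightarrow> \<bar>Q y - Q a\<bar> < e / 8)" ..
    note d = conjunct1[OF dd] conjunct2[OF dd, rule_format]
    obtain s where s: "finite s" "s \<subseteq> D" "s \<subseteq> ball a (d / 2)" "a \<in> interior (convex hull s)"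
      by (rule simplex_denseE[OF D half_gt_zero[OF d(1)]])
    then have "s \<noteq> {}" by auto
    then obtain y where "y \<in> s" by blast
    with s have y: "y \<in> D" "dist a y < d / 2" unfolding ball_def by blast+
    have y1: "\<bar>Q y - Q a\<bar> < e / 8" using y d by (intro d(2)) auto
    have "a - (2 *\<^sub>R y - a) = 2 *\<^sub>R (a - y)" by (simp add: scaleR_2)
    then have "dist a (2 *\<^sub>R y - a) = 2 * dist a y" by (simp add: dist_norm)
    then have y2: "\<bar>Q (2 *\<^sub>R y - a) - Q a\<bar> < e / 8" using y by (intro d(2)) auto
    have "(\<lambda>k. 2 *\<^sub>R y - x k) \<longlonglongrightarrow> 2 *\<^sub>R y - a" by (intro tendsto_intros x)
    from upper[OF this, of "e / 8"] e have "\<forall>\<^sub>F k in sequentially. f k (2 *\<^sub>R y - x k) < Q (2 *\<^sub>R y - a) + e / 8" by simp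
    moreover have "\<forall>\<^sub>F k in sequentially. Q y - e / 8 < f k y"
      using e by (intro order_tendstoD(1)[OF lim[OF y(1)]]) simp
    ultimately show ?thesis
    proof eventually_elim
      case (elim k)
      \<comment> \<open>\<open>y\<close> is the midpoint of \<open>x k\<close> and its reflection,
        and an upper bound at the reflection is already available.\<close>
      have "f k y = f k ((1 - 1/2) *\<^sub>R x k + (1/2) *\<^sub>R (2 *\<^sub>R y - x k))" by (simp add: algebra_simps)
      also have "\<dots> \<le> (1 - 1/2) * f k (x k) + (1/2) * f k (2 *\<^sub>R y - x k)"
        by (rule convex_onD[OF conv]) auto
      finally show ?case using elim y1 y2 unfolding abs_less_iff by simp
    qed
  qed
  show ?thesis
  proof (rule order_tendstoI)
    fix c assume "c < Q a"
    then show "\<forall>\<^sub>F k in sequentially. c < f k (x k)" using lower[of "Q a - c"] by simp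
  next
    fix c assume "Q a < c"
    then show "\<forall>\<^sub>F k in sequentially. f k (x k) < c" using upper[OF x, of "c - Q a"] by simp
  qed
qed

text \<open>If the bound failed infinitely often, compactness would give violating points converging
  along a subsequence, and continuous convergence there contradicts the gap of size 1.\<close>

lemma simplex_dense_convex_lower_bound:
  fixes f :: "nat \<Rightarrow> 'b::euclidean_space \<Rightarrow> real"
  assumes D: "simplex_dense D" and conv: "\<And>k. convex_on UNIV (f k)" and Q: "continuous_on UNIV Q"
    and lim: "\<And>d. d \<in> D \<Longrightarrow> (\<lambda>k. f k d) \<longlonglongrightarrow> Q d" and K: "compact K"
  shows "\<forall>\<^sub>F k in sequentially. \<forall>x\<in>K. Q x - 1 < f k x"
proof (rule ccontr)
  assume "\<not> ?thesis"
  then have "\<exists>\<^sub>F k in sequentially. \<exists>x\<in>K. f k x \<le> Q x - 1"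
    by (simp add: not_eventually not_less)
  then have "infinite {k. \<exists>x\<in>K. f k x \<le> Q x - 1}"
    unfolding cofinite_eq_sequentially[symmetric] by (simp add: INFM_iff_infinite)
  from infinite_enumerate[OF this] obtain r :: "nat \<Rightarrow> nat" where
    r: "strict_mono r" "\<forall>j. r j \<in> {k. \<exists>x\<in>K. f k x \<le> Q x - 1}" by blast
  have "\<forall>j. \<exists>x. x \<in> K \<and> f (r j) x \<le> Q x - 1" using r(2) by blast
  from choice[OF this] obtain x where x: "\<And>j. x j \<in> K" "\<And>j. f (r j) (x j) \<le> Q (x j) - 1" by blast
  obtain a s where s: "strict_mono s" "(x \<circ> s) \<longlonglongrightarrow> a"
    using K x(1) unfolding compact_def by metis
  have sub: "(\<lambda>k. f (r (s k)) d) \<longlonglongrightarrow> Q d" if "d \<in> D" for d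
    using LIMSEQ_subseq_LIMSEQ[OF lim[OF that] strict_mono_o[OF r(1) s(1)]] by (simp add: o_def)
  have "(\<lambda>k. f (r (s k)) (x (s k))) \<longlonglongrightarrow> Q a"
    using convex_pointwise_imp_continuous_convergence[OF D conv Q sub, of "x \<circ> s" a] s(2) by simp
  moreover have "(\<lambda>k. Q (x (s k)) - 1) \<longlonglongrightarrow> Q a - 1"
    using continuous_on_tendsto_compose[OF Q s(2)] by (auto intro!: tendsto_intros simp: o_def)
  ultimately have "Q a \<le> Q a - 1" by (rule LIMSEQ_le) (use x(2) in auto)
  then show False by simp
qed

text \<open>On the sphere of radius \<open>R\<close> the functions eventually exceed 2 - 1 = 1,
  while they vanish at the origin; convexity along rays then forces growth of slope at least 1 / R
  beyond the sphere.\<close>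

lemma convex_linear_growth:
  fixes f :: "nat \<Rightarrow> 'b::euclidean_space \<Rightarrow> real"
  assumes D: "simplex_dense D" and conv: "\<And>k. convex_on UNIV (f k)" and f0: "\<And>k. f k 0 = 0"
    and Q: "continuous_on UNIV Q" and lim: "\<And>d. d \<in> D \<Longrightarrow> (\<lambda>k. f k d) \<longlonglongrightarrow> Q d"
    and R: "0 < R" "\<And>x. norm x = R \<Longrightarrow> 2 \<le> Q x"
  obtains C where "\<forall>\<^sub>F k in sequentially. \<forall>x. norm x / R - C \<le> f k x"
proof -
  have "\<exists>m. \<forall>x\<in>cball 0 R. m \<le> Q x"
    using continuous_attains_inf[of "cball (0::'b) R" Q] R(1) continuous_on_subset[OF Q]
    by (metis cball_eq_empty compact_cball not_less_iff_gr_or_eq subset_UNIV)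
  then obtain m where "\<forall>x\<in>cball 0 R. m \<le> Q x" by blast
  then have m: "m \<le> Q x" if "norm x \<le> R" for x using that by simp
  have "\<forall>\<^sub>F k in sequentially. \<forall>x\<in>cball 0 R. Q x - 1 < f k x"
    by (rule simplex_dense_convex_lower_bound[OF D conv Q lim]) auto
  \<comment> \<open>Inside the ball \<open>norm x / R\<close> is at most 1 and \<open>f k x\<close>
    exceeds \<open>m - 1\<close>, which explains the constant \<open>2 - m\<close>; the maximum with
    0 serves the outside.\<close>
  then have "\<forall>\<^sub>F k in sequentially. \<forall>x. norm x / R - max 0 (2 - m) \<le> f k x"
  proof eventually_elim
    case (elim k)
    show ?case
    proof
      fix x show "norm x / R - max 0 (2 - m) \<le> f k x"
      proof (cases "norm x \<le> R")
        case True
        then have "norm x / R \<le> 1" using R(1) by simp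
        moreover have "Q x - 1 < f k x" using elim True by simp
        then have "m - 1 < f k x" using m[OF True] by simp
        ultimately show ?thesis by simp
      next
        case False
        define t where "t = R / norm x"
        have "0 < norm x" using False R(1) by linarith
        then have t: "0 < t" "t < 1" "norm (t *\<^sub>R x) = R" using False R(1) by (auto simp: t_def)
        have "Q (t *\<^sub>R x) - 1 < f k (t *\<^sub>R x)" using elim t(3) by simp
        then have "1 < f k (t *\<^sub>R x)" using R(2)[OF t(3)] by simp
        also have "t *\<^sub>R x = (1 - t) *\<^sub>R 0 + t *\<^sub>R x" by simp
        also have "f k \<dots> \<le> (1 - t) * f k 0 + t * f k x"
          by (rule convex_onD[OF conv]) (use t in auto)
        finally have "1 / t < f k x" using t(1) f0 by (simp add: field_simps)
        then show ?thesis by (simp add: t_def)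
      qed
    qed
  qed
  then show ?thesis using that by blast
qed

lemma integrable_exp_abs:
  assumes "0 < c"
  shows "integrable lborel (\<lambda>x::real. exp (- c * \<bar>x\<bar>))"
proof -
  have "(\<integral>\<^sup>+x. exponential_density c x \<partial>lborel) = 1"
    using prob_space.emeasure_space_1[OF prob_space_exponential_density[OF assms]]
    by (simp add: emeasure_density)
  then have i: "integrable lborel (exponential_density c)"
    using assms by (intro integrableI_nonneg) (auto simp: exponential_density_def)
  then have "integrable lborel (\<lambda>x. exponential_density c (0 + (-1) * x))"
    by (rule lborel_integrable_real_affine) simp
  with i have "integrable lborel (\<lambda>x. (exponential_density c x + exponential_density c (- x)) / c)"
    by simp
  then show ?thesis
    by (rule Bochner_Integration.integrable_bound) (use assms in \<open>auto simp: exponential_density_def\<close>)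
qed

text \<open>Half of the exponential decay absorbs the quadratic factor. The other half is dominated
  by a product of one-dimensional exponentials, because the coordinates sum to at most DIM times the
  norm; hence the rate \<open>c\<close>.\<close>

lemma integrable_exp_norm_quadratic:
  assumes a: "0 < a"
  shows "integrable lborel (\<lambda>x::'b::euclidean_space. exp (- a * norm x) * (1 + norm x)\<^sup>2)"
proof -
  define c where "c = a / (2 * DIM('b))"
  have c: "c > 0" using a by (simp add: c_def)
  have i: "integrable lborel (\<lambda>x::'b. \<Prod>b\<in>Basis. exp (- c * \<bar>x \<bullet> b\<bar>))"
    by (rule lborel_product_integral) (rule integrable_exp_abs[OF c])
  \<comment> \<open>From 1 + t <= max 1 (4 / a) (1 + a t / 4) <= max 1 (4 / a) exp (a t / 4),
    squared.\<close>
  define C where "C = (max 1 (4 / a))\<^sup>2"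
  have quad: "(1 + t)\<^sup>2 \<le> C * exp (a * t / 2)" if "t \<ge> 0" for t
  proof -
    have "1 + t \<le> max 1 (4 / a) * (1 + a * t / 4)"
    proof -
      have "1 + t = 1 * 1 + (4 / a) * (a * t / 4)" using a by simp
      also have "\<dots> \<le> max 1 (4 / a) * 1 + max 1 (4 / a) * (a * t / 4)"
        using a that by (intro add_mono mult_right_mono) auto
      finally show ?thesis by (simp add: algebra_simps)
    qed
    also have "\<dots> \<le> max 1 (4 / a) * exp (a * t / 4)"
      by (intro mult_left_mono exp_ge_add_one_self) auto
    finally have "(1 + t)\<^sup>2 \<le> (max 1 (4 / a) * exp (a * t / 4))\<^sup>2"
      using that by (intro power_mono) auto
    also have "\<dots> = C * exp (a * t / 2)"
      by (simp add: C_def power_mult_distrib flip: exp_double)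
    finally show ?thesis .
  qed
  have bound: "exp (- a * norm x) * (1 + norm x)\<^sup>2 \<le> C * (\<Prod>b\<in>Basis. exp (- c * \<bar>x \<bullet> b\<bar>))" for x :: 'b
  proof -
    have "(\<Sum>b\<in>Basis. c * \<bar>x \<bullet> b\<bar>) \<le> (\<Sum>b\<in>(Basis::'b set). c * norm x)"
      using c Basis_le_norm by (intro sum_mono mult_left_mono) auto
    also have "\<dots> = a * norm x / 2" by (simp add: c_def)
    finally have s: "(\<Sum>b\<in>Basis. c * \<bar>x \<bullet> b\<bar>) \<le> a * norm x / 2" .
    have "exp (- a * norm x) * (1 + norm x)\<^sup>2 \<le> exp (- a * norm x) * (C * exp (a * norm x / 2))"
      by (intro mult_left_mono quad) auto
    also have "\<dots> = C * exp (- (a * norm x / 2))" by (simp flip: exp_add)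
    also have "\<dots> \<le> C * exp (- (\<Sum>b\<in>Basis. c * \<bar>x \<bullet> b\<bar>))"
      using s by (intro mult_left_mono) (auto simp: C_def)
    finally show ?thesis by (simp add: exp_sum sum_negf[symmetric])
  qed
  show ?thesis
    by (rule Bochner_Integration.integrable_bound[OF integrable_mult_right[OF i, of C]])
       (use bound in \<open>auto simp: abs_mult C_def prod_nonneg\<close>)
qed

section \<open>Convergence of posteriors with convex exponents\<close>

definition second_moment :: "(real^'n \<Rightarrow> real) \<Rightarrow> bool" where
  "second_moment u \<longleftrightarrow> integrable lborel (\<lambda>x. (norm x)\<^sup>2 * u x)"

lemma second_moment_integrable:
  fixes u :: "real^'n \<Rightarrow> real" and f :: "real^'n \<Rightarrow> 'c::{banach, second_countable_topology}"
  assumes u: "unnorm_density u" "second_moment u" and [measurable]: "f \<in> borel_measurable borel"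
    and f: "\<And>x. norm (f x) \<le> 1 + (norm x)\<^sup>2"
  shows "integrable lborel (\<lambda>x. u x *\<^sub>R f x)" (is ?g1) "integrable (normalized u) f"
proof -
  note [measurable] = unnorm_densityD(3)[OF u(1)]
  have "integrable lborel (\<lambda>x. u x + (norm x)\<^sup>2 * u x)"
    using unnorm_densityD(2)[OF u(1)] u(2) unfolding second_moment_def by (rule Bochner_Integration.integrable_add)
  then show ?g1
  proof (rule Bochner_Integration.integrable_bound)
    have "norm (u x *\<^sub>R f x) \<le> norm (u x + (norm x)\<^sup>2 * u x)" for x
      using mult_left_mono[OF f[of x] unnorm_densityD(1)[OF u(1), of x]] unnorm_densityD(1)[OF u(1), of x]
      by (simp add: algebra_simps)
    then show "AE x in lborel. norm (u x *\<^sub>R f x) \<le> norm (u x + (norm x)\<^sup>2 * u x)" by simp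
  qed simp
  then show "integrable (normalized u) f" by (simp add: integrable_normalized_iff[OF u(1)])
qed

lemma norm_le_1_plus_sq: "t \<le> 1 + t\<^sup>2" for t :: real
  using sum_squares_ge_zero[of "t - 1/2" 0] by (simp add: power2_eq_square algebra_simps)

lemma vec_nth_mult_le: "\<bar>x $ i * x $ j\<bar> \<le> 1 + (norm (x::real^'n))\<^sup>2"
proof -
  have "\<bar>x $ i * x $ j\<bar> \<le> norm x * norm x"
    unfolding abs_mult by (intro mult_mono component_le_norm_cart) auto
  then show ?thesis by (simp add: power2_eq_square)
qed

lemma
  fixes u :: "real^'n \<Rightarrow> real"
  assumes u: "unnorm_density u" "second_moment u"
  shows integrable_normalized_id: "integrable (normalized u) (\<lambda>x. x)" (is ?g1)
    and integrable_normalized_nth: "integrable (normalized u) (\<lambda>x. x $ i)" (is ?g2)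
    and integrable_normalized_nth_mult: "integrable (normalized u) (\<lambda>x. x $ i * x $ j)" (is ?g3)
proof -
  show ?g1
    by (rule second_moment_integrable[OF u]) (use norm_le_1_plus_sq in auto)
  show ?g2
    by (rule second_moment_integrable[OF u])
       (use norm_le_1_plus_sq component_le_norm_cart order_trans in \<open>auto, blast\<close>)
  show ?g3
    by (rule second_moment_integrable[OF u]) (use vec_nth_mult_le in auto)
qed

lemma cov_mat_nth:
  fixes u :: "real^'n \<Rightarrow> real"
  assumes u: "unnorm_density u" "second_moment u"
  shows "cov_mat (normalized u) $ i $ j = (\<integral>x. x $ i * x $ j \<partial>normalized u) - mean_vec (normalized u) $ i * mean_vec (normalized u) $ j"
proof -
  interpret prob_space "normalized u" by (rule prob_space_normalized[OF u(1)])
  note i = integrable_normalized_id[OF u] integrable_normalized_nth[OF u] integrable_normalized_nth_mult[OF u]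
  define m where "m = mean_vec (normalized u)"
  have m: "(\<integral>x. x $ k \<partial>normalized u) = m $ k" for k
    unfolding m_def mean_vec_def by (rule integral_bounded_linear[OF bounded_linear_vec_nth i(1)])
  have "cov_mat (normalized u) $ i $ j = (\<integral>x. x $ i * x $ j - m $ j * x $ i - m $ i * x $ j + m $ i * m $ j \<partial>normalized u)"
    by (simp add: cov_mat_def m_def algebra_simps)
  also have "\<dots> = (\<integral>x. x $ i * x $ j \<partial>normalized u) - m $ i * m $ j"
    using i prob_space by (simp add: m)
  finally show ?thesis by (simp add: m_def)
qed

lemma
  fixes u :: "real^'n \<Rightarrow> real"
  assumes u: "unnorm_density u" "second_moment u" and c: "0 < c"
  shows mean_vec_affine: "mean_vec (normalized (\<lambda>x. u (a + x /\<^sub>R c))) = c *\<^sub>R (mean_vec (normalized u) - a)" (is ?g1)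
    and cov_mat_affine: "cov_mat (normalized (\<lambda>x. u (a + x /\<^sub>R c))) = c\<^sup>2 *\<^sub>R cov_mat (normalized u)" (is ?g2)
proof -
  interpret prob_space "normalized u" by (rule prob_space_normalized[OF u(1)])
  note eq = distr_normalized_affine[OF u(1) c, of a, symmetric]
  have "mean_vec (normalized (\<lambda>x. u (a + x /\<^sub>R c))) = (\<integral>x. c *\<^sub>R (x - a) \<partial>normalized u)"
    unfolding mean_vec_def eq by (subst integral_distr) auto
  also have "\<dots> = c *\<^sub>R (mean_vec (normalized u) - a)"
    using integrable_normalized_id[OF u] prob_space by (simp add: mean_vec_def)
  finally show m: ?g1 .
  show ?g2
  proof (simp add: vec_eq_iff, intro allI)
    fix i j
    have "cov_mat (normalized (\<lambda>x. u (a + x /\<^sub>R c))) $ i $ j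
      = (\<integral>x. c\<^sup>2 * ((x $ i - mean_vec (normalized u) $ i) * (x $ j - mean_vec (normalized u) $ j)) \<partial>normalized u)"
      unfolding cov_mat_def vec_lambda_beta m unfolding eq
      by (subst integral_distr) (auto simp: power2_eq_square algebra_simps)
    then show "cov_mat (normalized (\<lambda>x. u (a + x /\<^sub>R c))) $ i $ j = c\<^sup>2 * cov_mat (normalized u) $ i $ j"
      by (simp add: cov_mat_def)
  qed
qed

lemma second_moment_affine:
  fixes u :: "real^'n \<Rightarrow> real"
  assumes u: "unnorm_density u" "second_moment u" and c: "0 < c"
  shows "second_moment (\<lambda>x. u (a + x /\<^sub>R c))"
proof -
  note [measurable] = unnorm_densityD(3)[OF u(1)]
  define k where "k = c\<^sup>2 * (2 + 2 * (norm a)\<^sup>2)"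
  have k: "k > 0" unfolding k_def using c by (intro mult_pos_pos add_pos_nonneg) auto
  have "(norm (c *\<^sub>R (x - a)))\<^sup>2 \<le> k * (1 + (norm x)\<^sup>2)" for x
  proof -
    have "(norm (x - a))\<^sup>2 \<le> (norm x + norm a)\<^sup>2"
      by (intro power_mono norm_triangle_ineq4) simp
    also have "\<dots> \<le> 2 * (norm x)\<^sup>2 + 2 * (norm a)\<^sup>2"
      using sum_squares_ge_zero[of "norm x - norm a" 0] by (simp add: power2_eq_square algebra_simps)
    also have "\<dots> \<le> (2 + 2 * (norm a)\<^sup>2) * (1 + (norm x)\<^sup>2)"
      by (simp add: algebra_simps)
    finally have "c\<^sup>2 * (norm (x - a))\<^sup>2 \<le> c\<^sup>2 * ((2 + 2 * (norm a)\<^sup>2) * (1 + (norm x)\<^sup>2))"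
      by (rule mult_left_mono) simp
    moreover have "(norm (c *\<^sub>R (x - a)))\<^sup>2 = c\<^sup>2 * (norm (x - a))\<^sup>2"
      by (simp only: norm_scaleR power_mult_distrib power2_abs)
    ultimately show ?thesis by (simp only: mult.assoc k_def)
  qed
  then have "integrable lborel (\<lambda>x. u x *\<^sub>R ((norm (c *\<^sub>R (x - a)))\<^sup>2 / k))"
    using k by (intro second_moment_integrable[OF u]) (auto simp: pos_divide_le_eq mult.commute)
  then have "integrable lborel (\<lambda>x. k *\<^sub>R (u x *\<^sub>R ((norm (c *\<^sub>R (x - a)))\<^sup>2 / k)))"
    by (rule integrable_scaleR_right)
  then have "integrable lborel (\<lambda>x. (norm (c *\<^sub>R (x - a)))\<^sup>2 * u x)"
    using k by (simp add: mult.commute)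
  then have "integrable lborel (\<lambda>x. (norm (c *\<^sub>R ((a + x /\<^sub>R c) - a)))\<^sup>2 * u (a + x /\<^sub>R c))"
    by (subst lborel_scale(2)[OF c]) simp_all
  then show ?thesis using c by (simp add: second_moment_def)
qed

text \<open>The set where \<open>u\<close> is nonzero is open and null, hence empty.\<close>

lemma AE_eq_0_continuous:
  fixes u :: "'b::euclidean_space \<Rightarrow> real"
  assumes cont: "continuous_on UNIV u" and ae: "AE x in lborel. u x = 0"
  shows "u x = 0"
proof -
  have op: "open {x. u x \<noteq> 0}" by (intro open_Collect_neq continuous_intros cont)
  with ae have "{x. u x \<noteq> 0} \<in> null_sets lborel"
    by (subst AE_iff_null_sets) (auto intro: borel_open)
  then have "{x. u x \<noteq> 0} = {}"
    using op open_not_negligible negligible_iff_null_sets null_sets_completionI by blast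
  then show ?thesis by auto
qed

text \<open>The form at \<open>x\<close> is the variance of the projection on \<open>x\<close>. Were
  it zero, the density would vanish off a hyperplane, which a continuous density of positive mass
  cannot do. Thus the inverse that defines \<open>V_post\<close> is a genuine one.\<close>

lemma pos_def_cov_mat:
  fixes u :: "real^'n \<Rightarrow> real"
  assumes u: "unnorm_density u" "second_moment u" and cont: "continuous_on UNIV u"
  shows "pos_def (cov_mat (normalized u))"
  unfolding pos_def_def
proof (intro conjI allI impI)
  note [measurable] = unnorm_densityD(3)[OF u(1)]
  interpret prob_space "normalized u" by (rule prob_space_normalized[OF u(1)])
  show "transpose (cov_mat (normalized u)) = cov_mat (normalized u)"
    by (simp add: cov_mat_def transpose_def vec_eq_iff mult.commute)
  fix x :: "real^'n" assume x: "x \<noteq> 0"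
  define m where "m = mean_vec (normalized u)"
  have int: "integrable (normalized u) (\<lambda>y. (y $ i - m $ i) * (y $ j - m $ j))" for i j
  proof -
    have "integrable (normalized u) (\<lambda>y. y $ i * y $ j - m $ j * y $ i - m $ i * y $ j + m $ i * m $ j)"
      using integrable_normalized_nth[OF u] integrable_normalized_nth_mult[OF u] by auto
    then show ?thesis by (simp add: algebra_simps)
  qed
  have sq: "(x \<bullet> (y - m))\<^sup>2 = (\<Sum>i\<in>UNIV. \<Sum>j\<in>UNIV. x $ i * x $ j * ((y $ i - m $ i) * (y $ j - m $ j)))" for y
    by (simp add: inner_vec_def power2_eq_square sum_product mult_ac)
  have int_sq: "integrable (normalized u) (\<lambda>y. (x \<bullet> (y - m))\<^sup>2)"
    unfolding sq using int by (intro Bochner_Integration.integrable_sum integrable_mult_right) auto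
  have "x \<bullet> (cov_mat (normalized u) *v x) = (\<Sum>i\<in>UNIV. \<Sum>j\<in>UNIV. x $ i * x $ j * (\<integral>y. (y $ i - m $ i) * (y $ j - m $ j) \<partial>normalized u))"
    by (simp add: inner_vec_def matrix_vector_mult_def cov_mat_def m_def sum_distrib_left mult_ac)
  also have "\<dots> = (\<integral>y. (x \<bullet> (y - m))\<^sup>2 \<partial>normalized u)"
    unfolding sq using int by simp
  finally have eq: "x \<bullet> (cov_mat (normalized u) *v x) = (\<integral>y. (x \<bullet> (y - m))\<^sup>2 \<partial>normalized u)" .
  show "0 < x \<bullet> (cov_mat (normalized u) *v x)"
  proof (rule ccontr)
    assume "\<not> ?thesis"
    then have "(\<integral>y. (x \<bullet> (y - m))\<^sup>2 \<partial>normalized u) = 0"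
      unfolding eq by (simp add: not_less order_antisym)
    then have "(\<integral>y. u y * (x \<bullet> (y - m))\<^sup>2 \<partial>lborel) = 0"
      using unnorm_densityD(4)[OF u(1)] by (subst (asm) integral_normalized[OF u(1)]) auto
    moreover have "integrable lborel (\<lambda>y. u y * (x \<bullet> (y - m))\<^sup>2)"
      using int_sq by (subst (asm) integrable_normalized_iff[OF u(1)]) auto
    ultimately have ae: "AE y in lborel. u y * (x \<bullet> (y - m))\<^sup>2 = 0"
      using unnorm_densityD(1)[OF u(1)] by (subst (asm) integral_nonneg_eq_0_iff_AE) auto
    have "u y * (x \<bullet> (y - m))\<^sup>2 = 0" for y
      by (rule AE_eq_0_continuous[OF _ ae]) (intro continuous_intros cont)
    then have z: "u y = 0 \<or> x \<bullet> (y - m) = 0" for y by simp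
    have "\<exists>y. u y \<noteq> 0"
    proof (rule ccontr)
      assume "\<not> ?thesis"
      then have "u = (\<lambda>_. 0)" by auto
      then show False using unnorm_densityD(4)[OF u(1)] by simp
    qed
    then obtain y where y: "u y \<noteq> 0" by blast
    \<comment> \<open>A small step from \<open>y\<close> in the direction \<open>x\<close> leaves
      the hyperplane, while continuity keeps the density nonzero.\<close>
    have "((\<lambda>t. u (y + t *\<^sub>R x)) \<longlongrightarrow> u (y + 0 *\<^sub>R x)) (at_right 0)"
      by (rule continuous_on_tendsto_compose[OF cont]) (intro tendsto_intros, auto)
    then have "\<forall>\<^sub>F t in at_right (0::real). u (y + t *\<^sub>R x) \<noteq> 0"
      using y by (intro tendsto_imp_eventually_ne) auto
    then have "\<forall>\<^sub>F t in at_right (0::real). u (y + t *\<^sub>R x) \<noteq> 0 \<and> 0 < t"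
      by (rule eventually_conj) (simp add: eventually_at_right_less)
    then obtain t where t: "u (y + t *\<^sub>R x) \<noteq> 0" "0 < t"
      using eventually_happens'[of "at_right (0::real)"] trivial_limit_at_right_real by blast
    have "x \<bullet> (y + t *\<^sub>R x - m) = 0" "x \<bullet> (y - m) = 0" using z t(1) y by blast+
    then have "t * (x \<bullet> x) = 0" by (simp add: inner_simps)
    then show False using x t by simp
  qed
qed

text \<open>The limit theorem behind both posteriors: \<open>f\<close> is the exponent, normalised
  at the origin, and \<open>g\<close> the prior at the rescaled argument, which flattens to the
  constant \<open>c\<close>. Only limits on \<open>D\<close> are assumed; convexity supplies the
  limits elsewhere and the domination needed for moments up to order two.\<close>

lemma gauss_limit:
  fixes f g :: "nat \<Rightarrow> real^'n \<Rightarrow> real" and A :: "real^'n^'n"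
  defines "u \<equiv> \<lambda>k x. exp (- f k x) * g k x"
  assumes D: "simplex_dense D" and conv: "\<And>k. convex_on UNIV (f k)" and f0: "\<And>k. f k 0 = 0"
    and A: "pos_def A"
    and lim: "\<And>d. d \<in> D \<Longrightarrow> (\<lambda>k. f k d) \<longlonglongrightarrow> (d - \<mu>) \<bullet> (matrix_inv A *v (d - \<mu>)) / 2 - \<mu> \<bullet> (matrix_inv A *v \<mu>) / 2"
    and g: "\<And>k x. 0 \<le> g k x" "\<And>k x. g k x \<le> K" "\<And>x. (\<lambda>k. g k x) \<longlonglongrightarrow> c" "0 < c"
    and u: "\<And>k. unnorm_density (u k)" "\<And>k. second_moment (u k)"
  shows "(\<lambda>k. mean_vec (normalized (u k))) \<longlonglongrightarrow> \<mu>" (is ?g1)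
    and "(\<lambda>k. cov_mat (normalized (u k))) \<longlonglongrightarrow> A" (is ?g2)
    and "(\<lambda>k. tv_dist (normalized (u k)) (mvnormal \<mu> A)) \<longlonglongrightarrow> 0" (is ?g3)
proof -
  let ?P = "matrix_inv A"
  define q where "q x = (x - \<mu>) \<bullet> (?P *v (x - \<mu>)) / 2" for x
  define Q where "Q x = q x - q 0" for x
  have Q: "Q x = (x - \<mu>) \<bullet> (?P *v (x - \<mu>)) / 2 - \<mu> \<bullet> (?P *v \<mu>) / 2" for x
    using matrix_vector_mult_scaleR[of ?P "-1" \<mu>] by (simp add: Q_def q_def)
  have Qcont: "continuous_on UNIV Q"
    unfolding Q_def q_def by (intro continuous_intros matrix_vector_mult_linear_continuous_on continuous_on_compose2[OF matrix_vector_mult_linear_continuous_on]) auto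
  have limQ: "\<And>d. d \<in> D \<Longrightarrow> (\<lambda>k. f k d) \<longlonglongrightarrow> Q d" using lim by (simp add: Q)
  have flim: "(\<lambda>k. f k x) \<longlonglongrightarrow> Q x" for x
    by (rule convex_pointwise_imp_continuous_convergence[OF D conv Qcont limQ tendsto_const])
  obtain l where l: "0 < l" "\<And>x. l * (norm x)\<^sup>2 \<le> x \<bullet> (?P *v x)"
    using pos_def_coercive[OF pos_def_matrix_inv[OF A]] by blast
  \<comment> \<open>With r = R - norm mu, a point of norm \<open>R\<close> is at distance at least r
    from mu, and coercivity gives 2 q >= l r = l + 2 (2 + q 0), so Q = q - q 0 > 2. The summand 1
    ensures r <= r^2.\<close>
  define R where "R = 1 + norm \<mu> + (2 * (2 + q 0)) / l"
  have q0: "0 \<le> q 0"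
  proof -
    have "0 \<le> l * (norm (0 - \<mu>))\<^sup>2" using l(1) by simp
    also have "\<dots> \<le> (0 - \<mu>) \<bullet> (?P *v (0 - \<mu>))" by (rule l(2))
    finally show ?thesis unfolding q_def by linarith
  qed
  have R: "0 < R" unfolding R_def using l(1) q0 by (intro add_pos_nonneg) auto
  have growth: "2 \<le> Q x" if "norm x = R" for x
  proof -
    define r where "r = 1 + (2 * (2 + q 0)) / l"
    have r: "1 \<le> r" using l(1) q0 by (simp add: r_def)
    have "r \<le> norm (x - \<mu>)" using norm_triangle_ineq2[of x \<mu>] that by (simp add: R_def r_def)
    then have "r\<^sup>2 \<le> (norm (x - \<mu>))\<^sup>2" using r by (intro power_mono) auto
    moreover have "r \<le> r\<^sup>2" using r by (simp add: power2_eq_square)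
    ultimately have "l * r \<le> l * (norm (x - \<mu>))\<^sup>2" using l(1) by (intro mult_left_mono) auto
    also have "\<dots> \<le> 2 * q x" unfolding q_def using l(2)[of "x - \<mu>"] by simp
    finally have "l * r \<le> 2 * q x" .
    moreover have "l * r = l + 2 * (2 + q 0)" using l(1) by (simp add: r_def field_simps)
    ultimately show ?thesis using l(1) by (simp add: Q_def)
  qed
  obtain C where C: "\<forall>\<^sub>F k in sequentially. \<forall>x. norm x / R - C \<le> f k x"
    using convex_linear_growth[OF D conv f0 Qcont limQ R growth] by blast
  then obtain k0 where k0: "\<And>k x. k0 \<le> k \<Longrightarrow> norm x / R - C \<le> f k x"
    by (auto simp: eventually_sequentially)
  define v where "v x = c * exp (- Q x)" for x
  have v_eq: "v x = (c * exp (q 0)) * gauss_kernel \<mu> ?P x" for x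
    by (simp add: v_def gauss_kernel_def Q_def q_def flip: exp_add)
  have ce: "0 < c * exp (q 0)" using g(4) by simp
  have v: "unnorm_density v" "normalized v = mvnormal \<mu> A"
    unfolding v_eq[abs_def] using unnorm_density_scale[OF unnorm_density_gauss_kernel[OF A] ce, of \<mu>]
    by (simp_all add: normalized_scale[OF ce] mvnormal_eq_normalized[OF A])
  have ulim: "(\<lambda>k. u k x) \<longlonglongrightarrow> v x" for x
    unfolding u_def v_def using tendsto_mult[OF tendsto_exp[OF tendsto_minus[OF flim[of x]]] g(3)[of x]] by (simp add: mult.commute)
  have K: "0 \<le> K" using g(1,2) order_trans by blast
  have ubound: "u k x \<le> K * exp C * exp (- (1 / R) * norm x)" if "k0 \<le> k" for k x
  proof -
    have "u k x \<le> exp (- (norm x / R - C)) * K"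
      unfolding u_def using k0[OF that, of x] g K by (intro mult_mono) auto
    then show ?thesis by (simp add: exp_diff exp_minus field_simps)
  qed
  note umeas [measurable] = unnorm_densityD(3)[OF u(1)] unnorm_densityD(3)[OF v(1)]
  let ?b = "\<lambda>x::real^'n. K * exp C * (exp (- (1 / R) * norm x) * (1 + norm x)\<^sup>2)"
  have dom: "(\<lambda>k. \<integral>x. u k x *\<^sub>R \<phi> x \<partial>lborel) \<longlonglongrightarrow> (\<integral>x. v x *\<^sub>R \<phi> x \<partial>lborel)"
    if [measurable]: "\<phi> \<in> borel_measurable borel" and \<phi>: "\<And>x. norm (\<phi> x) \<le> 1 + (norm x)\<^sup>2"
    for \<phi> :: "real^'n \<Rightarrow> 'c::{banach, second_countable_topology}"
  \<comment> \<open>The exponential bound holds only from \<open>k0\<close> on, so the sequence is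
    shifted before domination applies.\<close>
  proof (rule LIMSEQ_offset[where k = k0], rule integral_dominated_convergence)
    show "integrable lborel (?b)"
      by (rule integrable_mult_right, rule integrable_exp_norm_quadratic) (use R in simp)
    show "AE x in lborel. (\<lambda>k. u (k + k0) x *\<^sub>R \<phi> x) \<longlonglongrightarrow> v x *\<^sub>R \<phi> x"
      using LIMSEQ_ignore_initial_segment[OF ulim] by (auto intro!: tendsto_intros)
    fix k
    have "norm (u (k + k0) x *\<^sub>R \<phi> x) \<le> ?b x" for x
    proof -
      have "1 + (norm x)\<^sup>2 \<le> (1 + norm x)\<^sup>2" by (simp add: power2_sum)
      then have "norm (\<phi> x) \<le> (1 + norm x)\<^sup>2" using \<phi>[of x] by simp
      then have "u (k + k0) x * norm (\<phi> x) \<le> (K * exp C * exp (- (1 / R) * norm x)) * (1 + norm x)\<^sup>2"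
        using ubound[of "k + k0" x] unnorm_densityD(1)[OF u(1)] K by (intro mult_mono) auto
      then show ?thesis using unnorm_densityD(1)[OF u(1)] by (simp add: mult.assoc)
    qed
    then show "AE x in lborel. norm (u (k + k0) x *\<^sub>R \<phi> x) \<le> ?b x"
      by simp
  qed simp_all
  have Z: "(\<lambda>k. mass (u k)) \<longlonglongrightarrow> mass v"
    using dom[of "\<lambda>_. 1::real"] by simp
  have mom: "(\<lambda>k. \<integral>x. \<phi> x \<partial>normalized (u k)) \<longlonglongrightarrow> (\<integral>x. \<phi> x \<partial>mvnormal \<mu> A)"
    if [measurable]: "\<phi> \<in> borel_measurable borel" and \<phi>: "\<And>x. norm (\<phi> x) \<le> 1 + (norm x)\<^sup>2"
    for \<phi> :: "real^'n \<Rightarrow> 'c::{banach, second_countable_topology}"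
    unfolding v(2)[symmetric] integral_normalized[OF u(1) that(1)] integral_normalized[OF v(1) that(1)]
    using unnorm_densityD(4)[OF v(1)] by (intro tendsto_intros dom that Z) auto
  show mean: ?g1
    using mom[of "\<lambda>x. x"] norm_le_1_plus_sq mean_vec_mvnormal[OF A, of \<mu>] unfolding mean_vec_def by simp
  \<comment> \<open>The limit inherits the exponential bound pointwise. Its second moment is needed
    to identify the limit of the covariance formula as \<open>A\<close>.\<close>
  have vm: "second_moment v"
  proof -
    have "integrable lborel (?b)"
      by (rule integrable_mult_right, rule integrable_exp_norm_quadratic) (use R in simp)
    then show ?thesis unfolding second_moment_def
    proof (rule Bochner_Integration.integrable_bound)
      have "norm ((norm x)\<^sup>2 * v x) \<le> norm (?b x)" for x
      proof -
        have "v x \<le> K * exp C * exp (- (1 / R) * norm x)"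
          by (rule tendsto_upperbound[OF ulim]) (use ubound in \<open>auto simp: eventually_sequentially intro!: exI[of _ k0]\<close>)
        then have "v x * (norm x)\<^sup>2 \<le> (K * exp C * exp (- (1 / R) * norm x)) * (1 + norm x)\<^sup>2"
          using unnorm_densityD(1)[OF v(1)] K by (intro mult_mono power_mono) auto
        then show ?thesis using unnorm_densityD(1)[OF v(1)] K by (simp add: mult_ac abs_mult)
      qed
      then show "AE x in lborel. norm ((norm x)\<^sup>2 * v x) \<le> norm (?b x)" by simp
    qed simp
  qed
  show ?g2
  proof (rule tendsto_matrixI)
    fix i j
    have "(\<lambda>k. (\<integral>x. x $ i * x $ j \<partial>normalized (u k)) - mean_vec (normalized (u k)) $ i * mean_vec (normalized (u k)) $ j)
      \<longlonglongrightarrow> (\<integral>x. x $ i * x $ j \<partial>mvnormal \<mu> A) - \<mu> $ i * \<mu> $ j"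
      using vec_nth_mult_le by (intro tendsto_intros mom mean) auto
    moreover have "(\<integral>x. x $ i * x $ j \<partial>mvnormal \<mu> A) - \<mu> $ i * \<mu> $ j = A $ i $ j"
      using cov_mat_nth[OF v(1) vm, of i j] by (simp add: v(2) mean_vec_mvnormal[OF A] cov_mat_mvnormal[OF A])
    ultimately show "(\<lambda>k. cov_mat (normalized (u k)) $ i $ j) \<longlonglongrightarrow> A $ i $ j"
      by (simp add: cov_mat_nth[OF u])
  qed
  show ?g3
    unfolding v(2)[symmetric] tv_dist_normalized[OF u(1) v(1)]
    using tendsto_divide[OF integral_abs_diff_normalized_tendsto_0[OF u(1) v(1) ulim Z] tendsto_const[of 2]] by simp
qed

section \<open>The check loss and convergence in probability\<close>

text \<open>The value of the integral over s from 0 to v of 1(u <= s) - 1(u <= 0), the form in which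
  the remainder of Knight's identity is usually written.\<close>

definition loss_remainder :: "real \<Rightarrow> real \<Rightarrow> real" where
  "loss_remainder u v = (if 0 < u \<and> u \<le> v then v - u else if v < u \<and> u \<le> 0 then u - v else 0)"

text \<open>Knight's identity; the remainder does not depend on \<open>\<tau>\<close>.\<close>

lemma check_loss_diff:
  "check_loss \<tau> (u - v) - check_loss \<tau> u = - v * (\<tau> - indicator {..0} u) + loss_remainder u v"
  by (auto simp: check_loss_def loss_remainder_def indicator_def algebra_simps)

lemma loss_remainder_bounds: "0 \<le> loss_remainder u v" "loss_remainder u v \<le> \<bar>v\<bar>"
  by (auto simp: loss_remainder_def)

lemma loss_remainder_eq_0: "\<bar>v\<bar> < \<bar>u\<bar> \<Longrightarrow> loss_remainder u v = 0"
  by (auto simp: loss_remainder_def)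

lemma borel_measurable_loss_remainder [measurable (raw)]:
  assumes [measurable]: "f \<in> borel_measurable M" "g \<in> borel_measurable M"
  shows "(\<lambda>x. loss_remainder (f x) (g x)) \<in> borel_measurable M"
  unfolding loss_remainder_def by measurable

lemma borel_measurable_check_loss [measurable (raw)]:
  assumes [measurable]: "f \<in> borel_measurable M"
  shows "(\<lambda>x. check_loss \<tau> (f x)) \<in> borel_measurable M"
  unfolding check_loss_def by measurable

text \<open>The graph bounds a right triangle with both legs \<open>\<bar>v\<bar>\<close>. This area
  is the source of the factor 1/2 and of the quadratic form in the limiting exponent.\<close>

lemma has_bochner_integral_loss_remainder:
  "has_bochner_integral lborel (\<lambda>t. loss_remainder t v) (v\<^sup>2 / 2)"
proof (cases "0 \<le> v")
  case True
  have "has_bochner_integral lborel (\<lambda>t. indicator {0..v} t *\<^sub>R (v - t)) ((v * v - v\<^sup>2 / 2) - (v * 0 - 0\<^sup>2 / 2))"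
    using True
    by (intro has_bochner_integral_FTC_Icc[where F = "\<lambda>t. v * t - t\<^sup>2 / 2"])
       (auto intro!: derivative_eq_intros continuous_intros simp: has_real_derivative_iff_has_vector_derivative[symmetric])
  then have "has_bochner_integral lborel (\<lambda>t. indicator {0..v} t *\<^sub>R (v - t)) (v\<^sup>2 / 2)"
    by (simp add: power2_eq_square field_simps)
  \<comment> \<open>The two functions differ at t = 0, where the remainder vanishes because its
    condition \<open>0 < u\<close> is strict.\<close>
  moreover have "AE t in lborel. indicator {0..v} t *\<^sub>R (v - t) = loss_remainder t v"
    using AE_lborel_singleton[of 0] by eventually_elim (use True in \<open>auto simp: loss_remainder_def indicator_def\<close>)
  ultimately show ?thesis
    by (subst (asm) has_bochner_integral_cong_AE) auto
next
  case False
  have "has_bochner_integral lborel (\<lambda>t. indicator {v..0} t *\<^sub>R (t - v)) ((0\<^sup>2 / 2 - v * 0) - (v\<^sup>2 / 2 - v * v))"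
    using False
    by (intro has_bochner_integral_FTC_Icc[where F = "\<lambda>t. t\<^sup>2 / 2 - v * t"])
       (auto intro!: derivative_eq_intros continuous_intros simp: has_real_derivative_iff_has_vector_derivative[symmetric])
  then have "has_bochner_integral lborel (\<lambda>t. indicator {v..0} t *\<^sub>R (t - v)) (v\<^sup>2 / 2)"
    by (simp add: power2_eq_square field_simps)
  moreover have "indicator {v..0} t *\<^sub>R (t - v) = loss_remainder t v" for t
    using False by (auto simp: loss_remainder_def indicator_def)
  ultimately show ?thesis by simp
qed

text \<open>The indicator hides that the loss is a maximum of two linear functions, the form from
  which continuity and convexity follow.\<close>

lemma check_loss_eq_max: "check_loss \<tau> u = max (\<tau> * u) ((\<tau> - 1) * u)"
  by (auto simp: check_loss_def indicator_def max_def algebra_simps)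

lemma check_loss_nonneg: "0 < \<tau> \<Longrightarrow> \<tau> < 1 \<Longrightarrow> 0 \<le> check_loss \<tau> u"
  by (auto simp: check_loss_def indicator_def mult_nonpos_nonpos)

lemma continuous_on_check_loss: "continuous_on A f \<Longrightarrow> continuous_on A (\<lambda>x. check_loss \<tau> (f x))"
  unfolding check_loss_eq_max by (intro continuous_intros)

lemma convex_on_check_loss: "convex_on UNIV (\<lambda>x::'b::real_inner. check_loss \<tau> (z - a \<bullet> x))"
proof (rule convex_onI)
  fix t :: real and x y :: 'b assume t: "0 < t" "t < 1"
  define p q where "p = z - a \<bullet> x" and "q = z - a \<bullet> y"
  let ?R = "(1 - t) * max (\<tau> * p) ((\<tau> - 1) * p) + t * max (\<tau> * q) ((\<tau> - 1) * q)"
  have "z - a \<bullet> ((1 - t) *\<^sub>R x + t *\<^sub>R y) = (1 - t) * p + t * q"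
    by (simp add: p_def q_def inner_simps algebra_simps)
  moreover have "max (\<tau> * ((1 - t) * p + t * q)) ((\<tau> - 1) * ((1 - t) * p + t * q))
     \<le> ?R"
  proof (rule max.boundedI)
    have "(1 - t) * (\<tau> * p) + t * (\<tau> * q) \<le> ?R"
      using t by (intro add_mono mult_left_mono) auto
    then show "\<tau> * ((1 - t) * p + t * q) \<le> ?R"
      by (simp add: algebra_simps)
    have "(1 - t) * ((\<tau> - 1) * p) + t * ((\<tau> - 1) * q) \<le> ?R"
      using t by (intro add_mono mult_left_mono) auto
    then show "(\<tau> - 1) * ((1 - t) * p + t * q) \<le> ?R"
      by (simp add: algebra_simps)
  qed
  ultimately show "check_loss \<tau> (z - a \<bullet> ((1 - t) *\<^sub>R x + t *\<^sub>R y)) \<le> (1 - t) * check_loss \<tau> (z - a \<bullet> x) + t * check_loss \<tau> (z - a \<bullet> y)"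
    by (simp add: check_loss_eq_max p_def q_def)
qed simp

text \<open>Cross terms factor by independence and vanish because the variables are centred.\<close>

lemma (in prob_space) indep_vars_sum_sq:
  fixes g :: "'i \<Rightarrow> 'a \<Rightarrow> real"
  assumes I: "finite I" "indep_vars (\<lambda>_. borel) g I"
    and g: "\<And>i. i \<in> I \<Longrightarrow> integrable M (g i)" "\<And>i. i \<in> I \<Longrightarrow> integrable M (\<lambda>\<omega>. (g i \<omega>)\<^sup>2)"
    and zero: "\<And>i. i \<in> I \<Longrightarrow> expectation (g i) = 0"
  shows "integrable M (\<lambda>\<omega>. (\<Sum>i\<in>I. g i \<omega>)\<^sup>2)" (is ?g1) "expectation (\<lambda>\<omega>. (\<Sum>i\<in>I. g i \<omega>)\<^sup>2) = (\<Sum>i\<in>I. expectation (\<lambda>\<omega>. (g i \<omega>)\<^sup>2))" (is ?g2)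
proof -
  have cross: "integrable M (\<lambda>\<omega>. g i \<omega> * g j \<omega>)"
     "expectation (\<lambda>\<omega>. g i \<omega> * g j \<omega>) = (if i = j then expectation (\<lambda>\<omega>. (g i \<omega>)\<^sup>2) else 0)"
    if ij: "i \<in> I" "j \<in> I" for i j
  proof -
    have "integrable M (\<lambda>\<omega>. g i \<omega> * g j \<omega>) \<and>
     expectation (\<lambda>\<omega>. g i \<omega> * g j \<omega>) = (if i = j then expectation (\<lambda>\<omega>. (g i \<omega>)\<^sup>2) else 0)"
    proof (cases "i = j")
      case True
      then show ?thesis using g(2)[OF ij(1)] by (simp add: power2_eq_square)
    next
      case False
      have ind: "indep_vars (\<lambda>_. borel) g {i, j}" using I(2) by (rule indep_vars_subset) (use ij in auto)
      have "integrable M (\<lambda>\<omega>. \<Prod>k\<in>{i, j}. g k \<omega>)" "expectation (\<lambda>\<omega>. \<Prod>k\<in>{i, j}. g k \<omega>) = (\<Prod>k\<in>{i, j}. expectation (g k))"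
        using ij g(1) by (auto intro!: indep_vars_integrable[OF _ ind] indep_vars_lebesgue_integral[OF _ ind])
      then show ?thesis using False zero ij by simp
    qed
    then show "integrable M (\<lambda>\<omega>. g i \<omega> * g j \<omega>)"
      "expectation (\<lambda>\<omega>. g i \<omega> * g j \<omega>) = (if i = j then expectation (\<lambda>\<omega>. (g i \<omega>)\<^sup>2) else 0)" by blast+
  qed
  have sq: "(\<Sum>i\<in>I. g i \<omega>)\<^sup>2 = (\<Sum>i\<in>I. \<Sum>j\<in>I. g i \<omega> * g j \<omega>)" for \<omega>
    by (simp add: power2_eq_square sum_product)
  show ?g1 unfolding sq using cross by auto
  have "expectation (\<lambda>\<omega>. (\<Sum>i\<in>I. g i \<omega>)\<^sup>2) = (\<Sum>i\<in>I. \<Sum>j\<in>I. expectation (\<lambda>\<omega>. g i \<omega> * g j \<omega>))"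
    unfolding sq using cross by (subst Bochner_Integration.integral_sum | auto)+
  also have "\<dots> = (\<Sum>i\<in>I. expectation (\<lambda>\<omega>. (g i \<omega>)\<^sup>2))"
    using I(1) cross(2) by (intro sum.cong) (auto simp: sum.delta)
  finally show ?g2 .
qed

text \<open>Chebyshev's inequality for the centred sum, with each variance enlarged to a raw second
  moment. The raw moments are what the later applications bound directly.\<close>

lemma (in prob_space) indep_sum_deviation:
  fixes g :: "'i \<Rightarrow> 'a \<Rightarrow> real"
  assumes I: "finite I" "indep_vars (\<lambda>_. borel) g I"
    and bound: "\<And>i \<omega>. i \<in> I \<Longrightarrow> \<bar>g i \<omega>\<bar> \<le> B i" and "0 < e"
  shows "prob {\<omega> \<in> space M. e \<le> \<bar>(\<Sum>i\<in>I. g i \<omega>) - (\<Sum>i\<in>I. expectation (g i))\<bar>} \<le> (\<Sum>i\<in>I. expectation (\<lambda>\<omega>. (g i \<omega>)\<^sup>2)) / e\<^sup>2"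
proof -
  have rv: "i \<in> I \<Longrightarrow> random_variable borel (g i)" for i using I(2) by (auto simp: indep_vars_def)
  have gi: "integrable M (g i)" if "i \<in> I" for i
    using rv[OF that] bound[OF that] by (intro integrable_const_bound[where B="B i"]) auto
  have gi2: "integrable M (\<lambda>\<omega>. (g i \<omega>)\<^sup>2)" if i: "i \<in> I" for i
  proof (rule integrable_const_bound[where B="(B i)\<^sup>2"])
    show "AE \<omega> in M. norm ((g i \<omega>)\<^sup>2) \<le> (B i)\<^sup>2"
      using bound[OF i] by (auto intro!: abs_le_square_iff[THEN iffD1] AE_I2 simp: abs_of_nonneg order_trans[OF abs_ge_zero bound[OF i]])
  qed (use rv[OF i] in measurable)
  define h where "h i \<omega> = g i \<omega> - expectation (g i)" for i \<omega>
  have ind: "indep_vars (\<lambda>_. borel) h I"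
    unfolding h_def[abs_def] by (rule indep_vars_compose2[OF I(2)]) measurable
  have h: "integrable M (h i)" "integrable M (\<lambda>\<omega>. (h i \<omega>)\<^sup>2)" "expectation (h i) = 0"
     "expectation (\<lambda>\<omega>. (h i \<omega>)\<^sup>2) \<le> expectation (\<lambda>\<omega>. (g i \<omega>)\<^sup>2)" if i: "i \<in> I" for i
  proof -
    show "integrable M (h i)" "expectation (h i) = 0"
      using gi[OF i] prob_space by (simp_all add: h_def[abs_def])
    have "(h i \<omega>)\<^sup>2 = (g i \<omega>)\<^sup>2 - 2 * expectation (g i) * g i \<omega> + (expectation (g i))\<^sup>2" for \<omega>
      by (simp add: h_def power2_diff)
    then show "integrable M (\<lambda>\<omega>. (h i \<omega>)\<^sup>2)" using gi[OF i] gi2[OF i] by simp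
    show "expectation (\<lambda>\<omega>. (h i \<omega>)\<^sup>2) \<le> expectation (\<lambda>\<omega>. (g i \<omega>)\<^sup>2)"
      unfolding h_def by (subst variance_eq[OF gi[OF i] gi2[OF i]]) simp
  qed
  have sq: "integrable M (\<lambda>\<omega>. (\<Sum>i\<in>I. h i \<omega>)\<^sup>2)"
    "expectation (\<lambda>\<omega>. (\<Sum>i\<in>I. h i \<omega>)\<^sup>2) = (\<Sum>i\<in>I. expectation (\<lambda>\<omega>. (h i \<omega>)\<^sup>2))"
    by (rule indep_vars_sum_sq[OF I(1) ind]; use h in simp)+
  have "prob {\<omega> \<in> space M. e \<le> \<bar>\<Sum>i\<in>I. h i \<omega>\<bar>} \<le> expectation (\<lambda>\<omega>. (\<Sum>i\<in>I. h i \<omega>)\<^sup>2) / e\<^sup>2"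
  proof (rule second_moment_method)
    show "(\<lambda>\<omega>. \<Sum>i\<in>I. h i \<omega>) \<in> borel_measurable M"
      using h(1) by (intro borel_measurable_sum) auto
  qed (use sq \<open>0 < e\<close> in auto)
  also have "\<dots> \<le> (\<Sum>i\<in>I. expectation (\<lambda>\<omega>. (g i \<omega>)\<^sup>2)) / e\<^sup>2"
    unfolding sq(2) using h(4) by (intro divide_right_mono sum_mono) auto
  finally show ?thesis by (simp add: h_def sum_subtractf)
qed

text \<open>
  Convergence in probability is reduced to a deterministic statement about sequences: if no
  \<open>m\<close> controls \<open>T\<close> on the event where \<open>\<parallel>W\<parallel> \<le> A\<close> and the first \<open>m\<close> deviations are at most
  \<open>1 / (m + 1)\<close>, the counterexamples form a sequence that the deterministic statement excludes.
\<close>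

lemma (in prob_space) tendsto_in_prob_via_sequences:
  fixes T :: "nat \<Rightarrow> 'a \<Rightarrow> real" and W :: "nat \<Rightarrow> 'a \<Rightarrow> 'b::euclidean_space" and X :: "'i \<Rightarrow> nat \<Rightarrow> 'a \<Rightarrow> real"
  assumes T: "\<And>n. N \<le> n \<Longrightarrow> T n \<in> borel_measurable M"
    and W [measurable]: "\<And>n. W n \<in> borel_measurable M"
    and X [measurable]: "\<And>d n. X d n \<in> borel_measurable M"
    and D: "countable D" "D \<noteq> {}"
    and tight: "\<And>e. 0 < e \<Longrightarrow> \<exists>A. \<forall>\<^sub>F n in sequentially. prob {\<omega> \<in> space M. A < norm (W n \<omega>)} \<le> e"
    and conv: "\<And>d e. d \<in> D \<Longrightarrow> 0 < e \<Longrightarrow> (\<lambda>n. prob {\<omega> \<in> space M. e < \<bar>X d n \<omega>\<bar>}) \<longlonglongrightarrow> 0"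
    and seq: "\<And>r \<omega> w. filterlim r at_top sequentially \<Longrightarrow> (\<And>k. N \<le> r k) \<Longrightarrow> (\<And>k. \<omega> k \<in> space M) \<Longrightarrow>
       (\<lambda>k. W (r k) (\<omega> k)) \<longlonglongrightarrow> w \<Longrightarrow> (\<And>d. d \<in> D \<Longrightarrow> (\<lambda>k. X d (r k) (\<omega> k)) \<longlonglongrightarrow> 0) \<Longrightarrow>
       (\<lambda>k. T (r k) (\<omega> k)) \<longlonglongrightarrow> 0"
  shows "tendsto_in_prob M T 0"
  unfolding tendsto_in_prob_def
proof (intro conjI allI impI)
  show "\<forall>\<^sub>F n in sequentially. T n \<in> borel_measurable M"
    using eventually_ge_at_top[of N] by eventually_elim (rule T)
  fix \<epsilon> :: real assume \<epsilon>: "0 < \<epsilon>"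
  define d where "d j = from_nat_into D j" for j
  have dD: "d j \<in> D" for j using D(2) by (simp add: d_def from_nat_into)
  have surj: "\<exists>j. d j = x" if "x \<in> D" for x
    using from_nat_into_surj[OF D(1) that] by (auto simp: d_def)
  \<comment> \<open>One \<open>m\<close> bounds the index from below, the number of controlled
    deviations and, by \<open>1 / (real m + 1)\<close>, their size. A failure for every
    \<open>m\<close> therefore yields pairs of an index and a sample point whose deviations all tend
    to zero; compactness of the ball makes \<open>W\<close> converge along a subsequence.\<close>
  have det: "\<exists>m. \<forall>n\<ge>max m N. \<forall>\<omega>\<in>space M. norm (W n \<omega>) \<le> A \<longrightarrow> (\<forall>j<m. \<bar>X (d j) n \<omega>\<bar> \<le> 1 / (real m + 1)) \<longrightarrow> \<bar>T n \<omega>\<bar> \<le> \<epsilon>" for A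
  proof (rule ccontr)
    assume "\<not> ?thesis"
    then have "\<forall>m. \<exists>p. max m N \<le> fst p \<and> snd p \<in> space M \<and> norm (W (fst p) (snd p)) \<le> A \<and>
        (\<forall>j<m. \<bar>X (d j) (fst p) (snd p)\<bar> \<le> 1 / (real m + 1)) \<and> \<epsilon> < \<bar>T (fst p) (snd p)\<bar>"
      by (simp add: not_le) blast
    from choice[OF this] obtain p where p: "\<And>m. max m N \<le> fst (p m)" "\<And>m. snd (p m) \<in> space M"
      "\<And>m. norm (W (fst (p m)) (snd (p m))) \<le> A"
      "\<And>m j. j < m \<Longrightarrow> \<bar>X (d j) (fst (p m)) (snd (p m))\<bar> \<le> 1 / (real m + 1)"
      "\<And>m. \<epsilon> < \<bar>T (fst (p m)) (snd (p m))\<bar>" by blast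
    define V where "V m = W (fst (p m)) (snd (p m))" for m
    have V: "\<forall>m. V m \<in> cball 0 A" using p(3) by (simp add: V_def)
    obtain w and s :: "nat \<Rightarrow> nat" where s: "strict_mono s" "(V \<circ> s) \<longlonglongrightarrow> w"
      by (rule seq_compactE[OF compact_imp_seq_compact[OF compact_cball] V])
    have sk: "k \<le> s k" for k using s(1) by (simp add: seq_suble)
    have "(\<lambda>k. T (fst (p (s k))) (snd (p (s k)))) \<longlonglongrightarrow> 0"
    proof (rule seq[of "\<lambda>k. fst (p (s k))" "\<lambda>k. snd (p (s k))" w])
      show "filterlim (\<lambda>k. fst (p (s k))) at_top sequentially"
      proof (rule filterlim_at_top_mono[OF filterlim_ident])
        show "\<forall>\<^sub>F k in sequentially. k \<le> fst (p (s k))"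
          using p(1) sk by (intro always_eventually allI) (meson max.boundedE order_trans)
      qed
      show "(\<lambda>k. W (fst (p (s k))) (snd (p (s k)))) \<longlonglongrightarrow> w" using s(2) by (simp add: o_def V_def)
      fix x assume "x \<in> D"
      then obtain j where j: "x = d j" using surj by blast
      show "(\<lambda>k. X x (fst (p (s k))) (snd (p (s k)))) \<longlonglongrightarrow> 0"
      proof (rule Lim_null_comparison)
        show "\<forall>\<^sub>F k in sequentially. norm (X x (fst (p (s k))) (snd (p (s k)))) \<le> 1 / (real k + 1)"
          using eventually_gt_at_top[of j]
        proof eventually_elim
          case (elim k)
          then have "\<bar>X (d j) (fst (p (s k))) (snd (p (s k)))\<bar> \<le> 1 / (real (s k) + 1)"
            using sk[of k] by (intro p(4)) linarith
          also have "\<dots> \<le> 1 / (real k + 1)" using sk[of k] by (simp add: frac_le)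
          finally show ?case by (simp add: j)
        qed
        show "(\<lambda>k. 1 / (real k + 1)) \<longlonglongrightarrow> 0" by real_asymp
      qed
    qed (use p(1,2) max.boundedE in auto)
    then have "\<forall>\<^sub>F k in sequentially. \<bar>T (fst (p (s k))) (snd (p (s k)))\<bar> < \<epsilon>"
      using \<epsilon> by (auto simp: tendsto_iff dist_real_def)
    then obtain k where "\<bar>T (fst (p (s k))) (snd (p (s k)))\<bar> < \<epsilon>"
      using eventually_happens'[OF sequentially_bot] by blast
    then show False using p(5)[of "s k"] by simp
  qed
  show "(\<lambda>n. prob {\<omega> \<in> space M. \<epsilon> < \<bar>T n \<omega> - 0\<bar>}) \<longlonglongrightarrow> 0"
  proof (rule order_tendstoI)
    fix a :: real assume "a < 0"
    then show "\<forall>\<^sub>F n in sequentially. a < prob {\<omega> \<in> space M. \<epsilon> < \<bar>T n \<omega> - 0\<bar>}"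
      by (intro always_eventually allI) (simp add: less_le_trans)
  next
    fix \<eta> :: real assume \<eta>: "0 < \<eta>"
    obtain A where A: "\<forall>\<^sub>F n in sequentially. prob {\<omega> \<in> space M. A < norm (W n \<omega>)} \<le> \<eta> / 2"
      using tight[OF half_gt_zero[OF \<eta>]] by blast
    obtain m where m: "\<forall>n\<ge>max m N. \<forall>\<omega>\<in>space M. norm (W n \<omega>) \<le> A \<longrightarrow> (\<forall>j<m. \<bar>X (d j) n \<omega>\<bar> \<le> 1 / (real m + 1)) \<longrightarrow> \<bar>T n \<omega>\<bar> \<le> \<epsilon>"
      using det by blast
    have "(\<lambda>n. \<Sum>j<m. prob {\<omega> \<in> space M. 1 / (real m + 1) < \<bar>X (d j) n \<omega>\<bar>}) \<longlonglongrightarrow> (\<Sum>j<m. 0)"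
      by (intro tendsto_sum conv dD) simp
    then have "\<forall>\<^sub>F n in sequentially. (\<Sum>j<m. prob {\<omega> \<in> space M. 1 / (real m + 1) < \<bar>X (d j) n \<omega>\<bar>}) < \<eta> / 2"
      using \<eta> by (intro order_tendstoD(2)[where y=0]) auto
    with A eventually_ge_at_top[of "max m N"]
    show "\<forall>\<^sub>F n in sequentially. prob {\<omega> \<in> space M. \<epsilon> < \<bar>T n \<omega> - 0\<bar>} < \<eta>"
    proof eventually_elim
      case (elim n)
      let ?B = "{\<omega> \<in> space M. A < norm (W n \<omega>)}"
      let ?C = "\<lambda>j. {\<omega> \<in> space M. 1 / (real m + 1) < \<bar>X (d j) n \<omega>\<bar>}"
      \<comment> \<open>By the choice of \<open>m\<close>, a large value of \<open>T n\<close>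
        forces either a large norm of \<open>W n\<close> or one of finitely many large
        deviations.\<close>
      have "{\<omega> \<in> space M. \<epsilon> < \<bar>T n \<omega> - 0\<bar>} \<subseteq> ?B \<union> (\<Union>j\<in>{..<m}. ?C j)"
        using m[rule_format, OF elim(2)] by (fastforce simp: not_le[symmetric])
      then have "prob {\<omega> \<in> space M. \<epsilon> < \<bar>T n \<omega> - 0\<bar>} \<le> prob (?B \<union> (\<Union>j\<in>{..<m}. ?C j))"
        by (intro finite_measure_mono) measurable
      also have "\<dots> \<le> prob ?B + prob (\<Union>j\<in>{..<m}. ?C j)"
        by (intro measure_Un_le) measurable
      also have "prob (\<Union>j\<in>{..<m}. ?C j) \<le> (\<Sum>j<m. prob (?C j))"
        by (intro measure_UNION_le) (auto intro: measurable)
      finally show ?case using elim by simp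
    qed
  qed
qed

section \<open>Quadratic expansion of the log-likelihood\<close>

lemma outer_square_quadratic: "h \<bullet> (outer_square x *v h) = (x \<bullet> h)\<^sup>2"
proof -
  have "outer_square x *v h = (x \<bullet> h) *\<^sub>R x"
    by (simp add: vec_eq_iff outer_square_def matrix_vector_mult_def matrix_matrix_mult_def
        columnvector_def rowvector_def inner_vec_def sum_distrib_left sum_distrib_right mult_ac)
  then show ?thesis by (simp add: power2_eq_square inner_commute)
qed

lemma transpose_outer_square: "transpose (outer_square x) = outer_square x"
  by (simp add: vec_eq_iff outer_square_def transpose_def matrix_matrix_mult_def columnvector_def rowvector_def mult.commute)

lemma sum_matrix_vector: "(\<Sum>i\<in>I. A i) *v x = (\<Sum>i\<in>I. (A i :: real^'n^'m) *v x)"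
  by (induction I rule: infinite_finite_induct) (auto simp: matrix_vector_mult_add_rdistrib)

lemma outer_square_sum_quadratic:
  "h \<bullet> ((a *\<^sub>R (\<Sum>i\<in>I. w i *\<^sub>R outer_square (x i))) *v h) = a * (\<Sum>i\<in>I. w i * (x i \<bullet> h)\<^sup>2)"
  by (simp add: scaleR_matrix_vector sum_matrix_vector inner_sum_right outer_square_quadratic)

lemma transpose_sum: "transpose (\<Sum>i\<in>I. A i) = (\<Sum>i\<in>I. transpose (A i :: real^'n^'m))"
  by (simp add: vec_eq_iff transpose_def)

lemma transpose_outer_square_sum:
  "transpose (a *\<^sub>R (\<Sum>i\<in>I. w i *\<^sub>R outer_square (x i))) = a *\<^sub>R (\<Sum>i\<in>I. w i *\<^sub>R outer_square (x i))"
  by (simp add: transpose_scaleR transpose_sum transpose_outer_square)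

lemma convex_on_sum_functions:
  "(\<And>i. convex_on UNIV (f i)) \<Longrightarrow> convex_on UNIV (\<lambda>x. \<Sum>i\<in>I. f i x)"
  by (induction I rule: infinite_finite_induct) (auto intro: convex_on_add simp: convex_on_def[of _ "\<lambda>_. 0"])

text \<open>Inserts trivial weights, so that the facts on weighted sums of outer squares serve both
  this matrix and the density-weighted averages that tend to \<open>V\<close>.\<close>

lemma S_emp_eq: "S_emp X n = (1 / real n) *\<^sub>R (\<Sum>i=1..n. 1 *\<^sub>R outer_square (X i))"
  by (simp add: S_emp_def)

lemma pos_def_limit_outer_squares:
  fixes A :: "real^'n^'n"
  assumes lim: "(\<lambda>n. (1 / real n) *\<^sub>R (\<Sum>i=1..n. w i *\<^sub>R outer_square (x i))) \<longlonglongrightarrow> A"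
    and w: "\<And>i. 1 \<le> i \<Longrightarrow> 0 \<le> w i" and inv: "invertible A"
  shows "pos_def A"
proof (rule pos_semidef_invertible_imp_pos_def[OF _ _ inv])
  let ?B = "\<lambda>n. (1 / real n) *\<^sub>R (\<Sum>i=1..n. w i *\<^sub>R outer_square (x i))"
  have "(\<lambda>n. transpose (?B n)) \<longlonglongrightarrow> transpose A"
  proof (rule tendsto_matrixI)
    fix i j
    have "(\<lambda>n. ?B n $ j $ i) \<longlonglongrightarrow> A $ j $ i" by (intro tendsto_vec_nth lim)
    then show "(\<lambda>n. transpose (?B n) $ i $ j) \<longlonglongrightarrow> transpose A $ i $ j"
      by (simp only: transpose_def vec_lambda_beta)
  qed
  then show "transpose A = A"
    unfolding transpose_outer_square_sum using lim LIMSEQ_unique by blast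
  fix h :: "real^'n"
  have "(\<lambda>n. h \<bullet> (?B n *v h)) \<longlonglongrightarrow> h \<bullet> (A *v h)"
    by (intro tendsto_intros tendsto_matrix_vector_mult lim)
  then show "0 \<le> h \<bullet> (A *v h)"
  proof (rule tendsto_lowerbound)
    show "\<forall>\<^sub>F n in sequentially. 0 \<le> h \<bullet> (?B n *v h)"
      unfolding outer_square_sum_quadratic by (intro always_eventually allI mult_nonneg_nonneg sum_nonneg w) auto
  qed simp
qed

text \<open>The remainder vanishes for arguments larger than \<open>\<bar>v\<bar>\<close>, so only
  the density within \<open>\<bar>v\<bar>\<close> of \<open>c\<close> matters. Freezing it at
  \<open>c\<close> gives the main term, and the Hoelder bound multiplies the same triangle area in
  the error.\<close>

lemma (in prob_space) expectation_loss_remainder: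
  fixes p :: "real \<Rightarrow> real"
  assumes Y: "distributed M lborel Y (\<lambda>y. ennreal (p y))" and p: "\<And>y. 0 \<le> p y"
    and holder: "\<And>t. \<bar>t\<bar> < \<delta> \<Longrightarrow> \<bar>p (c + t) - p c\<bar> \<le> C * \<bar>t\<bar> powr \<eta>"
    and v: "\<bar>v\<bar> < \<delta>" and C: "0 \<le> C" "0 \<le> \<eta>"
  shows "\<bar>expectation (\<lambda>\<omega>. loss_remainder (Y \<omega> - c) v) - p c * (v\<^sup>2 / 2)\<bar> \<le> C * \<bar>v\<bar> powr \<eta> * (v\<^sup>2 / 2)"
proof -
  have [measurable]: "p \<in> borel_measurable borel"
    using distributed_real_measurable[OF _ Y] p by simp
  have Ym [measurable]: "Y \<in> borel_measurable M"
    using distributed_measurable[OF Y] by simp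
  note I = has_bochner_integral_loss_remainder[of v]
  have "integrable M (\<lambda>\<omega>. loss_remainder (Y \<omega> - c) v)"
    using loss_remainder_bounds by (intro integrable_const_bound[where B="\<bar>v\<bar>"]) auto
  then have "integrable lborel (\<lambda>y. p y * loss_remainder (y - c) v)"
    using distributed_integrable[OF Y, of "\<lambda>y. loss_remainder (y - c) v"] p by simp
  from lborel_integrable_real_affine[OF this, of 1 c]
  have i1: "integrable lborel (\<lambda>t. p (c + t) * loss_remainder t v)" by simp
  have "expectation (\<lambda>\<omega>. loss_remainder (Y \<omega> - c) v) = (\<integral>y. p y * loss_remainder (y - c) v \<partial>lborel)"
    using distributed_integral[OF Y, of "\<lambda>y. loss_remainder (y - c) v"] p by simp
  also have "\<dots> = (\<integral>t. p (c + t) * loss_remainder t v \<partial>lborel)"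
    using lborel_integral_real_affine[of 1 "\<lambda>y. p y * loss_remainder (y - c) v" c] by simp
  finally have "expectation (\<lambda>\<omega>. loss_remainder (Y \<omega> - c) v) - p c * (v\<^sup>2 / 2)
     = (\<integral>t. p (c + t) * loss_remainder t v - p c * loss_remainder t v \<partial>lborel)"
    using i1 I by (simp add: has_bochner_integral_iff)
  also have "\<bar>\<dots>\<bar> \<le> (\<integral>t. \<bar>p (c + t) * loss_remainder t v - p c * loss_remainder t v\<bar> \<partial>lborel)"
    by (rule integral_abs_bound)
  also have "\<dots> \<le> (\<integral>t. C * \<bar>v\<bar> powr \<eta> * loss_remainder t v \<partial>lborel)"
  proof (rule integral_mono)
    fix t
    show "\<bar>p (c + t) * loss_remainder t v - p c * loss_remainder t v\<bar> \<le> C * \<bar>v\<bar> powr \<eta> * loss_remainder t v"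
    proof (cases "\<bar>v\<bar> < \<bar>t\<bar>")
      case True
      then show ?thesis by (simp add: loss_remainder_eq_0)
    next
      case False
      have "\<bar>p (c + t) - p c\<bar> \<le> C * \<bar>t\<bar> powr \<eta>" using False v by (intro holder) simp
      also have "\<dots> \<le> C * \<bar>v\<bar> powr \<eta>" using False C by (intro mult_left_mono powr_mono2) auto
      finally show ?thesis
        using loss_remainder_bounds(1)[of t v] by (simp add: abs_mult mult_right_mono flip: left_diff_distrib)
    qed
  qed (use i1 I in \<open>auto simp: has_bochner_integral_iff\<close>)
  also have "\<dots> = C * \<bar>v\<bar> powr \<eta> * (v\<^sup>2 / 2)"
    using I by (simp add: has_bochner_integral_iff)
  finally show ?thesis .
qed

section \<open>The quantile regression model\<close>

locale quantile_model = prob_space M for M :: "'a measure" +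
  fixes \<tau> :: real and Y :: "nat \<Rightarrow> 'a \<Rightarrow> real" and p :: "nat \<Rightarrow> real \<Rightarrow> real"
    and X :: "nat \<Rightarrow> real^'d" and \<beta>0 :: "real^'d" and \<pi> :: "real^'d \<Rightarrow> real"
    and S V :: "real^'d^'d" and c1 :: 'd
  assumes tau: "0 < \<tau>" "\<tau> < 1"
    and indep: "indep_vars (\<lambda>_. borel) Y {1..}"
    and p_nonneg: "\<And>i y. i \<ge> 1 \<Longrightarrow> 0 \<le> p i y"
    and Y_density: "\<And>i. i \<ge> 1 \<Longrightarrow> distributed M lborel (Y i) (\<lambda>y. ennreal (p i y))"
    and quantile: "\<And>i. i \<ge> 1 \<Longrightarrow> prob {\<omega> \<in> space M. Y i \<omega> - X i \<bullet> \<beta>0 \<le> 0} = \<tau>"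
    and S_lim: "(\<lambda>n. S_emp X n) \<longlonglongrightarrow> S"
    and V_lim: "(\<lambda>n. (1 / real n) *\<^sub>R (\<Sum>i=1..n. p i (X i \<bullet> \<beta>0) *\<^sub>R outer_square (X i))) \<longlonglongrightarrow> V"
    and S_inv: "invertible S"
    and V_inv: "invertible V"
    and prior: "\<And>\<beta>. 0 \<le> \<pi> \<beta>" "(\<integral>\<^sup>+ \<beta>. ennreal (\<pi> \<beta>) \<partial>lborel) = 1"
      "bounded (range \<pi>)" "continuous_on UNIV \<pi>" "0 < \<pi> \<beta>0"
    and prior_second_moment: "(\<integral>\<^sup>+ \<beta>. ennreal ((norm \<beta>)\<^sup>2 * \<pi> \<beta>) \<partial>lborel) < \<infinity>"
    and X_bounded: "\<exists>K>0. \<forall>i\<ge>1. norm (X i) \<le> K"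
    and intercept: "\<And>i. i \<ge> 1 \<Longrightarrow> X i $ c1 = 1"
    and density_holder: "\<exists>C>0. \<exists>\<eta>>0. \<forall>\<^sub>F \<beta> in nhds \<beta>0. \<forall>i\<ge>1.
         \<bar>p i (X i \<bullet> \<beta>) - p i (X i \<bullet> \<beta>0)\<bar> \<le> C * \<bar>X i \<bullet> \<beta> - X i \<bullet> \<beta>0\<bar> powr \<eta>"
begin

definition Z :: "nat \<Rightarrow> 'a \<Rightarrow> real" where "Z i \<omega> = Y i \<omega> - X i \<bullet> \<beta>0"

lemma Y_measurable: "1 \<le> i \<Longrightarrow> Y i \<in> borel_measurable M"
  using distributed_measurable[OF Y_density] by simp

lemma Z_measurable: "1 \<le> i \<Longrightarrow> Z i \<in> borel_measurable M"
  unfolding Z_def[abs_def] using Y_measurable by measurable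

lemma indep_Z: "indep_vars (\<lambda>_. borel) Z {1..}"
  unfolding Z_def[abs_def] by (rule indep_vars_compose2[OF indep]) measurable

lemma pos_def_V: "pos_def V"
  by (rule pos_def_limit_outer_squares[OF V_lim _ V_inv]) (rule p_nonneg)

lemma pos_def_S: "pos_def S"
  by (rule pos_def_limit_outer_squares[OF S_lim[unfolded S_emp_eq] _ S_inv]) simp

text \<open>Invertibility is an open condition: the determinants tend to that of \<open>S\<close>,
  and semidefiniteness holds for every \<open>n\<close>.\<close>

lemma eventually_pos_def_S_emp: "\<forall>\<^sub>F n in sequentially. pos_def (S_emp X n)"
proof -
  have "det S \<noteq> 0" using S_inv by (simp add: invertible_det_nz)
  then have "\<forall>\<^sub>F n in sequentially. det (S_emp X n) \<noteq> 0"
    by (rule tendsto_imp_eventually_ne[OF tendsto_det[OF S_lim]])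
  then show ?thesis
  proof eventually_elim
    case (elim n)
    show ?case
    proof (rule pos_semidef_invertible_imp_pos_def)
      show "transpose (S_emp X n) = S_emp X n" unfolding S_emp_eq by (rule transpose_outer_square_sum)
      show "invertible (S_emp X n)" using elim by (simp add: invertible_det_nz)
      show "0 \<le> h \<bullet> (S_emp X n *v h)" for h
        unfolding S_emp_eq outer_square_sum_quadratic by (intro mult_nonneg_nonneg sum_nonneg) auto
    qed
  qed
qed

text \<open>Moving \<open>\<beta>\<close> along the intercept coordinate shifts every \<open>X\<^sub>i\<^sup>T \<beta>\<close> by the same amount.\<close>

lemma uniform_holder:
  obtains C \<eta> \<delta> where "0 < C" "0 < \<eta>" "0 < \<delta>"
    "\<And>i t. 1 \<le> i \<Longrightarrow> \<bar>t\<bar> < \<delta> \<Longrightarrow> \<bar>p i (X i \<bullet> \<beta>0 + t) - p i (X i \<bullet> \<beta>0)\<bar> \<le> C * \<bar>t\<bar> powr \<eta>"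
proof -
  obtain C \<eta> where C: "0 < C" "0 < \<eta>" and ev: "\<forall>\<^sub>F \<beta> in nhds \<beta>0. \<forall>i\<ge>1.
         \<bar>p i (X i \<bullet> \<beta>) - p i (X i \<bullet> \<beta>0)\<bar> \<le> C * \<bar>X i \<bullet> \<beta> - X i \<bullet> \<beta>0\<bar> powr \<eta>"
    using density_holder by blast
  then obtain \<delta> where \<delta>: "0 < \<delta>" and h: "\<And>\<beta> i. dist \<beta> \<beta>0 < \<delta> \<Longrightarrow> 1 \<le> i \<Longrightarrow>
         \<bar>p i (X i \<bullet> \<beta>) - p i (X i \<bullet> \<beta>0)\<bar> \<le> C * \<bar>X i \<bullet> \<beta> - X i \<bullet> \<beta>0\<bar> powr \<eta>"
    unfolding eventually_nhds_metric by blast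
  have "\<bar>p i (X i \<bullet> \<beta>0 + t) - p i (X i \<bullet> \<beta>0)\<bar> \<le> C * \<bar>t\<bar> powr \<eta>" if "1 \<le> i" "\<bar>t\<bar> < \<delta>" for i t
  proof -
    have "X i \<bullet> (\<beta>0 + t *\<^sub>R axis c1 1) = X i \<bullet> \<beta>0 + t"
      using intercept[OF that(1)] by (simp add: inner_add_right inner_axis)
    moreover have "dist (\<beta>0 + t *\<^sub>R axis c1 1) \<beta>0 < \<delta>" using that(2) by (simp add: dist_norm norm_axis_1)
    ultimately show ?thesis using h[of "\<beta>0 + t *\<^sub>R axis c1 1" i] that(1) by simp
  qed
  then show ?thesis using that C \<delta> by blast
qed

section \<open>Law of large numbers for the remainders and tightness of the score\<close>

definition remainder_sum :: "real^'d \<Rightarrow> nat \<Rightarrow> 'a \<Rightarrow> real" where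
  "remainder_sum h n \<omega> = (\<Sum>i=1..n. loss_remainder (Z i \<omega>) (X i \<bullet> h / sqrt n))"

lemma remainder_sum_measurable [measurable]: "remainder_sum h n \<in> borel_measurable M"
proof -
  have "(\<lambda>\<omega>. loss_remainder (Z i \<omega>) (X i \<bullet> h / sqrt n)) \<in> borel_measurable M" if "i \<in> {1..n}" for i
  proof -
    have [measurable]: "Z i \<in> borel_measurable M" using Z_measurable that by simp
    show ?thesis by measurable
  qed
  then show ?thesis unfolding remainder_sum_def[abs_def] by (rule borel_measurable_sum)
qed

text \<open>The expectations \<open>E\<close> approach the quadratic form by freezing the densities
  at the quantiles. The fluctuations vanish because each remainder is at most B / sqrt n, so the
  second moments sum to at most B / sqrt n times the convergent \<open>E n\<close>.\<close>

lemma remainder_sum_tendsto: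
  assumes e: "0 < e"
  shows "(\<lambda>n. prob {\<omega> \<in> space M. e < \<bar>remainder_sum h n \<omega> - h \<bullet> (V *v h) / 2\<bar>}) \<longlonglongrightarrow> 0"
proof -
  obtain C \<eta> \<delta> where C: "0 < C" "0 < \<eta>" "0 < \<delta>"
    and holder: "\<And>i t. 1 \<le> i \<Longrightarrow> \<bar>t\<bar> < \<delta> \<Longrightarrow> \<bar>p i (X i \<bullet> \<beta>0 + t) - p i (X i \<bullet> \<beta>0)\<bar> \<le> C * \<bar>t\<bar> powr \<eta>"
    using uniform_holder by blast
  obtain K where K: "0 < K" "\<And>i. 1 \<le> i \<Longrightarrow> norm (X i) \<le> K" using X_bounded by blast
  define B where "B = K * norm h"
  have B: "0 \<le> B" using K by (simp add: B_def)
  have XB: "\<bar>X i \<bullet> h\<bar> \<le> B" if "1 \<le> i" for i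
    using Cauchy_Schwarz_ineq2[of "X i" h] mult_right_mono[OF K(2)[OF that], of "norm h"] by (simp add: B_def)
  define v where "v n i = X i \<bullet> h / sqrt n" for n i :: nat
  have v: "\<bar>v n i\<bar> \<le> B / sqrt n" if "1 \<le> i" for n i
    using XB[OF that] by (simp add: v_def divide_right_mono)
  let ?ER = "\<lambda>n i. expectation (\<lambda>\<omega>. loss_remainder (Z i \<omega>) (v n i))"
  define E where "E n = (\<Sum>i=1..n. ?ER n i)" for n
  have int: "integrable M (\<lambda>\<omega>. loss_remainder (Z i \<omega>) a)" if "1 \<le> i" for i a
  proof -
    have [measurable]: "Z i \<in> borel_measurable M" using Z_measurable that by simp
    show ?thesis using loss_remainder_bounds by (intro integrable_const_bound[where B="\<bar>a\<bar>"]) auto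
  qed
  define E' where "E' n = (\<Sum>i=1..n. p i (X i \<bullet> \<beta>0) * ((v n i)\<^sup>2 / 2))" for n
  have E'_eq: "E' n = h \<bullet> (((1 / real n) *\<^sub>R (\<Sum>i=1..n. p i (X i \<bullet> \<beta>0) *\<^sub>R outer_square (X i))) *v h) / 2" for n
    unfolding outer_square_sum_quadratic E'_def
    by (simp add: v_def power_divide sum_distrib_left sum_divide_distrib field_simps)
  have E': "E' \<longlonglongrightarrow> h \<bullet> (V *v h) / 2"
    unfolding E'_eq[abs_def] by (intro tendsto_intros tendsto_matrix_vector_mult V_lim) simp
  have lim0: "(\<lambda>n::nat. B / sqrt n) \<longlonglongrightarrow> 0" by real_asymp
  then have small: "\<forall>\<^sub>F n in sequentially. B / sqrt (real n) < \<delta>"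
    using C(3) by (rule order_tendstoD(2))
  have EE': "(\<lambda>n. E n - E' n) \<longlonglongrightarrow> 0"
  proof (rule Lim_null_comparison)
    have "(\<lambda>n::nat. (B / sqrt n) powr \<eta>) \<longlonglongrightarrow> 0 powr \<eta>"
    proof (rule tendsto_powr2[OF lim0 tendsto_const])
      show "\<forall>\<^sub>F n in sequentially. 0 \<le> B / sqrt (real n)" using B by simp
    qed (use C in simp)
    then have "(\<lambda>n::nat. C * (B / sqrt n) powr \<eta> * (B\<^sup>2 / 2)) \<longlonglongrightarrow> C * 0 * (B\<^sup>2 / 2)"
      using C by (intro tendsto_intros) simp
    then show "(\<lambda>n::nat. C * (B / sqrt n) powr \<eta> * (B\<^sup>2 / 2)) \<longlonglongrightarrow> 0" by simp
    show "\<forall>\<^sub>F n in sequentially. norm (E n - E' n) \<le> C * (B / sqrt n) powr \<eta> * (B\<^sup>2 / 2)"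
      using small eventually_gt_at_top[of 0]
    proof eventually_elim
      case (elim n)
      have bound: "\<bar>?ER n i - p i (X i \<bullet> \<beta>0) * ((v n i)\<^sup>2 / 2)\<bar>
          \<le> C * (B / sqrt n) powr \<eta> * ((B / sqrt n)\<^sup>2 / 2)" if i: "i \<in> {1..n}" for i
      proof -
        have i1: "1 \<le> i" using i by simp
        have "\<bar>v n i\<bar> < \<delta>" using v[OF i1] elim(1) by (rule le_less_trans)
        then have "\<bar>?ER n i - p i (X i \<bullet> \<beta>0) * ((v n i)\<^sup>2 / 2)\<bar>
          \<le> C * \<bar>v n i\<bar> powr \<eta> * ((v n i)\<^sup>2 / 2)"
          unfolding Z_def using expectation_loss_remainder[OF Y_density[OF i1] p_nonneg[OF i1] holder[OF i1]] C by simp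
        also have "(v n i)\<^sup>2 = \<bar>v n i\<bar>\<^sup>2" by simp
        also have "C * \<bar>v n i\<bar> powr \<eta> * (\<bar>v n i\<bar>\<^sup>2 / 2) \<le> C * (B / sqrt n) powr \<eta> * ((B / sqrt n)\<^sup>2 / 2)"
          using v[OF i1, of n] C by (intro mult_mono divide_right_mono power_mono powr_mono2) auto
        finally show ?thesis by simp
      qed
      have "\<bar>E n - E' n\<bar> \<le> (\<Sum>i=1..n. \<bar>?ER n i - p i (X i \<bullet> \<beta>0) * ((v n i)\<^sup>2 / 2)\<bar>)"
        unfolding E_def E'_def sum_subtractf[symmetric] by (rule sum_abs)
      also have "\<dots> \<le> (\<Sum>i=1..n. C * (B / sqrt n) powr \<eta> * ((B / sqrt n)\<^sup>2 / 2))"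
        by (rule sum_mono) (rule bound)
      also have "\<dots> = C * (B / sqrt n) powr \<eta> * (B\<^sup>2 / 2)"
        using elim(2) by (simp add: power_divide)
      finally show ?case by simp
    qed
  qed
  have E: "E \<longlonglongrightarrow> h \<bullet> (V *v h) / 2"
    using tendsto_add[OF EE' E'] by simp
  have dev: "prob {\<omega> \<in> space M. e / 2 \<le> \<bar>remainder_sum h n \<omega> - E n\<bar>} \<le> (B / sqrt n) * E n / (e / 2)\<^sup>2" for n
  proof -
    have ind: "indep_vars (\<lambda>_. borel) (\<lambda>i \<omega>. loss_remainder (Z i \<omega>) (v n i)) {1..n}"
      by (rule indep_vars_compose2[OF indep_vars_subset[OF indep_Z]]) (auto, measurable)
    have "prob {\<omega> \<in> space M. e / 2 \<le> \<bar>remainder_sum h n \<omega> - E n\<bar>}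
        \<le> (\<Sum>i=1..n. expectation (\<lambda>\<omega>. (loss_remainder (Z i \<omega>) (v n i))\<^sup>2)) / (e / 2)\<^sup>2"
      unfolding remainder_sum_def E_def v_def[symmetric]
      by (rule indep_sum_deviation[OF _ ind, where B="\<lambda>i. \<bar>v n i\<bar>"])
         (use e loss_remainder_bounds in \<open>auto simp: abs_of_nonneg\<close>)
    also have "(\<Sum>i=1..n. expectation (\<lambda>\<omega>. (loss_remainder (Z i \<omega>) (v n i))\<^sup>2))
        \<le> (\<Sum>i=1..n. (B / sqrt n) * ?ER n i)"
    proof (rule sum_mono)
      fix i assume "i \<in> {1..n}"
      then have i: "1 \<le> i" by simp
      have [measurable]: "Z i \<in> borel_measurable M" by (rule Z_measurable[OF i])
      \<comment> \<open>One factor of the square is replaced by its uniform bound, the other is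
        kept; this extra factor 1 / sqrt n makes Chebyshev's bound vanish.\<close>
      have le: "(loss_remainder (Z i \<omega>) (v n i))\<^sup>2 \<le> (B / sqrt n) * loss_remainder (Z i \<omega>) (v n i)" for \<omega>
        unfolding power2_eq_square using loss_remainder_bounds[of "Z i \<omega>" "v n i"] v[OF i, of n]
        by (intro mult_right_mono) auto
      have "expectation (\<lambda>\<omega>. (loss_remainder (Z i \<omega>) (v n i))\<^sup>2) \<le> expectation (\<lambda>\<omega>. (B / sqrt n) * loss_remainder (Z i \<omega>) (v n i))"
      proof (rule integral_mono_AE')
        show "integrable M (\<lambda>\<omega>. (B / sqrt n) * loss_remainder (Z i \<omega>) (v n i))" using int[OF i] by simp
      qed (use le order_trans[OF zero_le_power2 le] in auto)
      then show "expectation (\<lambda>\<omega>. (loss_remainder (Z i \<omega>) (v n i))\<^sup>2) \<le> (B / sqrt n) * ?ER n i"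
        by simp
    qed
    finally show ?thesis by (simp add: E_def sum_distrib_left divide_right_mono)
  qed
  have "(\<lambda>n::nat. (B / sqrt n) * E n / (e / 2)\<^sup>2) \<longlonglongrightarrow> 0 * (h \<bullet> (V *v h) / 2) / (e / 2)\<^sup>2"
    using e by (intro tendsto_intros lim0 E) simp
  then have bound: "(\<lambda>n::nat. (B / sqrt n) * E n / (e / 2)\<^sup>2) \<longlonglongrightarrow> 0" by simp
  have "\<forall>\<^sub>F n in sequentially. \<bar>E n - h \<bullet> (V *v h) / 2\<bar> < e / 2"
    using E half_gt_zero[OF e] unfolding tendsto_iff dist_real_def by blast
  then have "\<forall>\<^sub>F n in sequentially. norm (prob {\<omega> \<in> space M. e < \<bar>remainder_sum h n \<omega> - h \<bullet> (V *v h) / 2\<bar>}) \<le> (B / sqrt n) * E n / (e / 2)\<^sup>2"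
  proof eventually_elim
    case (elim n)
    have "prob {\<omega> \<in> space M. e < \<bar>remainder_sum h n \<omega> - h \<bullet> (V *v h) / 2\<bar>} \<le> prob {\<omega> \<in> space M. e / 2 \<le> \<bar>remainder_sum h n \<omega> - E n\<bar>}"
      using elim by (intro finite_measure_mono) (auto simp: abs_if split: if_splits, measurable)
    then show ?case using dev[of n] by simp
  qed
  then show ?thesis using bound by (rule Lim_null_comparison)
qed

text \<open>The vector W_n. Its summands are slopes of the check loss at \<open>Z i\<close>, and the
  quantile condition makes them centred.\<close>

definition score :: "nat \<Rightarrow> 'a \<Rightarrow> real^'d" where
  "score n \<omega> = (1 / sqrt n) *\<^sub>R (\<Sum>i=1..n. (\<tau> - indicator {..0} (Z i \<omega>)) *\<^sub>R X i)"

lemma score_measurable [measurable]: "score n \<in> borel_measurable M"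
proof -
  have "(\<lambda>\<omega>. (\<tau> - indicator {..0} (Z i \<omega>)) *\<^sub>R X i) \<in> borel_measurable M" if "i \<in> {1..n}" for i
  proof -
    have [measurable]: "Z i \<in> borel_measurable M" using Z_measurable that by simp
    show ?thesis by measurable
  qed
  then have "(\<lambda>\<omega>. \<Sum>i=1..n. (\<tau> - indicator {..0} (Z i \<omega>)) *\<^sub>R X i) \<in> borel_measurable M" by (rule borel_measurable_sum)
  then show ?thesis unfolding score_def[abs_def] by measurable
qed

text \<open>Each summand of a coordinate is bounded by \<open>K\<close> and centred, so the
  coordinate has second moment at most \<open>K\<^sup>2\<close> for every \<open>n\<close>.
  Chebyshev's inequality and a union over the coordinates finish.\<close>

lemma score_tight:
  assumes e: "0 < e"
  shows "\<exists>A. \<forall>\<^sub>F n in sequentially. prob {\<omega> \<in> space M. A < norm (score n \<omega>)} \<le> e"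
proof -
  obtain K where K: "0 < K" "\<And>i. 1 \<le> i \<Longrightarrow> norm (X i) \<le> K" using X_bounded by blast
  let ?d = "real CARD('d)"
  \<comment> \<open>Solves K^2 / a^2 = e / d, so each of the d coordinates receives an equal share
    of \<open>e\<close>. The threshold for the norm is then d a, by the l1 bound.\<close>
  define a where "a = K * sqrt (?d / e)"
  have a: "0 < a" using K e by (simp add: a_def)
  have comp: "prob {\<omega> \<in> space M. a \<le> \<bar>score n \<omega> $ k\<bar>} \<le> e / ?d" if n: "0 < n" for n k
  proof -
    define g where "g i \<omega> = (\<tau> - indicator {..0} (Z i \<omega>)) * X i $ k" for i \<omega>
    have ind: "indep_vars (\<lambda>_. borel) g {1..n}"
      unfolding g_def[abs_def] by (rule indep_vars_compose2[OF indep_vars_subset[OF indep_Z]]) (auto, measurable)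
    have gK: "\<bar>g i \<omega>\<bar> \<le> K" if "i \<in> {1..n}" for i \<omega>
    proof -
      have "\<bar>g i \<omega>\<bar> \<le> 1 * K"
        unfolding g_def abs_mult using tau K(2)[of i] that component_le_norm_cart[of "X i" k]
        by (intro mult_mono) (auto simp: indicator_def)
      then show ?thesis by simp
    qed
    have gE: "expectation (g i) = 0" if "i \<in> {1..n}" for i
    proof -
      have [measurable]: "Z i \<in> borel_measurable M" using Z_measurable that by simp
      have "expectation (\<lambda>\<omega>. indicator {..0} (Z i \<omega>)) = prob {\<omega> \<in> space M. Z i \<omega> \<le> 0}"
      proof -
        have "expectation (\<lambda>\<omega>. indicator {..0} (Z i \<omega>)) = expectation (indicator {\<omega> \<in> space M. Z i \<omega> \<le> 0})"
          by (intro Bochner_Integration.integral_cong) (auto simp: indicator_def)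
        also have "\<dots> = prob ({\<omega> \<in> space M. Z i \<omega> \<le> 0} \<inter> space M)" by simp
        also have "{\<omega> \<in> space M. Z i \<omega> \<le> 0} \<inter> space M = {\<omega> \<in> space M. Z i \<omega> \<le> 0}" by blast
        finally show ?thesis .
      qed
      also have "\<dots> = \<tau>" using quantile[of i] that by (simp add: Z_def)
      finally have "expectation (\<lambda>\<omega>. indicator {..0} (Z i \<omega>)) = \<tau>" .
      moreover have "integrable M (\<lambda>\<omega>. indicator {..0} (Z i \<omega>) :: real)"
        by (rule integrable_const_bound[where B=1]) auto
      ultimately show ?thesis using prob_space by (simp add: g_def[abs_def])
    qed
    have "score n \<omega> $ k = (\<Sum>i=1..n. g i \<omega>) / sqrt n" for \<omega>
      by (simp add: score_def g_def)
    then have "prob {\<omega> \<in> space M. a \<le> \<bar>score n \<omega> $ k\<bar>} = prob {\<omega> \<in> space M. a * sqrt n \<le> \<bar>(\<Sum>i=1..n. g i \<omega>) - (\<Sum>i=1..n. expectation (g i))\<bar>}"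
      using n gE by (simp add: pos_le_divide_eq)
    also have "\<dots> \<le> (\<Sum>i=1..n. expectation (\<lambda>\<omega>. (g i \<omega>)\<^sup>2)) / (a * sqrt n)\<^sup>2"
      by (rule indep_sum_deviation[OF _ ind, where B="\<lambda>_. K"]) (use gK a n in auto)
    also have "\<dots> \<le> (\<Sum>i=1..n. K\<^sup>2) / (a * sqrt n)\<^sup>2"
    proof (intro divide_right_mono sum_mono)
      fix i assume i: "i \<in> {1..n}"
      have "expectation (\<lambda>\<omega>. (g i \<omega>)\<^sup>2) \<le> expectation (\<lambda>\<omega>. K\<^sup>2)"
        using gK[OF i] K(1) by (intro integral_mono_AE') (auto intro!: AE_I2 abs_le_square_iff[THEN iffD1])
      then show "expectation (\<lambda>\<omega>. (g i \<omega>)\<^sup>2) \<le> K\<^sup>2" using prob_space by simp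
    qed simp
    also have "\<dots> = e / ?d"
      using n K e by (simp add: a_def power_mult_distrib)
    finally show ?thesis .
  qed
  have "prob {\<omega> \<in> space M. ?d * a < norm (score n \<omega>)} \<le> e" if n: "0 < n" for n
  proof -
    have "{\<omega> \<in> space M. ?d * a < norm (score n \<omega>)} \<subseteq> (\<Union>k\<in>UNIV. {\<omega> \<in> space M. a \<le> \<bar>score n \<omega> $ k\<bar>})"
    proof
      fix \<omega> assume \<omega>: "\<omega> \<in> {\<omega> \<in> space M. ?d * a < norm (score n \<omega>)}"
      have "\<exists>k. a \<le> \<bar>score n \<omega> $ k\<bar>"
      proof (rule ccontr)
        assume "\<not> ?thesis"
        then have "\<bar>score n \<omega> $ k\<bar> \<le> a" for k by (meson less_imp_le not_le)
        then have "(\<Sum>k\<in>UNIV. \<bar>score n \<omega> $ k\<bar>) \<le> ?d * a"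
          using sum_bounded_above[of UNIV "\<lambda>k. \<bar>score n \<omega> $ k\<bar>" a] by simp
        then show False using \<omega> norm_le_l1_cart[of "score n \<omega>"] by simp
      qed
      then show "\<omega> \<in> (\<Union>k\<in>UNIV. {\<omega> \<in> space M. a \<le> \<bar>score n \<omega> $ k\<bar>})" using \<omega> by auto
    qed
    then have "prob {\<omega> \<in> space M. ?d * a < norm (score n \<omega>)} \<le> prob (\<Union>k\<in>UNIV. {\<omega> \<in> space M. a \<le> \<bar>score n \<omega> $ k\<bar>})"
      by (intro finite_measure_mono) measurable
    also have "\<dots> \<le> (\<Sum>k\<in>UNIV. prob {\<omega> \<in> space M. a \<le> \<bar>score n \<omega> $ k\<bar>})"
      by (intro measure_UNION_le) (auto intro: measurable)
    also have "\<dots> \<le> (\<Sum>k\<in>(UNIV :: 'd set). e / ?d)" by (intro sum_mono comp n)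
    also have "\<dots> = e" by simp
    finally show ?thesis .
  qed
  then have "\<forall>\<^sub>F n in sequentially. prob {\<omega> \<in> space M. ?d * a < norm (score n \<omega>)} \<le> e"
    by (auto simp: eventually_sequentially intro!: exI[of _ 1])
  then show ?thesis by blast
qed

definition loss_increment :: "nat \<Rightarrow> 'a \<Rightarrow> real^'d \<Rightarrow> real" where
  "loss_increment n \<omega> h = (\<Sum>i=1..n. check_loss \<tau> (Z i \<omega> - (X i /\<^sub>R sqrt n) \<bullet> h) - check_loss \<tau> (Z i \<omega>))"

lemma loss_increment_expansion: "loss_increment n \<omega> h = - (score n \<omega> \<bullet> h) + remainder_sum h n \<omega>"
proof -
  have "loss_increment n \<omega> h = (\<Sum>i=1..n. - (X i \<bullet> h / sqrt n) * (\<tau> - indicator {..0} (Z i \<omega>)) + loss_remainder (Z i \<omega>) (X i \<bullet> h / sqrt n))"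
    by (simp add: loss_increment_def check_loss_diff divide_inverse mult.commute)
  then show ?thesis
    by (simp add: remainder_sum_def score_def sum.distrib sum_subtractf inner_sum_left sum_negf sum_divide_distrib mult_ac)
qed

lemma convex_loss_increment: "convex_on UNIV (loss_increment n \<omega>)"
  unfolding loss_increment_def[abs_def]
proof (rule convex_on_sum_functions)
  fix i
  have "convex_on UNIV (\<lambda>h. check_loss \<tau> (Z i \<omega> - (X i /\<^sub>R sqrt n) \<bullet> h) + - check_loss \<tau> (Z i \<omega>))"
    by (intro convex_on_add convex_on_check_loss) (simp add: convex_on_const)
  then show "convex_on UNIV (\<lambda>h. check_loss \<tau> (Z i \<omega> - (X i /\<^sub>R sqrt n) \<bullet> h) - check_loss \<tau> (Z i \<omega>))" by simp
qed

lemma loss_increment_0: "loss_increment n \<omega> 0 = 0"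
  by (simp add: loss_increment_def)

end

section \<open>Local posteriors\<close>

text \<open>A supremum of reals carries information only for a bounded family, so every estimate of
  \<open>tv_dist\<close> from below needs this.\<close>

lemma bdd_above_measure_diff:
  assumes "prob_space P" "prob_space Q"
  shows "bdd_above ((\<lambda>B. \<bar>measure P B - measure Q B\<bar>) ` A)"
proof (rule bdd_aboveI2)
  fix B
  show "\<bar>measure P B - measure Q B\<bar> \<le> 1"
    using prob_space.prob_le_1[OF assms(1), of B] prob_space.prob_le_1[OF assms(2), of B]
      measure_nonneg[of P B] measure_nonneg[of Q B] unfolding abs_le_iff by linarith
qed

lemma tv_dist_triangle:
  fixes P Q R :: "'b::topological_space measure"
  assumes P: "prob_space P" "prob_space Q" "prob_space R"
  shows "tv_dist P R \<le> tv_dist P Q + tv_dist Q R"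
proof (rule cSUP_least)
  fix B :: "'b set" assume B: "B \<in> sets borel"
  have "\<bar>measure P B - measure R B\<bar> \<le> \<bar>measure P B - measure Q B\<bar> + \<bar>measure Q B - measure R B\<bar>" by linarith
  also have "\<dots> \<le> tv_dist P Q + tv_dist Q R"
    using B P by (intro add_mono cSUP_upper bdd_above_measure_diff)
  finally show "\<bar>measure P B - measure R B\<bar> \<le> tv_dist P Q + tv_dist Q R" .
qed auto

lemma tv_dist_nonneg:
  assumes "prob_space P" "prob_space Q"
  shows "0 \<le> tv_dist P Q"
  by (rule cSUP_upper2[OF bdd_above_measure_diff[OF assms], of "{}"]) auto

lemma tv_dist_commute:
  "tv_dist P Q = tv_dist Q P"
  by (simp add: abs_minus_commute)

text \<open>Translation does not change the mass of the kernel, so pointwise convergence of the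
  kernels is enough for Scheffe's lemma.\<close>

lemma mvnormal_mean_continuous:
  fixes A :: "real^'n^'n"
  assumes A: "pos_def A" and lim: "\<mu>' \<longlonglongrightarrow> \<mu>"
  shows "(\<lambda>k. tv_dist (mvnormal (\<mu>' k) A) (mvnormal \<mu> A)) \<longlonglongrightarrow> 0"
proof -
  let ?g = "\<lambda>m. gauss_kernel m (matrix_inv A)"
  note u = unnorm_density_gauss_kernel[OF A]
  have shift: "(\<integral>x. ?g m x \<partial>lborel) = (\<integral>x. ?g 0 x \<partial>lborel)" for m
    using lborel_scale(1)[of 1 "?g m" m] by (simp add: gauss_kernel_def)
  have g: "(\<lambda>k. ?g (\<mu>' k) x) \<longlonglongrightarrow> ?g \<mu> x" for x
    unfolding gauss_kernel_def by (intro tendsto_intros tendsto_matrix_vector_mult lim) simp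
  have "(\<integral>x. ?g (\<mu>' k) x \<partial>lborel) = (\<integral>x. ?g \<mu> x \<partial>lborel)" for k
    by (rule trans[OF shift shift[symmetric]])
  then have "(\<lambda>k. \<integral>x. ?g (\<mu>' k) x \<partial>lborel) \<longlonglongrightarrow> (\<integral>x. ?g \<mu> x \<partial>lborel)" by simp
  from integral_abs_diff_normalized_tendsto_0[OF u u g this]
  have "(\<lambda>k. \<integral>x. \<bar>?g (\<mu>' k) x / (\<integral>y. ?g (\<mu>' k) y \<partial>lborel) - ?g \<mu> x / (\<integral>y. ?g \<mu> y \<partial>lborel)\<bar> \<partial>lborel) \<longlonglongrightarrow> 0" .
  then show ?thesis
    unfolding mvnormal_eq_normalized[OF A] tv_dist_normalized[OF u u]
    using tendsto_divide[OF _ tendsto_const[of 2]] by force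
qed

text \<open>A supremum over uncountably many sets is not visibly measurable in the parameter; its L1
  formula is a parametrised integral and therefore is.\<close>

lemma tv_dist_normalized_measurable:
  fixes u v :: "'a \<Rightarrow> 'b::euclidean_space \<Rightarrow> real"
  assumes [measurable]: "case_prod u \<in> borel_measurable (M \<Otimes>\<^sub>M lborel)" "case_prod v \<in> borel_measurable (M \<Otimes>\<^sub>M lborel)"
    and u: "\<And>\<omega>. \<omega> \<in> space M \<Longrightarrow> unnorm_density (u \<omega>)" and v: "\<And>\<omega>. \<omega> \<in> space M \<Longrightarrow> unnorm_density (v \<omega>)"
  shows "(\<lambda>\<omega>. tv_dist (normalized (u \<omega>)) (normalized (v \<omega>))) \<in> borel_measurable M"
proof -
  have "(\<lambda>\<omega>. (\<integral>x. \<bar>u \<omega> x / mass (u \<omega>) - v \<omega> x / mass (v \<omega>)\<bar> \<partial>lborel) / 2) \<in> borel_measurable M"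
    by measurable
  then show ?thesis
    by (rule measurable_cong[THEN iffD1, rotated]) (simp add: tv_dist_normalized u v)
qed

lemma
  fixes u :: "'a \<Rightarrow> real^'n \<Rightarrow> real"
  assumes [measurable]: "case_prod u \<in> borel_measurable (M \<Otimes>\<^sub>M lborel)"
    and u: "\<And>\<omega>. \<omega> \<in> space M \<Longrightarrow> unnorm_density (u \<omega>)"
  shows mean_vec_normalized_measurable: "(\<lambda>\<omega>. mean_vec (normalized (u \<omega>))) \<in> borel_measurable M" (is ?g1)
    and cov_mat_normalized_measurable: "(\<lambda>\<omega>. cov_mat (normalized (u \<omega>))) \<in> borel_measurable M" (is ?g2)
proof -
  have "(\<lambda>\<omega>. (1 / mass (u \<omega>)) *\<^sub>R (\<integral>x. u \<omega> x *\<^sub>R x \<partial>lborel)) \<in> borel_measurable M"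
    by measurable
  then show m [measurable]: ?g1
    by (rule measurable_cong[THEN iffD1, rotated]) (simp add: mean_vec_def integral_normalized u)
  show ?g2
  proof (intro borel_measurable_vecI)
    fix i j
    have "(\<lambda>\<omega>. (1 / mass (u \<omega>)) *\<^sub>R (\<integral>x. u \<omega> x *\<^sub>R ((x $ i - mean_vec (normalized (u \<omega>)) $ i) * (x $ j - mean_vec (normalized (u \<omega>)) $ j)) \<partial>lborel)) \<in> borel_measurable M"
      by measurable
    then show "(\<lambda>\<omega>. cov_mat (normalized (u \<omega>)) $ i $ j) \<in> borel_measurable M"
      by (rule measurable_cong[THEN iffD1, rotated]) (simp add: cov_mat_def integral_normalized u)
  qed
qed

lemma integral_pos_of_continuous:
  fixes u :: "'b::euclidean_space \<Rightarrow> real"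
  assumes cont: "continuous_on UNIV u" and nn: "\<And>x. 0 \<le> u x" and int: "integrable lborel u" and pos: "0 < u a"
  shows "0 < mass u"
proof (rule ccontr)
  assume "\<not> ?thesis"
  then have "mass u = 0" using nn by (simp add: not_less order_antisym)
  then have "AE x in lborel. u x = 0" using nn int by (subst (asm) integral_nonneg_eq_0_iff_AE) auto
  then show False using AE_eq_0_continuous[OF cont] pos by (metis less_irrefl)
qed

lemma unnorm_density_rescale:
  assumes u: "unnorm_density u" and eq: "\<And>x. u x = k * v x" and k: "0 < k"
  shows "unnorm_density v" "normalized u = normalized v"
proof -
  have v: "v = (\<lambda>x. (1 / k) * u x)" using eq k by (auto simp: fun_eq_iff)
  show "unnorm_density v" unfolding v using k by (intro unnorm_density_scale u) simp
  show "normalized u = normalized v" unfolding v using k by (intro normalized_scale[symmetric]) simp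
qed

lemma second_moment_rescale:
  assumes u: "second_moment u" and eq: "\<And>x. u x = k * v x" and k: "0 < k"
  shows "second_moment v"
proof -
  have v: "v = (\<lambda>x. (1 / k) * u x)" using eq k by (auto simp: fun_eq_iff)
  have "integrable lborel (\<lambda>x. (1 / k) * ((norm x)\<^sup>2 * u x))" using u unfolding second_moment_def by (rule integrable_mult_right)
  then show ?thesis unfolding second_moment_def v by (simp add: mult_ac)
qed

section \<open>Posteriors in the local parameter\<close>

context quantile_model
begin

lemma prior_measurable [measurable]: "\<pi> \<in> borel_measurable borel"
  using prior(4) by (rule borel_measurable_continuous_onI)

lemma prior_integrable: "integrable lborel \<pi>"
  using prior(1,2) by (intro integrableI_nonneg) auto

lemma prior_bound: obtains K where "\<And>\<beta>. \<pi> \<beta> \<le> K"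
  using prior(3) unfolding bounded_iff by (auto simp: abs_le_iff)

text \<open>A bounded likelihood inherits integrability and the second moment from the prior; the
  mass is positive because the product is continuous and positive at
  \<open>\<beta>0\<close>.\<close>

lemma prior_times_likelihood:
  assumes L: "continuous_on UNIV L" "\<And>\<beta>. 0 < L \<beta>" "\<And>\<beta>. L \<beta> \<le> B"
  shows "unnorm_density (\<lambda>\<beta>. L \<beta> * \<pi> \<beta>)" (is ?g1) "second_moment (\<lambda>\<beta>. L \<beta> * \<pi> \<beta>)" (is ?g2) "continuous_on UNIV (\<lambda>\<beta>. L \<beta> * \<pi> \<beta>)" (is ?g3)
proof -
  have [measurable]: "L \<in> borel_measurable borel" using L(1) by (rule borel_measurable_continuous_onI)
  show cont: ?g3 by (intro continuous_intros L prior)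
  have bound: "\<bar>L \<beta> * \<pi> \<beta>\<bar> \<le> B * \<pi> \<beta>" for \<beta>
    using L(2)[of \<beta>] L(3)[of \<beta>] prior(1)[of \<beta>] by (simp add: abs_mult mult_right_mono)
  have int: "integrable lborel (\<lambda>\<beta>. L \<beta> * \<pi> \<beta>)"
    by (rule Bochner_Integration.integrable_bound[OF integrable_mult_right[OF prior_integrable, of B]])
       (use bound in \<open>auto intro!: AE_I2 intro: order_trans[OF _ abs_ge_self]\<close>)
  have nn: "0 \<le> L \<beta> * \<pi> \<beta>" for \<beta> using L(2)[of \<beta>] prior(1)[of \<beta>] by (intro mult_nonneg_nonneg) auto
  show ?g1
    unfolding unnorm_density_def
    using nn int integral_pos_of_continuous[OF cont nn int, of \<beta>0] L(2)[of \<beta>0] prior(5) by simp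
  have "integrable lborel (\<lambda>\<beta>. (norm \<beta>)\<^sup>2 * \<pi> \<beta>)"
    using prior_second_moment prior(1) by (intro integrableI_nonneg) auto
  then have "integrable lborel (\<lambda>\<beta>. B * ((norm \<beta>)\<^sup>2 * \<pi> \<beta>))" by (rule integrable_mult_right)
  then show ?g2
    unfolding second_moment_def
  proof (rule Bochner_Integration.integrable_bound)
    have "norm ((norm \<beta>)\<^sup>2 * (L \<beta> * \<pi> \<beta>)) \<le> norm (B * ((norm \<beta>)\<^sup>2 * \<pi> \<beta>))" for \<beta>
    proof -
      have "norm ((norm \<beta>)\<^sup>2 * (L \<beta> * \<pi> \<beta>)) = (norm \<beta>)\<^sup>2 * \<bar>L \<beta> * \<pi> \<beta>\<bar>" by (simp add: abs_mult)
      also have "\<dots> \<le> (norm \<beta>)\<^sup>2 * (B * \<pi> \<beta>)" by (intro mult_left_mono bound) simp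
      finally show ?thesis by (simp add: mult_ac)
    qed
    then show "AE \<beta> in lborel. norm ((norm \<beta>)\<^sup>2 * (L \<beta> * \<pi> \<beta>)) \<le> norm (B * ((norm \<beta>)\<^sup>2 * \<pi> \<beta>))" by simp
  qed measurable
qed

text \<open>The posterior density at \<open>\<beta>0 + h /\<^sub>R sqrt n\<close>, divided by the
  likelihood at \<open>\<beta>0\<close>. The divisor does not depend on \<open>h\<close>, so the
  normalized law is that of the local parameter.\<close>

definition local_density :: "nat \<Rightarrow> 'a \<Rightarrow> real^'d \<Rightarrow> real" where
  "local_density n \<omega> h = exp (- loss_increment n \<omega> h) * \<pi> (\<beta>0 + h /\<^sub>R sqrt n)"

lemma ald_likelihood_bounds:
  "continuous_on UNIV (ald_likelihood \<tau> X n y)" "0 < ald_likelihood \<tau> X n y \<beta>" "ald_likelihood \<tau> X n y \<beta> \<le> 1"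
proof -
  show "continuous_on UNIV (ald_likelihood \<tau> X n y)"
    unfolding ald_likelihood_def[abs_def] by (intro continuous_intros continuous_on_check_loss)
  show "0 < ald_likelihood \<tau> X n y \<beta>" unfolding ald_likelihood_def using tau by (intro prod_pos) auto
  show "ald_likelihood \<tau> X n y \<beta> \<le> 1" unfolding ald_likelihood_def
  proof (rule prod_le_1)
    fix i
    have "\<tau> * (1 - \<tau>) * exp (- check_loss \<tau> (y i - X i \<bullet> \<beta>)) \<le> 1 * 1 * 1"
      using tau check_loss_nonneg[OF tau] by (intro mult_mono) auto
    then show "0 \<le> \<tau> * (1 - \<tau>) * exp (- check_loss \<tau> (y i - X i \<bullet> \<beta>)) \<and> \<tau> * (1 - \<tau>) * exp (- check_loss \<tau> (y i - X i \<bullet> \<beta>)) \<le> 1"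
      using tau by simp
  qed
qed

lemma ald_likelihood_local:
  assumes n: "1 \<le> n"
  obtains k where "0 < k" "\<And>h. ald_likelihood \<tau> X n (\<lambda>i. Y i \<omega>) (\<beta>0 + h /\<^sub>R sqrt n) = k * exp (- loss_increment n \<omega> h)"
proof -
  define k where "k = (\<Prod>i=1..n. \<tau> * (1 - \<tau>) * exp (- check_loss \<tau> (Z i \<omega>)))"
  have "ald_likelihood \<tau> X n (\<lambda>i. Y i \<omega>) (\<beta>0 + h /\<^sub>R sqrt n) = k * exp (- loss_increment n \<omega> h)" for h
  proof -
    have "exp (- loss_increment n \<omega> h) = (\<Prod>i=1..n. exp (- (check_loss \<tau> (Z i \<omega> - (X i /\<^sub>R sqrt n) \<bullet> h) - check_loss \<tau> (Z i \<omega>))))"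
      by (simp add: loss_increment_def flip: exp_sum sum_negf)
    then have "k * exp (- loss_increment n \<omega> h) = (\<Prod>i=1..n. \<tau> * (1 - \<tau>) * exp (- check_loss \<tau> (Z i \<omega> - (X i /\<^sub>R sqrt n) \<bullet> h)))"
      unfolding k_def by (simp flip: prod.distrib exp_add add: mult.assoc)
    also have "\<dots> = ald_likelihood \<tau> X n (\<lambda>i. Y i \<omega>) (\<beta>0 + h /\<^sub>R sqrt n)"
      by (simp add: ald_likelihood_def Z_def inner_add_right diff_diff_eq)
    finally show ?thesis ..
  qed
  moreover have "0 < k" unfolding k_def using tau by (intro prod_pos) auto
  ultimately show ?thesis using that by blast
qed

lemma ald_posterior_normalized:
  "ald_posterior \<tau> X \<pi> n y = normalized (\<lambda>\<beta>. ald_likelihood \<tau> X n y \<beta> * \<pi> \<beta>)"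
  unfolding ald_posterior_def
  by (rule posterior_eq_normalized[OF prior_times_likelihood(1)[OF ald_likelihood_bounds]])

abbreviation (input) obs :: "'a \<Rightarrow> nat \<Rightarrow> real" where "obs \<omega> \<equiv> \<lambda>i. Y i \<omega>"

lemma measure_local:
  assumes "unnorm_density u" "1 \<le> n" "B \<in> sets borel"
  shows "measure (normalized u) {\<beta>. sqrt (real n) *\<^sub>R (\<beta> - \<beta>0) \<in> B} = measure (normalized (\<lambda>h. u (\<beta>0 + h /\<^sub>R sqrt n))) B"
proof -
  have c: "0 < sqrt (real n)" using assms(2) by simp
  show ?thesis
    unfolding distr_normalized_affine[OF assms(1) c, of \<beta>0, symmetric]
    using assms(3) by (subst measure_distr) (auto simp: vimage_def)
qed

lemma local_density_facts:
  assumes n: "1 \<le> n"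
  shows "unnorm_density (local_density n \<omega>)" (is ?g1) "second_moment (local_density n \<omega>)" (is ?g2) "continuous_on UNIV (local_density n \<omega>)" (is ?g3)
    and "B \<in> sets borel \<Longrightarrow> measure (ald_posterior \<tau> X \<pi> n (obs \<omega>)) {\<beta>. sqrt (real n) *\<^sub>R (\<beta> - \<beta>0) \<in> B} = measure (normalized (local_density n \<omega>)) B"
    and "sqrt (real n) *\<^sub>R (beta_tilde \<tau> X \<pi> n (obs \<omega>) - \<beta>0) = mean_vec (normalized (local_density n \<omega>))" (is ?g4)
    and "V_post \<tau> X \<pi> n (obs \<omega>) = matrix_inv (cov_mat (normalized (local_density n \<omega>)))" (is ?g5)
proof -
  let ?u = "\<lambda>\<beta>. ald_likelihood \<tau> X n (obs \<omega>) \<beta> * \<pi> \<beta>"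
  note u = prior_times_likelihood[OF ald_likelihood_bounds, of n "obs \<omega>"]
  have c: "0 < sqrt (real n)" using n by simp
  obtain k where k: "0 < k" "\<And>h. ald_likelihood \<tau> X n (obs \<omega>) (\<beta>0 + h /\<^sub>R sqrt n) = k * exp (- loss_increment n \<omega> h)"
    using ald_likelihood_local[OF n] by blast
  have eq: "?u (\<beta>0 + h /\<^sub>R sqrt n) = k * local_density n \<omega> h" for h
    by (simp add: k(2) local_density_def)
  note scaled = unnorm_density_rescale[OF unnorm_density_affine[OF u(1) c] eq k(1)]
  show ?g1 by (rule scaled(1))
  show ?g2
    by (rule second_moment_rescale[OF second_moment_affine[OF u(1,2) c] eq k(1)])
  have ld: "local_density n \<omega> = (\<lambda>h. (1 / k) * ?u (\<beta>0 + h /\<^sub>R sqrt n))"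
    unfolding eq using k(1) by (simp add: fun_eq_iff)
  show ?g3
    unfolding ld by (intro continuous_intros continuous_on_compose2[OF ald_likelihood_bounds(1)] continuous_on_compose2[OF prior(4)]) auto
  show "measure (ald_posterior \<tau> X \<pi> n (obs \<omega>)) {\<beta>. sqrt (real n) *\<^sub>R (\<beta> - \<beta>0) \<in> B} = measure (normalized (local_density n \<omega>)) B"
    if "B \<in> sets borel"
    unfolding ald_posterior_normalized measure_local[OF u(1) n that] scaled(2) ..
  show ?g4
    unfolding beta_tilde_def ald_posterior_normalized scaled(2)[symmetric] by (rule mean_vec_affine[OF u(1,2) c, symmetric])
  \<comment> \<open>The factor \<open>n\<close> in the definition of \<open>V_post\<close> is the
    square of the scale sqrt n, so \<open>V_post\<close> is the inverse covariance of the local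
    parameter.\<close>
  show ?g5
    unfolding V_post_def ald_posterior_normalized scaled(2)[symmetric] cov_mat_affine[OF u(1,2) c] by simp
qed

definition local_mean :: "nat \<Rightarrow> 'a \<Rightarrow> real^'d" where
  "local_mean n \<omega> = mean_vec (normalized (local_density n \<omega>))"

definition local_cov :: "nat \<Rightarrow> 'a \<Rightarrow> real^'d^'d" where
  "local_cov n \<omega> = cov_mat (normalized (local_density n \<omega>))"

definition local_Sigma :: "nat \<Rightarrow> 'a \<Rightarrow> real^'d^'d" where
  "local_Sigma n \<omega> = sandwich \<tau> (matrix_inv (local_cov n \<omega>)) (S_emp X n)"

text \<open>The value at the origin is subtracted to meet the normalisation required by
  \<open>gauss_limit\<close>; it is constant in \<open>h\<close> and disappears on
  normalising.\<close>

definition sandwich_exponent :: "nat \<Rightarrow> 'a \<Rightarrow> real^'d \<Rightarrow> real" where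
  "sandwich_exponent n \<omega> h = (h - local_mean n \<omega>) \<bullet> (matrix_inv (local_Sigma n \<omega>) *v (h - local_mean n \<omega>)) / 2
     - (0 - local_mean n \<omega>) \<bullet> (matrix_inv (local_Sigma n \<omega>) *v (0 - local_mean n \<omega>)) / 2"

definition sandwich_density :: "nat \<Rightarrow> 'a \<Rightarrow> real^'d \<Rightarrow> real" where
  "sandwich_density n \<omega> h = exp (- sandwich_exponent n \<omega> h) * \<pi> (\<beta>0 + h /\<^sub>R sqrt n)"

lemma pos_def_local_cov: "1 \<le> n \<Longrightarrow> pos_def (local_cov n \<omega>)"
  unfolding local_cov_def by (rule pos_def_cov_mat) (rule local_density_facts, assumption)+

lemma pos_def_local_Sigma: "1 \<le> n \<Longrightarrow> pos_def (S_emp X n) \<Longrightarrow> pos_def (local_Sigma n \<omega>)"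
  unfolding local_Sigma_def by (intro pos_def_sandwich pos_def_matrix_inv pos_def_local_cov tau)

text \<open>Positive definiteness of \<open>S_emp X n\<close> passes to the sandwich matrix, so the
  sandwich likelihood has a positive prefactor and a nonnegative form in its exponent. It is
  therefore positive, continuous and bounded, which is all that the prior requires of it.\<close>

lemma sandwich_density_facts:
  assumes n: "1 \<le> n" and S: "pos_def (S_emp X n)"
  shows "unnorm_density (sandwich_density n \<omega>)" (is ?g1) "second_moment (sandwich_density n \<omega>)" (is ?g2)
    and "B \<in> sets borel \<Longrightarrow> measure (sandwich_posterior \<tau> X \<pi> n (obs \<omega>)) {\<beta>. sqrt (real n) *\<^sub>R (\<beta> - \<beta>0) \<in> B} = measure (normalized (sandwich_density n \<omega>)) B"
proof -
  let ?y = "obs \<omega>"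
  let ?L = "sandwich_likelihood \<tau> X \<pi> n ?y" and ?P = "matrix_inv (local_Sigma n \<omega>)"
  let ?m = "local_mean n \<omega>" and ?b = "beta_tilde \<tau> X \<pi> n ?y"
  have Sigma: "Sigma_post \<tau> X \<pi> n ?y = local_Sigma n \<omega>"
    by (simp add: Sigma_post_def local_Sigma_def local_cov_def local_density_facts(6)[OF n])
  have m: "?m = sqrt (real n) *\<^sub>R (?b - \<beta>0)"
    by (simp only: local_mean_def local_density_facts(5)[OF n])
  note pdS = pos_def_local_Sigma[OF n S, of \<omega>]
  have pd: "pos_def ?P" by (rule pos_def_matrix_inv[OF pdS])
  define \<kappa> where "\<kappa> = 1 / sqrt (det ((1 / real n) *\<^sub>R local_Sigma n \<omega>))"
  have \<kappa>: "0 < \<kappa>" unfolding \<kappa>_def using n pos_def_det_pos[OF pos_def_scaleR[OF pdS, of "1 / real n"]] by simp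
  have L: "?L \<beta> = \<kappa> * exp (- (real n / 2) * ((?b - \<beta>) \<bullet> (?P *v (?b - \<beta>))))" for \<beta>
    by (simp add: sandwich_likelihood_def Sigma \<kappa>_def)
  have Lb: "continuous_on UNIV ?L" "0 < ?L \<beta>" "?L \<beta> \<le> \<kappa>" for \<beta>
  proof -
    show "continuous_on UNIV ?L"
      unfolding L[abs_def]
      by (intro continuous_intros continuous_on_compose2[OF matrix_vector_mult_linear_continuous_on]) auto
    show "0 < ?L \<beta>" using \<kappa> by (simp add: L)
    have "0 \<le> (?b - \<beta>) \<bullet> (?P *v (?b - \<beta>))"
      using pos_defD(2)[OF pd, of "?b - \<beta>"] by (cases "?b - \<beta> = 0") auto
    then show "?L \<beta> \<le> \<kappa>" using \<kappa> by (simp add: L)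
  qed
  note u = prior_times_likelihood[OF Lb]
  have c: "0 < sqrt (real n)" using n by simp
  \<comment> \<open>The sandwich likelihood at \<open>\<beta>0\<close>: its exponential is the
    constant subtracted in \<open>sandwich_exponent\<close>.\<close>
  define k where "k = \<kappa> * exp (- ((0 - ?m) \<bullet> (?P *v (0 - ?m)) / 2))"
  have k: "0 < k" using \<kappa> by (simp add: k_def)
  have eq: "?L (\<beta>0 + h /\<^sub>R sqrt n) * \<pi> (\<beta>0 + h /\<^sub>R sqrt n) = k * sandwich_density n \<omega> h" for h
  proof -
    define q where "q = h - ?m"
    have d: "?b - (\<beta>0 + h /\<^sub>R sqrt n) = (- 1 / sqrt n) *\<^sub>R q"
      using c by (simp add: q_def m algebra_simps scaleR_diff_right inverse_eq_divide)
    have "(real n / 2) * ((?b - (\<beta>0 + h /\<^sub>R sqrt n)) \<bullet> (?P *v (?b - (\<beta>0 + h /\<^sub>R sqrt n)))) = q \<bullet> (?P *v q) / 2"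
      unfolding d matrix_vector_mult_scaleR using n by simp
    then have "(real n / 2) * ((?b - (\<beta>0 + h /\<^sub>R sqrt n)) \<bullet> (?P *v (?b - (\<beta>0 + h /\<^sub>R sqrt n)))) = (h - ?m) \<bullet> (?P *v (h - ?m)) / 2"
      by (simp only: q_def)
    then show ?thesis
      by (simp add: L k_def sandwich_density_def sandwich_exponent_def flip: exp_add)
  qed
  note scaled = unnorm_density_rescale[OF unnorm_density_affine[OF u(1) c] eq k]
  show ?g1 by (rule scaled(1))
  show ?g2
    by (rule second_moment_rescale[OF second_moment_affine[OF u(1,2) c] eq k])
  show "measure (sandwich_posterior \<tau> X \<pi> n ?y) {\<beta>. sqrt (real n) *\<^sub>R (\<beta> - \<beta>0) \<in> B} = measure (normalized (sandwich_density n \<omega>)) B"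
    if "B \<in> sets borel"
    unfolding sandwich_posterior_def posterior_eq_normalized[OF u(1)] measure_local[OF u(1) n that] scaled(2) ..
qed

lemma local_density_measurable: "case_prod (local_density n) \<in> borel_measurable (M \<Otimes>\<^sub>M lborel)"
proof -
  have "(\<lambda>x. check_loss \<tau> (Z i (fst x) - (X i /\<^sub>R sqrt n) \<bullet> snd x) - check_loss \<tau> (Z i (fst x))) \<in> borel_measurable (M \<Otimes>\<^sub>M lborel)"
    if "i \<in> {1..n}" for i
  proof -
    have [measurable]: "Z i \<in> borel_measurable M" using Z_measurable that by simp
    show ?thesis by measurable
  qed
  then have [measurable]: "(\<lambda>x. loss_increment n (fst x) (snd x)) \<in> borel_measurable (M \<Otimes>\<^sub>M lborel)"
    unfolding loss_increment_def by (rule borel_measurable_sum)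
  show ?thesis unfolding local_density_def[abs_def] split_beta' by measurable
qed

lemma local_mean_measurable [measurable]: "1 \<le> n \<Longrightarrow> local_mean n \<in> borel_measurable M"
  unfolding local_mean_def[abs_def]
  by (rule mean_vec_normalized_measurable[OF local_density_measurable]) (rule local_density_facts)

lemma local_cov_measurable [measurable]: "1 \<le> n \<Longrightarrow> local_cov n \<in> borel_measurable M"
  unfolding local_cov_def[abs_def]
  by (rule cov_mat_normalized_measurable[OF local_density_measurable]) (rule local_density_facts)

text \<open>The inverse of the inverse covariance is the covariance again, so the matrix is a
  polynomial in measurable entries.\<close>

lemma local_Sigma_eq: "1 \<le> n \<Longrightarrow> local_Sigma n \<omega> = (\<tau> * (1 - \<tau>)) *\<^sub>R (local_cov n \<omega> ** S_emp X n ** local_cov n \<omega>)"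
  unfolding local_Sigma_def sandwich_def
  by (simp add: matrix_inv_matrix_inv pos_def_invertible[OF pos_def_local_cov])

lemma sandwich_density_measurable:
  assumes n: "1 \<le> n" and S: "pos_def (S_emp X n)"
  shows "case_prod (sandwich_density n) \<in> borel_measurable (M \<Otimes>\<^sub>M lborel)"
proof -
  note [measurable] = local_mean_measurable[OF n] local_cov_measurable[OF n]
  have "local_Sigma n \<in> borel_measurable M"
    unfolding local_Sigma_eq[OF n, abs_def] by measurable
  then have [measurable]: "(\<lambda>\<omega>. matrix_inv (local_Sigma n \<omega>)) \<in> borel_measurable M"
    by (rule borel_measurable_matrix_inv) (rule pos_def_invertible[OF pos_def_local_Sigma[OF n S]])
  show ?thesis unfolding sandwich_density_def[abs_def] sandwich_exponent_def[abs_def] split_beta' by measurable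
qed

lemma gauss_kernel_local_mean_measurable:
  assumes n: "1 \<le> n"
  shows "case_prod (\<lambda>\<omega>. gauss_kernel (local_mean n \<omega>) P) \<in> borel_measurable (M \<Otimes>\<^sub>M lborel)"
proof -
  note [measurable] = local_mean_measurable[OF n]
  show ?thesis unfolding gauss_kernel_def[abs_def] split_beta' by measurable
qed

section \<open>Limits along sequences and return to convergence in probability\<close>

text \<open>The deterministic core: the points \<open>\<omega> k\<close> are arbitrary, and
  randomness enters only through the two assumed limits. The first conclusion comes with limits of
  the mean and covariance, which feed the second.\<close>

lemma sequence_limits:
  assumes D: "simplex_dense D" and r: "filterlim r at_top sequentially" and r1: "\<And>k. 1 \<le> r k"
    and S: "\<And>k. pos_def (S_emp X (r k))"
    and w: "(\<lambda>k. score (r k) (\<omega> k)) \<longlonglongrightarrow> w"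
    and rem: "\<And>d. d \<in> D \<Longrightarrow> (\<lambda>k. remainder_sum d (r k) (\<omega> k) - d \<bullet> (V *v d) / 2) \<longlonglongrightarrow> 0"
  shows "(\<lambda>k. tv_dist (normalized (local_density (r k) (\<omega> k))) (mvnormal (local_mean (r k) (\<omega> k)) (matrix_inv V))) \<longlonglongrightarrow> 0"
    and "(\<lambda>k. tv_dist (normalized (sandwich_density (r k) (\<omega> k))) (mvnormal (local_mean (r k) (\<omega> k)) (sandwich \<tau> V S))) \<longlonglongrightarrow> 0"
proof -
  \<comment> \<open>Completing the square: -w.d + d.Vd / 2 is half of (d - mu).V(d - mu) - mu.V mu
    exactly when V mu = w.\<close>
  define \<mu> where "\<mu> = matrix_inv V *v w"
  have V\<mu>: "V *v \<mu> = w" by (simp add: \<mu>_def matrix_inv_mult_vec[OF V_inv])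
  let ?A = "matrix_inv V" and ?\<Sigma> = "sandwich \<tau> V S"
  have A: "pos_def ?A" by (rule pos_def_matrix_inv[OF pos_def_V])
  have invA: "matrix_inv ?A = V" by (rule matrix_inv_matrix_inv[OF V_inv])
  have \<Sigma>: "pos_def ?\<Sigma>" by (rule pos_def_sandwich[OF pos_def_V pos_def_S tau])
  obtain K where K: "\<And>\<beta>. \<pi> \<beta> \<le> K" using prior_bound by blast
  have "(\<lambda>k. \<beta>0 + h /\<^sub>R sqrt (real (r k))) \<longlonglongrightarrow> \<beta>0 + 0 *\<^sub>R h" for h
  proof -
    have "(\<lambda>n. inverse (sqrt (real n))) \<longlonglongrightarrow> 0" by real_asymp
    then have "(\<lambda>k. inverse (sqrt (real (r k)))) \<longlonglongrightarrow> 0" using r by (rule filterlim_compose)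
    then show ?thesis by (intro tendsto_intros)
  qed
  then have g: "(\<lambda>k. \<pi> (\<beta>0 + h /\<^sub>R sqrt (real (r k)))) \<longlonglongrightarrow> \<pi> \<beta>0" for h
    using continuous_on_tendsto_compose[OF prior(4)] by force
  have lim: "(\<lambda>k. loss_increment (r k) (\<omega> k) d) \<longlonglongrightarrow> (d - \<mu>) \<bullet> (matrix_inv ?A *v (d - \<mu>)) / 2 - \<mu> \<bullet> (matrix_inv ?A *v \<mu>) / 2"
    if d: "d \<in> D" for d
  proof -
    have "(\<lambda>k. - (score (r k) (\<omega> k) \<bullet> d) + (remainder_sum d (r k) (\<omega> k) - d \<bullet> (V *v d) / 2) + d \<bullet> (V *v d) / 2)
       \<longlonglongrightarrow> - (w \<bullet> d) + 0 + d \<bullet> (V *v d) / 2"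
      by (intro tendsto_intros w rem d)
    moreover have "\<mu> \<bullet> (V *v d) = w \<bullet> d"
      using symmetric_matrix_inner[OF pos_defD(1)[OF pos_def_V], of \<mu> d] by (simp add: V\<mu>)
    then have "(d - \<mu>) \<bullet> (V *v (d - \<mu>)) / 2 - \<mu> \<bullet> (V *v \<mu>) / 2 = - (w \<bullet> d) + 0 + d \<bullet> (V *v d) / 2"
      by (simp add: matrix_vector_mult_diff_distrib inner_diff_left inner_diff_right V\<mu> inner_commute[of d w] diff_divide_distrib add_divide_distrib)
    ultimately show ?thesis unfolding loss_increment_expansion invA by simp
  qed
  note ald = gauss_limit[where f = "\<lambda>k. loss_increment (r k) (\<omega> k)" and g = "\<lambda>k h. \<pi> (\<beta>0 + h /\<^sub>R sqrt (real (r k)))",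
      OF D convex_loss_increment loss_increment_0 A lim prior(1) K g prior(5),
      folded local_density_def, OF _ local_density_facts(1)[OF r1] local_density_facts(2)[OF r1]]
  have mean: "(\<lambda>k. local_mean (r k) (\<omega> k)) \<longlonglongrightarrow> \<mu>"
    unfolding local_mean_def by (rule ald(1))
  have cov: "(\<lambda>k. local_cov (r k) (\<omega> k)) \<longlonglongrightarrow> ?A"
    unfolding local_cov_def by (rule ald(2))
  let ?m = "\<lambda>k. local_mean (r k) (\<omega> k)"
  \<comment> \<open>\<open>gauss_limit\<close> compares with the normal law at the limit
    \<open>\<mu>\<close>, the claim with the one at the moving posterior mean; since the mean tends
    to \<open>\<mu>\<close>, the triangle inequality joins them.\<close>
  have combine: "(\<lambda>k. tv_dist (normalized (u k)) (mvnormal (?m k) C)) \<longlonglongrightarrow> 0"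
    if C: "pos_def C" and u: "\<And>k. unnorm_density (u k)"
      and lim: "(\<lambda>k. tv_dist (normalized (u k)) (mvnormal \<mu> C)) \<longlonglongrightarrow> 0"
    for u :: "nat \<Rightarrow> real^'d \<Rightarrow> real" and C
  proof (rule tendsto_sandwich[OF _ _ tendsto_const])
    note P = prob_space_normalized[OF u] prob_space_mvnormal[OF C]
    show "\<forall>\<^sub>F k in sequentially. 0 \<le> tv_dist (normalized (u k)) (mvnormal (?m k) C)"
      by (intro always_eventually allI tv_dist_nonneg P)
    show "\<forall>\<^sub>F k in sequentially. tv_dist (normalized (u k)) (mvnormal (?m k) C)
       \<le> tv_dist (normalized (u k)) (mvnormal \<mu> C)
        + tv_dist (mvnormal \<mu> C) (mvnormal (?m k) C)"
      by (intro always_eventually allI tv_dist_triangle P)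
    show "(\<lambda>k. tv_dist (normalized (u k)) (mvnormal \<mu> C)
        + tv_dist (mvnormal \<mu> C) (mvnormal (?m k) C)) \<longlonglongrightarrow> 0"
      using tendsto_add[OF lim mvnormal_mean_continuous[OF C mean]]
      by (simp add: tv_dist_commute[of "mvnormal \<mu> C"])
  qed
  show "(\<lambda>k. tv_dist (normalized (local_density (r k) (\<omega> k))) (mvnormal (?m k) ?A)) \<longlonglongrightarrow> 0"
    by (rule combine[OF A local_density_facts(1)[OF r1] ald(3)])
  \<comment> \<open>Here the covariance of the misspecified posterior is used as an estimator: its
    inverse recovers \<open>V\<close>, and hence the empirical sandwich matrix recovers the correct
    covariance.\<close>
  have "(\<lambda>k. matrix_inv (local_cov (r k) (\<omega> k))) \<longlonglongrightarrow> V"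
    using tendsto_matrix_inv[OF cov pos_def_invertible[OF A]] by (simp add: invA)
  then have "(\<lambda>k. local_Sigma (r k) (\<omega> k)) \<longlonglongrightarrow> ?\<Sigma>"
    unfolding local_Sigma_def by (rule tendsto_sandwich_matrix[OF _ filterlim_compose[OF S_lim r] V_inv])
  then have P: "(\<lambda>k. matrix_inv (local_Sigma (r k) (\<omega> k))) \<longlonglongrightarrow> matrix_inv ?\<Sigma>"
    by (rule tendsto_matrix_inv) (rule pos_def_invertible[OF \<Sigma>])
  have neg: "(0 - \<mu>) \<bullet> (matrix_inv ?\<Sigma> *v (0 - \<mu>)) = \<mu> \<bullet> (matrix_inv ?\<Sigma> *v \<mu>)"
    using matrix_vector_mult_scaleR[of "matrix_inv ?\<Sigma>" "-1" \<mu>] by simp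
  have lim2: "(\<lambda>k. sandwich_exponent (r k) (\<omega> k) d) \<longlonglongrightarrow> (d - \<mu>) \<bullet> (matrix_inv ?\<Sigma> *v (d - \<mu>)) / 2 - \<mu> \<bullet> (matrix_inv ?\<Sigma> *v \<mu>) / 2" for d
    unfolding sandwich_exponent_def neg[symmetric] by (intro tendsto_intros tendsto_matrix_vector_mult P mean) auto
  have conv2: "convex_on UNIV (sandwich_exponent (r k) (\<omega> k))" for k
  proof -
    let ?P = "matrix_inv (local_Sigma (r k) (\<omega> k))"
    have "convex_on UNIV (\<lambda>h. (h - ?m k) \<bullet> (?P *v (h - ?m k)) / 2 + - ((0 - ?m k) \<bullet> (?P *v (0 - ?m k)) / 2))"
      by (intro convex_on_add convex_on_quadratic pos_def_matrix_inv pos_def_local_Sigma r1 S) (simp add: convex_on_const)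
    then show ?thesis by (simp add: sandwich_exponent_def[abs_def])
  qed
  have zero2: "sandwich_exponent (r k) (\<omega> k) 0 = 0" for k by (simp add: sandwich_exponent_def)
  note sandwich = gauss_limit[where f = "\<lambda>k. sandwich_exponent (r k) (\<omega> k)" and g = "\<lambda>k h. \<pi> (\<beta>0 + h /\<^sub>R sqrt (real (r k)))",
      OF D conv2 zero2 \<Sigma> lim2 prior(1) K g prior(5),
      folded sandwich_density_def, OF sandwich_density_facts(1)[OF r1 S] sandwich_density_facts(2)[OF r1 S]]
  show "(\<lambda>k. tv_dist (normalized (sandwich_density (r k) (\<omega> k))) (mvnormal (?m k) ?\<Sigma>)) \<longlonglongrightarrow> 0"
    by (rule combine[OF \<Sigma> sandwich_density_facts(1)[OF r1 S] sandwich(3)])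
qed

text \<open>The interface shared by the two claims. \<open>T\<close> has to agree with the local
  distance only where \<open>S_emp X n\<close> is positive definite, which holds from some
  \<open>N\<close> on. The limit is demanded for every \<open>simplex_dense\<close> set because the
  countable one is chosen inside the proof.\<close>

lemma tv_dist_tendsto_in_prob:
  assumes T: "\<And>n \<omega>. 1 \<le> n \<Longrightarrow> pos_def (S_emp X n) \<Longrightarrow> T n \<omega> = tv_dist (normalized (u n \<omega>)) (mvnormal (local_mean n \<omega>) C)"
    and C: "pos_def C"
    and u: "\<And>n. 1 \<le> n \<Longrightarrow> pos_def (S_emp X n) \<Longrightarrow> case_prod (u n) \<in> borel_measurable (M \<Otimes>\<^sub>M lborel)"
      "\<And>n \<omega>. 1 \<le> n \<Longrightarrow> pos_def (S_emp X n) \<Longrightarrow> unnorm_density (u n \<omega>)"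
    and lim: "\<And>D r \<omega> w. simplex_dense D \<Longrightarrow> filterlim r at_top sequentially \<Longrightarrow> (\<And>k. 1 \<le> r k) \<Longrightarrow>
      (\<And>k. pos_def (S_emp X (r k))) \<Longrightarrow> (\<lambda>k. score (r k) (\<omega> k)) \<longlonglongrightarrow> w \<Longrightarrow>
      (\<And>d. d \<in> D \<Longrightarrow> (\<lambda>k. remainder_sum d (r k) (\<omega> k) - d \<bullet> (V *v d) / 2) \<longlonglongrightarrow> 0) \<Longrightarrow>
      (\<lambda>k. tv_dist (normalized (u (r k) (\<omega> k))) (mvnormal (local_mean (r k) (\<omega> k)) C)) \<longlonglongrightarrow> 0"
  shows "tendsto_in_prob M T 0"
proof -
  obtain D :: "(real^'d) set" where D: "countable D" "simplex_dense D" by (rule countable_simplex_dense_exists)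
  obtain s where "s \<subseteq> D" "(0::real^'d) \<in> interior (convex hull s)"
    by (rule simplex_denseE[OF D(2) zero_less_one])
  then have D0: "D \<noteq> {}" by auto
  obtain N0 where N0: "\<And>n. N0 \<le> n \<Longrightarrow> pos_def (S_emp X n)"
    using eventually_pos_def_S_emp by (auto simp: eventually_sequentially)
  define N where "N = max 1 N0"
  have N: "1 \<le> n" "pos_def (S_emp X n)" if "N \<le> n" for n using that N0 by (auto simp: N_def)
  show ?thesis
  proof (rule tendsto_in_prob_via_sequences[where W = score and X = "\<lambda>d n \<omega>. remainder_sum d n \<omega> - d \<bullet> (V *v d) / 2" and N = N,
      OF _ score_measurable _ D(1) D0 score_tight remainder_sum_tendsto])
    fix n assume n: "N \<le> n"
    have "(\<lambda>\<omega>. tv_dist (normalized (u n \<omega>)) (mvnormal (local_mean n \<omega>) C)) \<in> borel_measurable M"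
      unfolding mvnormal_eq_normalized[OF C]
      by (intro tv_dist_normalized_measurable gauss_kernel_local_mean_measurable N[OF n] u unnorm_density_gauss_kernel C)
    then show "T n \<in> borel_measurable M"
      by (rule measurable_cong[THEN iffD2, rotated]) (rule T[OF N[OF n]])
  next
    fix r \<omega> w
    assume a: "filterlim r at_top sequentially" "\<And>k. N \<le> r k" "(\<lambda>k. score (r k) (\<omega> k)) \<longlonglongrightarrow> w"
      "\<And>d. d \<in> D \<Longrightarrow> (\<lambda>k. remainder_sum d (r k) (\<omega> k) - d \<bullet> (V *v d) / 2) \<longlonglongrightarrow> 0"
    show "(\<lambda>k. T (r k) (\<omega> k)) \<longlonglongrightarrow> 0"
      unfolding T[OF N[OF a(2)]] by (rule lim[OF D(2) a(1) N[OF a(2)] a(3,4)])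
  qed simp_all
qed

end

theorem theorem2:
  fixes M :: "'a measure"
    and \<tau> :: real
    and Y Z :: "nat \<Rightarrow> 'a \<Rightarrow> real"
    and p :: "nat \<Rightarrow> real \<Rightarrow> real"
    and X :: "nat \<Rightarrow> real^'d"
    and \<beta>0 :: "real^'d"
    and \<pi> :: "real^'d \<Rightarrow> real"
    and S V :: "real^'d^'d"
    and c1 :: 'd
  assumes tau: "0 < \<tau>" "\<tau> < 1"
    and prob: "prob_space M"
    and indep: "prob_space.indep_vars M (\<lambda>_. borel) Y {1..}"
    and p_nonneg: "\<And>i y. i \<ge> 1 \<Longrightarrow> 0 \<le> p i y"
    and Y_density: "\<And>i. i \<ge> 1 \<Longrightarrow> distributed M lborel (Y i) (\<lambda>y. ennreal (p i y))"
    and Z: "\<And>i \<omega>. Z i \<omega> = Y i \<omega> - X i \<bullet> \<beta>0"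
    and quantile: "\<And>i. i \<ge> 1 \<Longrightarrow> measure M {\<omega> \<in> space M. Z i \<omega> \<le> 0} = \<tau>"
    and S_lim: "(\<lambda>n. S_emp X n) \<longlonglongrightarrow> S"
    and V_lim: "(\<lambda>n. (1 / real n) *\<^sub>R (\<Sum>i=1..n. p i (X i \<bullet> \<beta>0) *\<^sub>R outer_square (X i))) \<longlonglongrightarrow> V"
    and S_inv: "invertible S"
    and V_inv: "invertible V"
    and A1a: "\<And>\<beta>. 0 \<le> \<pi> \<beta>" "(\<integral>\<^sup>+ \<beta>. ennreal (\<pi> \<beta>) \<partial>lborel) = 1"
      "bounded (range \<pi>)" "continuous_on UNIV \<pi>" "0 < \<pi> \<beta>0"
    and A1b: "(\<integral>\<^sup>+ \<beta>. ennreal ((norm \<beta>)\<^sup>2 * \<pi> \<beta>) \<partial>lborel) < \<infinity>"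
    and A2: "\<exists>K>0. \<forall>i\<ge>1. norm (X i) \<le> K"
    and A3a: "\<And>i. i \<ge> 1 \<Longrightarrow> X i $ c1 = 1"
      "\<exists>c. c $ c1 = 0 \<and> (\<exists>\<epsilon>0>0. \<forall>D \<in> orthant_cells c1 \<epsilon>0.
         0 < liminf (\<lambda>n. ereal ((1 / real n) * (\<Sum>i=1..n. indicator D (X i - c)))))"
    and A3b: "\<exists>C>0. \<forall>\<^sub>F \<Delta> in at_right 0. \<forall>i\<ge>1.
         measure M {\<omega> \<in> space M. 0 < Z i \<omega> \<and> Z i \<omega> < \<Delta>} > C * \<Delta> \<and>
         measure M {\<omega> \<in> space M. - \<Delta> < Z i \<omega> \<and> Z i \<omega> < 0} > C * \<Delta>"
    and A4: "limsup (\<lambda>m. (\<Sum>i=1..m. \<integral>\<^sup>+ \<omega>. ennreal \<bar>Z i \<omega>\<bar> \<partial>M) / of_nat m) < \<infinity>"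
      "(\<Sum>i. (\<integral>\<^sup>+ \<omega>. ennreal ((Z (Suc i) \<omega>)\<^sup>2) \<partial>M) / of_nat ((Suc i)\<^sup>2)) < \<infinity>"
    and A5a: "\<exists>K. \<forall>i\<ge>1. p i (X i \<bullet> \<beta>0) \<le> K"
    and A5b: "\<exists>C>0. \<exists>\<eta>>0. \<forall>\<^sub>F \<beta> in nhds \<beta>0. \<forall>i\<ge>1.
         \<bar>p i (X i \<bullet> \<beta>) - p i (X i \<bullet> \<beta>0)\<bar> \<le> C * \<bar>X i \<bullet> \<beta> - X i \<bullet> \<beta>0\<bar> powr \<eta>"
  shows "tendsto_in_prob M
      (\<lambda>n \<omega>. SUP B \<in> sets borel.
         \<bar>measure (ald_posterior \<tau> X \<pi> n (\<lambda>i. Y i \<omega>)) {\<beta>. sqrt (real n) *\<^sub>R (\<beta> - \<beta>0) \<in> B}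
          - measure (mvnormal (sqrt (real n) *\<^sub>R (beta_tilde \<tau> X \<pi> n (\<lambda>i. Y i \<omega>) - \<beta>0))
              (matrix_inv V)) B\<bar>) 0
    \<and> tendsto_in_prob M
      (\<lambda>n \<omega>. SUP B \<in> sets borel.
         \<bar>measure (sandwich_posterior \<tau> X \<pi> n (\<lambda>i. Y i \<omega>)) {\<beta>. sqrt (real n) *\<^sub>R (\<beta> - \<beta>0) \<in> B}
          - measure (mvnormal (sqrt (real n) *\<^sub>R (beta_tilde \<tau> X \<pi> n (\<lambda>i. Y i \<omega>) - \<beta>0))
              (sandwich \<tau> V S)) B\<bar>) 0"
proof -
  interpret prob_space M by (rule prob)
  interpret quantile_model M \<tau> Y p X \<beta>0 \<pi> S V c1
    using tau indep p_nonneg Y_density quantile[unfolded Z] S_lim V_lim S_inv V_inv A1a A1b A2 A3a(1) A5b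
    by unfold_locales
  note ald = tv_dist_tendsto_in_prob[OF _ pos_def_matrix_inv[OF pos_def_V] local_density_measurable
      local_density_facts(1) sequence_limits(1)]
  note sandwich = tv_dist_tendsto_in_prob[OF _ pos_def_sandwich[OF pos_def_V pos_def_S tau] sandwich_density_measurable
      sandwich_density_facts(1) sequence_limits(2)]
  \<comment> \<open>What remains is to see that the displayed suprema are distances between local
    laws: the event for \<open>\<beta>\<close> becomes the set \<open>B\<close> for the local
    parameter, and the rescaled posterior mean becomes \<open>local_mean\<close>.\<close>
  show ?thesis
    by (rule conjI[OF ald sandwich])
       (auto intro!: SUP_cong simp: local_density_facts(4,5) sandwich_density_facts(3) local_mean_def)
qed

end
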